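(* In the algebra $\mathbb C[[\mathrm{Mat}_{mn}\times\overline{\mathrm{Mat}}_{mn}]]_q$ the elements $\chi_k$, $k=1,\dots,m$, pairwise commute, and for all $\lambda\in\mathbb C$ $$K_\lambda=\prod_{j=0}^\infty\Bigl(1+\sum_{k=1}^m(-q^{2(\lambda+j)})^k\chi_k\Bigr)\cdot\Bigl(\prod_{j=0}^\infty\Bigl(1+\sum_{k=1}^m(-q^{2j})^k\chi_k\Bigr)\Bigr)^{-1}.$$
   Context: Notation: $q\in(0,1)$; $1\le m\le n$ integers; $N=m+n$. $\mathrm{Pol}(\mathrm{Mat}_{mn})_q$ is the unital $*$-algebra over $\mathbb C$ with generators $z_a^\alpha$ ($1\le a\le n$, $1\le\alpha\le m$) and relations: $z_a^\alpha z_b^\beta=q z_b^\beta z_a^\alpha$ if ($a=b$, $\alpha<\beta$) or ($a<b$, $\alpha=\beta$); $z_a^\alpha z_b^\beta=z_b^\beta z_a^\alpha$ if $\alpha<\beta$, $a>b$; $z_a^\alpha z_b^\beta-z_b^\beta z_a^\alpha=(q-q^{-1})z_a^\beta z_b^\alpha$ if $\alpha<\beta$, $a<b$; and $$(z_b^\beta)^*z_a^\alpha=q^2\sum_{a',b'=1}^n\sum_{\alpha',\beta'=1}^m R_{ba}^{b'a'}R_{\beta\alpha}^{\beta'\alpha'}z_{a'}^{\alpha'}(z_{b'}^{\beta'})^*+(1-q^2)\delta_{ab}\delta^{\alpha\beta},$$ where $R_{ij}^{kl}=q^{-1}$ if $i\ne j,\ i=k,\ j=l$; $=1$ if $i=j=k=l$;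 $=-(q^{-2}-1)$ if $i=j,\ k=l,\ l>j$; $=0$ otherwise. $\mathbb C[\mathrm{Mat}_{mn}]_q$ (resp. $\mathbb C[\overline{\mathrm{Mat}}_{mn}]_q$) is the unital subalgebra generated by all $z_a^\alpha$ (resp. all $(z_a^\alpha)^*$), graded by $\deg z_a^\alpha=1$ (resp. $\deg (z_a^\alpha)^*=-1$), with homogeneous components $\mathbb C[\mathrm{Mat}_{mn}]_{q,k}$, $\mathbb C[\overline{\mathrm{Mat}}_{mn}]_{q,-k}$, $k\ge0$. For $J'=\{\alpha_1<\dots<\alpha_k\}\subset\{1,\dots,m\}$, $J''=\{a_1<\dots<a_k\}\subset\{1,\dots,n\}$ put $z^{\wedge k\,J'}_{\quad J''}=\sum_{s\in S_k}(-q)^{l(s)}z_{a_1}^{\alpha_{s(1)}}\cdots z_{a_k}^{\alpha_{s(k)}}$, with $l(s)$ the number of inversions of $s$. $\mathbb C[\mathrm{Mat}_{mn}]_q^{\rm op}$ is $\mathbb C[\mathrm{Mat}_{mn}]_q$ with opposite multiplication. $\mathbb C[[\mathrm{Mat}_{mn}\times\overline{\mathrm{Mat}}_{mn}]]_q$ is the algebra of formal series $K=\sum_{i,j\ge0}K^{(i,j)}$, $K^{(i,j)}\in\mathbb C[\mathrm{Mat}_{mn}]^{\rm op}_{q,i}\otimes\mathbb C[\overline{\mathrm{Mat}}_{mn}]_{q,-j}$ (the completion of $\mathbb C[\mathrm{Mat}_{mn}]^{\rm op}_q\otimes\mathbb C[\overline{\mathrm{Mat}}_{mn}]_q$), with the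 topology of coefficientwise convergence; infinite products converge in this topology. Put $$\chi_k=\sum_{J'\subset\{1,\dots,m\},\,|J'|=k}\ \sum_{J''\subset\{1,\dots,n\},\,|J''|=k}z^{\wedge k\,J'}_{\quad J''}\otimes\bigl(z^{\wedge k\,J'}_{\quad J''}\bigr)^*,$$ and for $l\in\{-1,-2,\dots\}$ $$K_l=\Bigl(1+\sum_{k=1}^m(-q^{2l})^k\chi_k\Bigr)\Bigl(1+\sum_{k=1}^m(-q^{2(l+1)})^k\chi_k\Bigr)\cdots\Bigl(1+\sum_{k=1}^m(-q^{-2})^k\chi_k\Bigr).$$ A polynomial kernel is a formal series $K(u)=\sum_{i,j\ge 0} K(u)^{(i,j)}$ with $K(u)^{(i,j)}\in\mathbb C[\mathrm{Mat}_{mn}]^{\rm op}_{q,i}\otimes\mathbb C[\overline{\mathrm{Mat}}_{mn}]_{q,-j}\otimes\mathbb C[u]$. Let $K(u)$ be the unique polynomial kernel with $K(q^{2l})=K_l$ for all $l\in\{-1,-2,\dots\}$. For $\lambda\in\mathbb C$ put $K_\lambda=K(q^{2\lambda})$. *)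

theory Defs
  imports
    "HOL-Analysis.Complex_Transcendental"
    "HOL-Algebra.QuotRing"
    "HOL-Algebra.Module"
    "HOL-Combinatorics.Permutations"
    "HOL-Library.Poly_Mapping"
begin

section \<open>Complex algebras\<close>

text \<open>
  Complex algebras are records of type \<open>(complex, 'a) module\<close>. The algebra \<open>monoid_algebra M\<close> is
  \<open>\<complex>[M]\<close>, the vector space with basis the carrier of \<open>M\<close> and the bilinear extension of the
  multiplication of \<open>M\<close>.
\<close>

definition monoid_algebra :: "('w, 'c) monoid_scheme \<Rightarrow> (complex, 'w \<Rightarrow>\<^sub>0 complex) module" where
  "monoid_algebra M =
    \<lparr>carrier = {f. Poly_Mapping.keys f \<subseteq> carrier M},
     mult = (\<lambda>f g. \<Sum>x\<in>Poly_Mapping.keys f. \<Sum>y\<in>Poly_Mapping.keys g.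
       Poly_Mapping.single (x \<otimes>\<^bsub>M\<^esub> y) (Poly_Mapping.lookup f x * Poly_Mapping.lookup g y)),
     one = Poly_Mapping.single \<one>\<^bsub>M\<^esub> 1,
     zero = 0,
     add = (+),
     smult = (\<lambda>c. Poly_Mapping.map ((*) c))\<rparr>"

definition free_algebra :: "'g set \<Rightarrow> (complex, 'g list \<Rightarrow>\<^sub>0 complex) module" where
  "free_algebra G = monoid_algebra \<lparr>carrier = lists G, mult = (@), one = []\<rparr>"

definition quotient_algebra :: "(complex, 'a) module \<Rightarrow> 'a set \<Rightarrow> (complex, 'a set) module" where
  "quotient_algebra A I =
    \<lparr>carrier = carrier (A Quot I),
     mult = mult (A Quot I),
     one = one (A Quot I),
     zero = zero (A Quot I),
     add = add (A Quot I),
     smult = (\<lambda>c X. \<Union>x\<in>X. I +>\<^bsub>A\<^esub> (c \<odot>\<^bsub>A\<^esub> x))\<rparr>"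

definition opposite_algebra :: "(complex, 'a) module \<Rightarrow> (complex, 'a) module" where
  "opposite_algebra A = A\<lparr>mult := \<lambda>x y. y \<otimes>\<^bsub>A\<^esub> x\<rparr>"

inductive_set linear_span :: "(complex, 'a) module \<Rightarrow> 'a set \<Rightarrow> 'a set"
  for A :: "(complex, 'a) module" and S :: "'a set" where
  zero: "\<zero>\<^bsub>A\<^esub> \<in> linear_span A S"
| add: "\<lbrakk>x \<in> linear_span A S; s \<in> S\<rbrakk> \<Longrightarrow> x \<oplus>\<^bsub>A\<^esub> (c \<odot>\<^bsub>A\<^esub> s) \<in> linear_span A S"

inductive_set generated_subalgebra :: "(complex, 'a) module \<Rightarrow> 'a set \<Rightarrow> 'a set"
  for A :: "(complex, 'a) module" and S :: "'a set" where
  one: "\<one>\<^bsub>A\<^esub> \<in> generated_subalgebra A S"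
| gen: "s \<in> S \<Longrightarrow> s \<in> generated_subalgebra A S"
| add: "\<lbrakk>x \<in> generated_subalgebra A S; y \<in> generated_subalgebra A S\<rbrakk>
         \<Longrightarrow> x \<oplus>\<^bsub>A\<^esub> y \<in> generated_subalgebra A S"
| mult: "\<lbrakk>x \<in> generated_subalgebra A S; y \<in> generated_subalgebra A S\<rbrakk>
         \<Longrightarrow> x \<otimes>\<^bsub>A\<^esub> y \<in> generated_subalgebra A S"
| smult: "x \<in> generated_subalgebra A S \<Longrightarrow> c \<odot>\<^bsub>A\<^esub> x \<in> generated_subalgebra A S"

definition list_prod :: "(complex, 'a) module \<Rightarrow> 'a list \<Rightarrow> 'a" where
  "list_prod A xs = foldr (mult A) xs \<one>\<^bsub>A\<^esub>"

definition homogeneous_component :: "(complex, 'a) module \<Rightarrow> 'a set \<Rightarrow> nat \<Rightarrow> 'a set" where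
  "homogeneous_component A S k = linear_span A (list_prod A ` {xs. set xs \<subseteq> S \<and> length xs = k})"

text \<open>
  The tensor product of two algebras is the vector space with basis the pairs \<open>(a, b)\<close>, modulo the
  bilinearity relations. The span of these relations is closed under multiplication by pairs, so it
  is the ideal that they generate.
\<close>

definition tensor_ideal ::
  "(complex, 'a) module \<Rightarrow> (complex, 'b) module \<Rightarrow> ('a \<times> 'b \<Rightarrow>\<^sub>0 complex) set" where
  "tensor_ideal A B = Idl\<^bsub>monoid_algebra (A \<times>\<times> B)\<^esub>
    ({Poly_Mapping.single (a \<oplus>\<^bsub>A\<^esub> a', b) 1
        - Poly_Mapping.single (a, b) 1 - Poly_Mapping.single (a', b) 1 | a a' b.
        a \<in> carrier A \<and> a' \<in> carrier A \<and> b \<in> carrier B} \<union>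
     {Poly_Mapping.single (a, b \<oplus>\<^bsub>B\<^esub> b') 1
        - Poly_Mapping.single (a, b) 1 - Poly_Mapping.single (a, b') 1 | a b b'.
        a \<in> carrier A \<and> b \<in> carrier B \<and> b' \<in> carrier B} \<union>
     {Poly_Mapping.single (c \<odot>\<^bsub>A\<^esub> a, b) 1 - Poly_Mapping.single (a, b) c | a b c.
        a \<in> carrier A \<and> b \<in> carrier B} \<union>
     {Poly_Mapping.single (a, c \<odot>\<^bsub>B\<^esub> b) 1 - Poly_Mapping.single (a, b) c | a b c.
        a \<in> carrier A \<and> b \<in> carrier B})"

definition tensor_algebra ::
  "(complex, 'a) module \<Rightarrow> (complex, 'b) module \<Rightarrow> (complex, ('a \<times> 'b \<Rightarrow>\<^sub>0 complex) set) module" where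
  "tensor_algebra A B = quotient_algebra (monoid_algebra (A \<times>\<times> B)) (tensor_ideal A B)"

definition pure_tensor ::
  "(complex, 'a) module \<Rightarrow> (complex, 'b) module \<Rightarrow> 'a \<Rightarrow> 'b \<Rightarrow> ('a \<times> 'b \<Rightarrow>\<^sub>0 complex) set" where
  "pure_tensor A B a b =
    tensor_ideal A B +>\<^bsub>monoid_algebra (A \<times>\<times> B)\<^esub> Poly_Mapping.single (a, b) 1"


section \<open>The algebra of polynomials on quantum matrices\<close>

text \<open>
  \<open>Z a \<alpha>\<close> stands for the generator \<open>z\<close> with lower index \<open>a \<in> {1..n}\<close> and upper index
  \<open>\<alpha> \<in> {1..m}\<close>, and \<open>Zstar a \<alpha>\<close> for its adjoint.
\<close>

datatype gen = Z nat nat | Zstar nat nat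

definition generators :: "nat \<Rightarrow> nat \<Rightarrow> gen set" where
  "generators m n =
    {Z a \<alpha> | a \<alpha>. a \<in> {1..n} \<and> \<alpha> \<in> {1..m}} \<union> {Zstar a \<alpha> | a \<alpha>. a \<in> {1..n} \<and> \<alpha> \<in> {1..m}}"

fun gen_star :: "gen \<Rightarrow> gen" where
  "gen_star (Z a \<alpha>) = Zstar a \<alpha>"
| "gen_star (Zstar a \<alpha>) = Z a \<alpha>"

definition free_star :: "(gen list \<Rightarrow>\<^sub>0 complex) \<Rightarrow> (gen list \<Rightarrow>\<^sub>0 complex)" where
  "free_star f = (\<Sum>w\<in>Poly_Mapping.keys f. Poly_Mapping.single (rev (map gen_star w)) (cnj (Poly_Mapping.lookup f w)))"

text \<open>\<open>R_coeff q i j k l\<close> has lower indices \<open>i, j\<close> and upper indices \<open>k, l\<close>.\<close>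

definition R_coeff :: "real \<Rightarrow> nat \<Rightarrow> nat \<Rightarrow> nat \<Rightarrow> nat \<Rightarrow> real" where
  "R_coeff q i j k l =
    (if i \<noteq> j \<and> i = k \<and> j = l then inverse q
     else if i = j \<and> j = k \<and> k = l then 1
     else if i = j \<and> k = l \<and> l > j then - (inverse (q\<^sup>2) - 1)
     else 0)"

definition mat_relations :: "real \<Rightarrow> nat \<Rightarrow> nat \<Rightarrow> (gen list \<Rightarrow>\<^sub>0 complex) set" where
  "mat_relations q m n =
    {Poly_Mapping.single [Z a \<alpha>, Z b \<beta>] 1
       - Poly_Mapping.single [Z b \<beta>, Z a \<alpha>] (of_real q) | a b \<alpha> \<beta>.
       a \<in> {1..n} \<and> b \<in> {1..n} \<and> \<alpha> \<in> {1..m} \<and> \<beta> \<in> {1..m} \<and> (a = b \<and> \<alpha> < \<beta> \<or> a < b \<and> \<alpha> = \<beta>)} \<union>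
    {Poly_Mapping.single [Z a \<alpha>, Z b \<beta>] 1 - Poly_Mapping.single [Z b \<beta>, Z a \<alpha>] 1 | a b \<alpha> \<beta>.
       a \<in> {1..n} \<and> b \<in> {1..n} \<and> \<alpha> \<in> {1..m} \<and> \<beta> \<in> {1..m} \<and> \<alpha> < \<beta> \<and> a > b} \<union>
    {Poly_Mapping.single [Z a \<alpha>, Z b \<beta>] 1 - Poly_Mapping.single [Z b \<beta>, Z a \<alpha>] 1
       - Poly_Mapping.single [Z a \<beta>, Z b \<alpha>] (of_real (q - inverse q)) | a b \<alpha> \<beta>.
       a \<in> {1..n} \<and> b \<in> {1..n} \<and> \<alpha> \<in> {1..m} \<and> \<beta> \<in> {1..m} \<and> \<alpha> < \<beta> \<and> a < b} \<union>
    {Poly_Mapping.single [Zstar b \<beta>, Z a \<alpha>] 1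
       - (\<Sum>a'\<in>{1..n}. \<Sum>b'\<in>{1..n}. \<Sum>\<alpha>'\<in>{1..m}. \<Sum>\<beta>'\<in>{1..m}.
            Poly_Mapping.single [Z a' \<alpha>', Zstar b' \<beta>']
              (of_real (q\<^sup>2 * R_coeff q b a b' a' * R_coeff q \<beta> \<alpha> \<beta>' \<alpha>')))
       - Poly_Mapping.single [] (if a = b \<and> \<alpha> = \<beta> then of_real (1 - q\<^sup>2) else 0) | a b \<alpha> \<beta>.
       a \<in> {1..n} \<and> b \<in> {1..n} \<and> \<alpha> \<in> {1..m} \<and> \<beta> \<in> {1..m}}"

text \<open>
  A presentation as a star-algebra imposes the relations together with their adjoints; the resulting
  ideal is invariant under \<open>free_star\<close>, so the involution maps cosets to cosets.
\<close>

definition pol_ideal :: "real \<Rightarrow> nat \<Rightarrow> nat \<Rightarrow> (gen list \<Rightarrow>\<^sub>0 complex) set" where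
  "pol_ideal q m n =
    Idl\<^bsub>free_algebra (generators m n)\<^esub> (mat_relations q m n \<union> free_star ` mat_relations q m n)"

type_synonym pol = "(gen list \<Rightarrow>\<^sub>0 complex) set"

definition Pol_Mat :: "real \<Rightarrow> nat \<Rightarrow> nat \<Rightarrow> (complex, pol) module" where
  "Pol_Mat q m n = quotient_algebra (free_algebra (generators m n)) (pol_ideal q m n)"

definition pol_star :: "pol \<Rightarrow> pol" where
  "pol_star X = free_star ` X"

definition z_gen :: "real \<Rightarrow> nat \<Rightarrow> nat \<Rightarrow> nat \<Rightarrow> nat \<Rightarrow> pol" where
  "z_gen q m n a \<alpha> = pol_ideal q m n +>\<^bsub>free_algebra (generators m n)\<^esub> Poly_Mapping.single [Z a \<alpha>] 1"

definition z_set :: "real \<Rightarrow> nat \<Rightarrow> nat \<Rightarrow> pol set" where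
  "z_set q m n = {z_gen q m n a \<alpha> | a \<alpha>. a \<in> {1..n} \<and> \<alpha> \<in> {1..m}}"

definition Mat_algebra :: "real \<Rightarrow> nat \<Rightarrow> nat \<Rightarrow> (complex, pol) module" where
  "Mat_algebra q m n =
    (Pol_Mat q m n)\<lparr>carrier := generated_subalgebra (Pol_Mat q m n) (z_set q m n)\<rparr>"

definition Matbar_algebra :: "real \<Rightarrow> nat \<Rightarrow> nat \<Rightarrow> (complex, pol) module" where
  "Matbar_algebra q m n =
    (Pol_Mat q m n)\<lparr>carrier := generated_subalgebra (Pol_Mat q m n) (pol_star ` z_set q m n)\<rparr>"

definition Mat_component :: "real \<Rightarrow> nat \<Rightarrow> nat \<Rightarrow> nat \<Rightarrow> pol set" where
  "Mat_component q m n i = homogeneous_component (Pol_Mat q m n) (z_set q m n) i"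

text \<open>\<open>Matbar_component q m n j\<close> is the component of degree \<open>-j\<close>.\<close>

definition Matbar_component :: "real \<Rightarrow> nat \<Rightarrow> nat \<Rightarrow> nat \<Rightarrow> pol set" where
  "Matbar_component q m n j = homogeneous_component (Pol_Mat q m n) (pol_star ` z_set q m n) j"

definition inversion_number :: "nat \<Rightarrow> (nat \<Rightarrow> nat) \<Rightarrow> nat" where
  "inversion_number k s = card {(i, j). i < j \<and> j < k \<and> s i > s j}"

text \<open>Positions in the sorted lists of \<open>J'\<close> and \<open>J''\<close> are counted from \<open>0\<close>.\<close>

definition q_minor :: "real \<Rightarrow> nat \<Rightarrow> nat \<Rightarrow> nat \<Rightarrow> nat set \<Rightarrow> nat set \<Rightarrow> pol" where
  "q_minor q m n k J' J'' = (\<Oplus>\<^bsub>Pol_Mat q m n\<^esub> s \<in> {s. s permutes {..<k}}.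
    of_real ((- q) ^ inversion_number k s) \<odot>\<^bsub>Pol_Mat q m n\<^esub>
    list_prod (Pol_Mat q m n)
      (map (\<lambda>i. z_gen q m n (sorted_list_of_set J'' ! i) (sorted_list_of_set J' ! s i)) [0..<k]))"


section \<open>Formal series\<close>

type_synonym kern = "(pol \<times> pol \<Rightarrow>\<^sub>0 complex) set"
type_synonym series = "nat \<Rightarrow> nat \<Rightarrow> kern"

definition kernel_algebra :: "real \<Rightarrow> nat \<Rightarrow> nat \<Rightarrow> (complex, kern) module" where
  "kernel_algebra q m n =
    tensor_algebra (opposite_algebra (Mat_algebra q m n)) (Matbar_algebra q m n)"

definition ktensor :: "real \<Rightarrow> nat \<Rightarrow> nat \<Rightarrow> pol \<Rightarrow> pol \<Rightarrow> kern" where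
  "ktensor q m n = pure_tensor (opposite_algebra (Mat_algebra q m n)) (Matbar_algebra q m n)"

definition kernel_component :: "real \<Rightarrow> nat \<Rightarrow> nat \<Rightarrow> nat \<Rightarrow> nat \<Rightarrow> kern set" where
  "kernel_component q m n i j = linear_span (kernel_algebra q m n)
    {ktensor q m n a b | a b. a \<in> Mat_component q m n i \<and> b \<in> Matbar_component q m n j}"

text \<open>A series \<open>K\<close> is represented by the family \<open>K i j\<close> of its components of bidegree \<open>(i, -j)\<close>.\<close>

definition series_algebra :: "real \<Rightarrow> nat \<Rightarrow> nat \<Rightarrow> (complex, series) module" where
  "series_algebra q m n =
    \<lparr>carrier = {K. \<forall>i j. K i j \<in> kernel_component q m n i j},
     mult = (\<lambda>K L i j. \<Oplus>\<^bsub>kernel_algebra q m n\<^esub> a \<in> {..i}. \<Oplus>\<^bsub>kernel_algebra q m n\<^esub> b \<in> {..j}.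
       K a b \<otimes>\<^bsub>kernel_algebra q m n\<^esub> L (i - a) (j - b)),
     one = (\<lambda>i j. if i = 0 \<and> j = 0
       then \<one>\<^bsub>kernel_algebra q m n\<^esub> else \<zero>\<^bsub>kernel_algebra q m n\<^esub>),
     zero = (\<lambda>i j. \<zero>\<^bsub>kernel_algebra q m n\<^esub>),
     add = (\<lambda>K L i j. K i j \<oplus>\<^bsub>kernel_algebra q m n\<^esub> L i j),
     smult = (\<lambda>c K i j. c \<odot>\<^bsub>kernel_algebra q m n\<^esub> K i j)\<rparr>"

text \<open>
  Coefficientwise convergence. The components are finite-dimensional complex vector spaces, and a
  sequence in such a space converges exactly if its image under every linear functional converges.
\<close>

definition linear_functional :: "(complex, 'a) module \<Rightarrow> 'a set \<Rightarrow> ('a \<Rightarrow> complex) \<Rightarrow> bool" where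
  "linear_functional A V \<phi> \<longleftrightarrow>
    (\<forall>x\<in>V. \<forall>y\<in>V. \<phi> (x \<oplus>\<^bsub>A\<^esub> y) = \<phi> x + \<phi> y) \<and> (\<forall>c. \<forall>x\<in>V. \<phi> (c \<odot>\<^bsub>A\<^esub> x) = c * \<phi> x)"

definition series_converges ::
  "real \<Rightarrow> nat \<Rightarrow> nat \<Rightarrow> (nat \<Rightarrow> series) \<Rightarrow> series \<Rightarrow> bool" where
  "series_converges q m n X L \<longleftrightarrow>
    (\<forall>p. X p \<in> carrier (series_algebra q m n)) \<and> L \<in> carrier (series_algebra q m n) \<and>
    (\<forall>i j \<phi>. linear_functional (kernel_algebra q m n) (kernel_component q m n i j) \<phi> \<longrightarrow>
       (\<lambda>p. \<phi> (X p i j)) \<longlonglongrightarrow> \<phi> (L i j))"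

primrec partial_product ::
  "real \<Rightarrow> nat \<Rightarrow> nat \<Rightarrow> (nat \<Rightarrow> series) \<Rightarrow> nat \<Rightarrow> series" where
  "partial_product q m n f 0 = \<one>\<^bsub>series_algebra q m n\<^esub>"
| "partial_product q m n f (Suc p) = partial_product q m n f p \<otimes>\<^bsub>series_algebra q m n\<^esub> f p"

definition has_infinite_product ::
  "real \<Rightarrow> nat \<Rightarrow> nat \<Rightarrow> (nat \<Rightarrow> series) \<Rightarrow> series \<Rightarrow> bool" where
  "has_infinite_product q m n f P \<longleftrightarrow> series_converges q m n (partial_product q m n f) P"

definition infinite_product :: "real \<Rightarrow> nat \<Rightarrow> nat \<Rightarrow> (nat \<Rightarrow> series) \<Rightarrow> series" where
  "infinite_product q m n f = (THE P. has_infinite_product q m n f P)"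


section \<open>The kernels\<close>

definition chi :: "real \<Rightarrow> nat \<Rightarrow> nat \<Rightarrow> nat \<Rightarrow> series" where
  "chi q m n k = (\<lambda>i j. if i = k \<and> j = k
     then \<Oplus>\<^bsub>kernel_algebra q m n\<^esub> J' \<in> {J'. J' \<subseteq> {1..m} \<and> card J' = k}.
            \<Oplus>\<^bsub>kernel_algebra q m n\<^esub> J'' \<in> {J''. J'' \<subseteq> {1..n} \<and> card J'' = k}.
              ktensor q m n (q_minor q m n k J' J'') (pol_star (q_minor q m n k J' J''))
     else \<zero>\<^bsub>kernel_algebra q m n\<^esub>)"

definition chi_factor :: "real \<Rightarrow> nat \<Rightarrow> nat \<Rightarrow> complex \<Rightarrow> series" where
  "chi_factor q m n t = \<one>\<^bsub>series_algebra q m n\<^esub> \<oplus>\<^bsub>series_algebra q m n\<^esub>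
    (\<Oplus>\<^bsub>series_algebra q m n\<^esub> k \<in> {1..m}. ((- t) ^ k) \<odot>\<^bsub>series_algebra q m n\<^esub> chi q m n k)"

text \<open>\<open>K_neg q m n l\<close>, for negative \<open>l\<close>, has the \<open>-l\<close> factors with exponents \<open>2l, 2(l+1), \<dots>, -2\<close>.\<close>

definition K_neg :: "real \<Rightarrow> nat \<Rightarrow> nat \<Rightarrow> int \<Rightarrow> series" where
  "K_neg q m n l =
    partial_product q m n (\<lambda>j. chi_factor q m n (of_real (q powi (2 * (l + int j))))) (nat (- l))"

text \<open>
  A polynomial kernel is given by the coefficients of its components: \<open>K i j d\<close> is the
  coefficient of \<open>u^d\<close> in the component of bidegree \<open>(i, -j)\<close>.
\<close>

type_synonym poly_kernel = "nat \<Rightarrow> nat \<Rightarrow> nat \<Rightarrow> kern"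

definition polynomial_kernel :: "real \<Rightarrow> nat \<Rightarrow> nat \<Rightarrow> poly_kernel \<Rightarrow> bool" where
  "polynomial_kernel q m n K \<longleftrightarrow>
    (\<forall>i j. (\<forall>d. K i j d \<in> kernel_component q m n i j) \<and>
           finite {d. K i j d \<noteq> \<zero>\<^bsub>kernel_algebra q m n\<^esub>})"

definition kernel_eval :: "real \<Rightarrow> nat \<Rightarrow> nat \<Rightarrow> poly_kernel \<Rightarrow> complex \<Rightarrow> series" where
  "kernel_eval q m n K u = (\<lambda>i j.
    \<Oplus>\<^bsub>kernel_algebra q m n\<^esub> d \<in> {d. K i j d \<noteq> \<zero>\<^bsub>kernel_algebra q m n\<^esub>}.
      (u ^ d) \<odot>\<^bsub>kernel_algebra q m n\<^esub> K i j d)"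

definition interpolating_kernel :: "real \<Rightarrow> nat \<Rightarrow> nat \<Rightarrow> poly_kernel" where
  "interpolating_kernel q m n = (THE K. polynomial_kernel q m n K \<and>
    (\<forall>l::int. l \<le> -1 \<longrightarrow> kernel_eval q m n K (of_real (q powi (2 * l))) = K_neg q m n l))"

definition K_lambda :: "real \<Rightarrow> nat \<Rightarrow> nat \<Rightarrow> complex \<Rightarrow> series" where
  "K_lambda q m n lam = kernel_eval q m n (interpolating_kernel q m n) (of_real q powr (2 * lam))"

text \<open>\<open>chi_product q m n lam\<close> is the product over \<open>j \<ge> 0\<close> of the factors with \<open>t = q^(2(lam+j))\<close>.\<close>

definition shifted_factor :: "real \<Rightarrow> nat \<Rightarrow> nat \<Rightarrow> complex \<Rightarrow> nat \<Rightarrow> series" where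
  "shifted_factor q m n lam j = chi_factor q m n (of_real q powr (2 * (lam + of_nat j)))"

definition chi_product :: "real \<Rightarrow> nat \<Rightarrow> nat \<Rightarrow> complex \<Rightarrow> series" where
  "chi_product q m n lam = infinite_product q m n (shifted_factor q m n lam)"

end

theory Submission
  imports Defs
begin

text \<open>
  Commutativity. Put \<open>T(a,b) = z\<close>-monomial with row word \<open>a\<close> and column word \<open>b\<close>. The Hecke algebra
  of type A acts on functions of words, and the defining relations say that the actions on the two words
  of \<open>T\<close> agree. For a linear functional \<open>\<phi>\<close> on the kernel algebra,
  \<open>\<tau>(a,a') = \<Sum>\<^sub>b \<phi>(T(a,b) \<otimes> T(a',b)\<^sup>*)\<close> therefore commutes with the Hecke algebra, so that pairing with \<open>\<tau>\<close> is
  a trace on operators. Quantum minors are the coordinates of \<open>T\<close> along \<open>q\<close>-antisymmetric vectors, and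
  \<open>\<phi>(\<chi>\<^sub>k \<chi>\<^sub>l)\<close> is the trace of the projector onto the functions that are antisymmetric in the first \<open>l\<close> and
  in the last \<open>k\<close> letters. The projectors for \<open>(l,k)\<close> and \<open>(k,l)\<close> are conjugate under a power of the
  Coxeter element, so \<open>\<phi>(\<chi>\<^sub>k \<chi>\<^sub>l) = \<phi>(\<chi>\<^sub>l \<chi>\<^sub>k)\<close>. Linear functionals separate points of the kernel algebra.

  Product formula. Let \<open>F(t)\<close> be the factor with parameter \<open>t\<close>. The series \<open>P(t)\<close> determined by
  \<open>P(t) = F(t) P(q\<^sup>2 t)\<close> and constant term \<open>1\<close> has components of bidegree \<open>(i,-i)\<close> proportional to \<open>t\<^sup>i\<close>.
  The partial products of \<open>F(t) F(q\<^sup>2 t) \<dots>\<close> are \<open>P(t) P(q\<^bsup>2p\<^esup> t)\<^sup>-\<^sup>1\<close>; they tend to \<open>P(t)\<close>, and for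
  \<open>t = q\<^bsup>2l\<^esup>\<close>, \<open>p = -l\<close> they give \<open>K\<^sub>l = P(q\<^bsup>2l\<^esup>) P(1)\<^sup>-\<^sup>1\<close>. As \<open>P(u) P(1)\<^sup>-\<^sup>1\<close> is polynomial in \<open>u\<close>, it is \<open>K(u)\<close>.
\<close>

section \<open>Hecke operators on words\<close>

text \<open>The obstacle is that the algebras are quotients by ideals for which no basis is at hand.
  Every identity in the kernel algebra is therefore tested by an arbitrary linear functional, which
  also turns iterated \<open>finsum\<close> expressions into complex sums that can be reindexed
  freely. A trace needs a sum over all column words, while a quantum minor has one sorted column
  word. The gap closes because the relations carry antisymmetry in the rows over to the columns: all
  column words with the same two letter sets contribute multiples of the sorted one, and these
  multiples add up to the normalisation of the projector. The blocks are exchanged by a power of the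
  Coxeter element because the conjugation rules then hold already for braid words and reduce to two
  rules, one raising an index and one wrapping the last index round to the first. The bound q < 1
  enters in three ways: 1 - q^(2i) is invertible, which makes the recursion for the coefficients of
  P solvable; q^(2p) t tends to 0; and the points q^(2l) are distinct, which makes the interpolation
  unique.\<close>

type_synonym word = "nat \<Rightarrow> nat"

definition swap_at :: "nat \<Rightarrow> word \<Rightarrow> word" where
  "swap_at i w = w(i := w (Suc i), Suc i := w i)"

text \<open>The standard generators of the Hecke algebra of type A, with eigenvalues \<open>Q\<close> and \<open>- inverse Q\<close>.\<close>

definition hecke :: "complex \<Rightarrow> nat \<Rightarrow> (word \<Rightarrow> complex) \<Rightarrow> word \<Rightarrow> complex" where
  "hecke Q i f w =
    (if w i = w (Suc i) then Q * f w
     else f (swap_at i w) + (if w i < w (Suc i) then (Q - inverse Q) * f w else 0))"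

lemma swap_at_swap_at [simp]: "swap_at i (swap_at i w) = w"
  by (auto simp: swap_at_def)

lemma swap_at_eq_self: "w i = w (Suc i) \<Longrightarrow> swap_at i w = w"
  by (auto simp: swap_at_def)

lemma swap_at_apply [simp]:
  "swap_at i w i = w (Suc i)" "swap_at i w (Suc i) = w i"
  "j \<noteq> i \<Longrightarrow> j \<noteq> Suc i \<Longrightarrow> swap_at i w j = w j"
  by (auto simp: swap_at_def)

lemma hecke_add: "hecke Q i (\<lambda>w. f w + g w) w = hecke Q i f w + hecke Q i g w"
  by (simp add: hecke_def algebra_simps)

lemma hecke_scale: "hecke Q i (\<lambda>w. c * f w) w = c * hecke Q i f w"
  by (simp add: hecke_def algebra_simps)

lemma hecke_sum: "hecke Q i (\<lambda>w. \<Sum>x\<in>A. f x w) w = (\<Sum>x\<in>A. hecke Q i (f x) w)"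
  by (simp add: hecke_def sum.distrib sum_distrib_left)

text \<open>The exchange of two different letters squares to the identity, and exactly one of
  \<open>w\<close> and \<open>swap_at i w\<close> carries the diagonal coefficient
  \<open>Q - inverse Q\<close>. In factored form the relation is (T - Q)(T + 1/Q) = 0.\<close>

lemma hecke_quadratic:
  assumes "Q \<noteq> 0"
  shows "hecke Q i (hecke Q i f) w = (Q - inverse Q) * hecke Q i f w + f w"
  using assms by (auto simp: hecke_def swap_at_eq_self field_simps)

lemma hecke_commute:
  assumes "Suc i < j"
  shows "hecke Q i (hecke Q j f) = hecke Q j (hecke Q i f)"
proof
  fix w
  have "swap_at i (swap_at j w) = swap_at j (swap_at i w)" for w
    using assms by (auto simp: swap_at_def)
  then show "hecke Q i (hecke Q j f) w = hecke Q j (hecke Q i f) w"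
    using assms by (simp add: hecke_def algebra_simps)
qed

text \<open>Both sides only involve values of \<open>f\<close> at words that arise from
  \<open>w\<close> by permuting three consecutive letters. Writing \<open>w\<close> as
  \<open>W a b c\<close> leaves a finite check over the relative orders of \<open>a\<close>,
  \<open>b\<close>, \<open>c\<close>.\<close>

lemma hecke_braid:
  assumes "Q \<noteq> 0"
  shows "hecke Q i (hecke Q (Suc i) (hecke Q i f)) = hecke Q (Suc i) (hecke Q i (hecke Q (Suc i) f))"
proof
  fix w :: word
  define W where "W a b c = w(i := a, Suc i := b, Suc (Suc i) := c)" for a b c
  have W [simp]: "swap_at i (W a b c) = W b a c" "swap_at (Suc i) (W a b c) = W a c b"
    "W a b c i = a" "W a b c (Suc i) = b" "W a b c (Suc (Suc i)) = c" for a b c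
    by (auto simp: W_def swap_at_def)
  have *: "hecke Q i (hecke Q (Suc i) (hecke Q i f)) (W a b c)
      = hecke Q (Suc i) (hecke Q i (hecke Q (Suc i) f)) (W a b c)" for a b c
    using assms
    by (cases a b rule: linorder_cases; cases b c rule: linorder_cases; cases a c rule: linorder_cases)
      (simp_all add: hecke_def field_simps)
  have "w = W (w i) (w (Suc i)) (w (Suc (Suc i)))" by (auto simp: W_def)
  then show "hecke Q i (hecke Q (Suc i) (hecke Q i f)) w
      = hecke Q (Suc i) (hecke Q i (hecke Q (Suc i) f)) w" using * by metis
qed

text \<open>Equality of positive braid words: neither cancellation nor the quadratic relation is
  imposed. Reversal is then an anti-automorphism, and the rules below transfer to every family of
  operators satisfying the braid relations, without reduced words or lengths.\<close>

inductive braid_equiv :: "nat list \<Rightarrow> nat list \<Rightarrow> bool" where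
  equiv_refl: "braid_equiv xs xs"
| equiv_sym: "braid_equiv xs ys \<Longrightarrow> braid_equiv ys xs"
| equiv_trans: "braid_equiv xs ys \<Longrightarrow> braid_equiv ys zs \<Longrightarrow> braid_equiv xs zs"
| far_commute: "Suc i < j \<Longrightarrow> braid_equiv (xs @ [i, j] @ ys) (xs @ [j, i] @ ys)"
| braid_move: "braid_equiv (xs @ [i, Suc i, i] @ ys) (xs @ [Suc i, i, Suc i] @ ys)"

lemma braid_equiv_rev: "braid_equiv xs ys \<Longrightarrow> braid_equiv (rev xs) (rev ys)"
proof (induction rule: braid_equiv.induct)
  case (far_commute i j xs ys)
  then show ?case using braid_equiv.equiv_sym[OF braid_equiv.far_commute[of i j "rev ys" "rev xs"]] by simp
next
  case (braid_move xs i ys)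
  then show ?case using braid_equiv.braid_move[of "rev ys" i "rev xs"] by simp
qed (auto intro: braid_equiv.intros)

lemma braid_equiv_context: "braid_equiv xs ys \<Longrightarrow> braid_equiv (us @ xs @ vs) (us @ ys @ vs)"
proof (induction rule: braid_equiv.induct)
  case (far_commute i j xs ys)
  then show ?case using braid_equiv.far_commute[of i j "us @ xs" "ys @ vs"] by simp
next
  case (braid_move xs i ys)
  then show ?case using braid_equiv.braid_move[of "us @ xs" i "ys @ vs"] by simp
qed (auto intro: braid_equiv.intros)

lemma braid_equiv_pre: "braid_equiv xs ys \<Longrightarrow> braid_equiv (us @ xs) (us @ ys)"
  using braid_equiv_context[of xs ys us "[]"] by simp

lemma braid_equiv_post: "braid_equiv xs ys \<Longrightarrow> braid_equiv (xs @ vs) (ys @ vs)"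
  using braid_equiv_context[of xs ys "[]" vs] by simp

lemma braid_equiv_commute_list:
  "(\<And>j. j \<in> set xs \<Longrightarrow> Suc i < j \<or> Suc j < i) \<Longrightarrow> braid_equiv (xs @ [i]) (i # xs)"
proof (induction xs)
  case (Cons j xs)
  have "braid_equiv ((j # xs) @ [i]) (j # i # xs)"
    using braid_equiv_pre[OF Cons.IH, of "[j]"] Cons.prems by auto
  moreover have "braid_equiv (j # i # xs) (i # j # xs)"
    using Cons.prems[of j] braid_equiv.far_commute[of i j "[]" xs] braid_equiv.far_commute[of j i "[]" xs]
      braid_equiv.equiv_sym by auto
  ultimately show ?case by (auto intro: braid_equiv.equiv_trans)
qed (auto intro: braid_equiv.equiv_refl)

text \<open>Conjugation by the Coxeter element raises an index by one. The letter \<open>i\<close>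
  slides left past the letters of \<open>?B\<close>, which are all larger than \<open>Suc i\<close>;
  a braid move turns it into \<open>Suc i\<close>, and that slides past the letters of
  \<open>?A\<close>, which are all smaller than \<open>i\<close>.\<close>

lemma coxeter_shift:
  assumes "Suc (Suc i) < N"
  shows "braid_equiv ([0..<N - 1] @ [i]) (Suc i # [0..<N - 1])"
proof -
  let ?A = "[0..<i]" and ?B = "[Suc (Suc i)..<N - 1]"
  have split: "[0..<N - 1] = ?A @ [i, Suc i] @ ?B"
  proof -
    have "[0..<N - 1] = [0..<i] @ [i..<N - 1]"
      using assms upt_add_eq_append[of 0 i "N - 1 - i"] by simp
    also have "[i..<N - 1] = i # Suc i # ?B"
      using assms by (simp add: upt_conv_Cons)
    finally show ?thesis by simp
  qed
  have "braid_equiv ([0..<N - 1] @ [i]) ((?A @ [i, Suc i]) @ i # ?B)"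
    unfolding split using braid_equiv_pre[OF braid_equiv_commute_list[of ?B i], of "?A @ [i, Suc i]"]
    by auto
  also have "braid_equiv ((?A @ [i, Suc i]) @ i # ?B) (?A @ [Suc i, i, Suc i] @ ?B)"
    using braid_equiv.braid_move[of ?A i ?B] by simp
  also (braid_equiv.equiv_trans) have "braid_equiv (?A @ [Suc i, i, Suc i] @ ?B) (Suc i # ?A @ [i, Suc i] @ ?B)"
    using braid_equiv_post[OF braid_equiv_commute_list[of ?A "Suc i"], of "[i, Suc i] @ ?B"] by auto
  finally (braid_equiv.equiv_trans) show ?thesis using split by simp
qed

lemma coxeter_shift_list:
  assumes "\<And>i. i \<in> set xs \<Longrightarrow> Suc (Suc i) < N"
  shows "braid_equiv ([0..<N - 1] @ xs) (map Suc xs @ [0..<N - 1])"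
  using assms
proof (induction xs)
  case (Cons i xs)
  have "braid_equiv ([0..<N - 1] @ i # xs) (Suc i # [0..<N - 1] @ xs)"
    using braid_equiv_post[OF coxeter_shift[of i N], of xs] Cons.prems by simp
  moreover have "braid_equiv (Suc i # [0..<N - 1] @ xs) (Suc i # map Suc xs @ [0..<N - 1])"
    using braid_equiv_pre[OF Cons.IH, of "[Suc i]"] Cons.prems by simp
  ultimately have "braid_equiv ([0..<N - 1] @ i # xs) (Suc i # map Suc xs @ [0..<N - 1])"
    by (rule braid_equiv.equiv_trans)
  then show ?case by simp
qed (auto intro: braid_equiv.equiv_refl)

text \<open>The last generator has no successor, so one Coxeter word does not conjugate it to a
  generator, but two conjugate it to the first one. Shifting \<open>[0..<N - 2]\<close> through one
  Coxeter word and adding \<open>0\<close> in front and \<open>N - 2\<close> behind completes the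
  shifted and the unshifted piece to full Coxeter words.\<close>

lemma coxeter_wrap:
  assumes "2 \<le> N"
  shows "braid_equiv ([0..<N - 1] @ [0..<N - 1] @ [N - 2]) (0 # [0..<N - 1] @ [0..<N - 1])"
proof -
  let ?d = "[0..<N - 1]"
  have last: "?d = [0..<N - 2] @ [N - 2]"
    using assms upt_Suc_append[of 0 "N - 2"] by (simp add: Suc_diff_Suc numeral_2_eq_2)
  have first: "?d = 0 # map Suc [0..<N - 2]"
    using assms by (simp add: map_Suc_upt upt_conv_Cons numeral_2_eq_2 Suc_diff_Suc)
  then have first': "0 # map Suc [0..<N - 2] @ ys = ?d @ ys" for ys
    by (metis append_Cons)
  have "braid_equiv (?d @ [0..<N - 2]) (map Suc [0..<N - 2] @ ?d)"
    by (rule coxeter_shift_list) auto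
  then have "braid_equiv (0 # ?d @ [0..<N - 2] @ [N - 2]) (0 # map Suc [0..<N - 2] @ ?d @ [N - 2])"
    using braid_equiv_context[of "?d @ [0..<N - 2]" "map Suc [0..<N - 2] @ ?d" "[0]" "[N - 2]"] by simp
  then have "braid_equiv (0 # ?d @ ?d) (?d @ ?d @ [N - 2])"
    unfolding last[symmetric] by (simp only: first' append.assoc)
  then show ?thesis by (rule braid_equiv.equiv_sym)
qed

text \<open>The \<open>k\<close>-th power of the Coxeter element. Conjugation by it exchanges the generators of a block of
  length \<open>N - k\<close> followed by one of length \<open>k\<close>.\<close>

definition block_swap :: "nat \<Rightarrow> nat \<Rightarrow> nat list" where
  "block_swap N k = concat (replicate k [0..<N - 1])"

lemma block_swap_0 [simp]: "block_swap N 0 = []"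
  and block_swap_Suc: "block_swap N (Suc k) = [0..<N - 1] @ block_swap N k"
  by (simp_all add: block_swap_def)

lemma block_swap_add: "block_swap N (j + k) = block_swap N j @ block_swap N k"
  by (simp add: block_swap_def replicate_add)

lemma block_swap_shift:
  "i + k + 1 < N \<Longrightarrow> braid_equiv (block_swap N k @ [i]) ((i + k) # block_swap N k)"
proof (induction k)
  case (Suc k)
  have "braid_equiv (block_swap N (Suc k) @ [i]) ([0..<N - 1] @ (i + k) # block_swap N k)"
    using braid_equiv_pre[OF Suc.IH, of "[0..<N - 1]"] Suc.prems by (simp add: block_swap_Suc)
  moreover have "braid_equiv ([0..<N - 1] @ (i + k) # block_swap N k)
      (Suc (i + k) # [0..<N - 1] @ block_swap N k)"
    using braid_equiv_post[OF coxeter_shift[of "i + k" N], of "block_swap N k"] Suc.prems by simp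
  ultimately have "braid_equiv (block_swap N (Suc k) @ [i]) (Suc (i + k) # [0..<N - 1] @ block_swap N k)"
    by (rule braid_equiv.equiv_trans)
  then show ?case by (simp add: block_swap_Suc)
qed (auto intro: braid_equiv.equiv_refl)

lemma block_swap_wrap:
  assumes "Suc j < k"
  shows "braid_equiv (block_swap (l + k) k @ [l + j]) (j # block_swap (l + k) k)"
proof -
  let ?N = "l + k"
  \<comment> \<open>Read from the right, \<open>r\<close> Coxeter words raise \<open>l + j\<close>
    to the last index \<open>l + k - 2\<close>, two more wrap it to \<open>0\<close>, and the
    remaining \<open>j\<close> raise it to \<open>j\<close>; hence k = j + 2 + r.\<close>
  define r where "r = k - 2 - j"
  have k: "k = j + (2 + r)" using assms by (simp add: r_def)
  have "braid_equiv (block_swap ?N r @ [l + j]) ((?N - 2) # block_swap ?N r)"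
    using block_swap_shift[of "l + j" r ?N] k by (simp add: ac_simps)
  then have 1: "braid_equiv (block_swap ?N j @ block_swap ?N 2 @ block_swap ?N r @ [l + j])
     (block_swap ?N j @ block_swap ?N 2 @ (?N - 2) # block_swap ?N r)"
    by (intro braid_equiv_pre)
  have "block_swap ?N 2 = [0..<?N - 1] @ [0..<?N - 1]" by (simp add: block_swap_Suc numeral_2_eq_2)
  then have "braid_equiv (block_swap ?N 2 @ [?N - 2]) (0 # block_swap ?N 2)"
    using coxeter_wrap[of ?N] k by simp
  then have 2: "braid_equiv (block_swap ?N j @ block_swap ?N 2 @ (?N - 2) # block_swap ?N r)
      (block_swap ?N j @ 0 # block_swap ?N 2 @ block_swap ?N r)"
    using braid_equiv_context[of "block_swap ?N 2 @ [?N - 2]" "0 # block_swap ?N 2" "block_swap ?N j"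
        "block_swap ?N r"] by simp
  have "braid_equiv (block_swap ?N j @ [0]) (j # block_swap ?N j)"
    using block_swap_shift[of 0 j ?N] k by simp
  then have 3: "braid_equiv (block_swap ?N j @ 0 # block_swap ?N 2 @ block_swap ?N r)
      (j # block_swap ?N j @ block_swap ?N 2 @ block_swap ?N r)"
    using braid_equiv_post[of "block_swap ?N j @ [0]" _ "block_swap ?N 2 @ block_swap ?N r"] by fastforce
  have "block_swap ?N k = block_swap ?N j @ block_swap ?N 2 @ block_swap ?N r"
    using block_swap_add[of ?N j "2 + r"] block_swap_add[of ?N 2 r] k by simp
  then show ?thesis using braid_equiv.equiv_trans[OF 1 braid_equiv.equiv_trans[OF 2 3]] by simp
qed

text \<open>A pair \<open>(i, c)\<close> stands for the operator \<open>hecke Q i + c\<close>.\<close>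

fun hecke_word :: "complex \<Rightarrow> (nat \<times> complex) list \<Rightarrow> (word \<Rightarrow> complex) \<Rightarrow> word \<Rightarrow> complex" where
  "hecke_word Q [] f = f"
| "hecke_word Q ((i, c) # xs) f = (\<lambda>w. hecke Q i (hecke_word Q xs f) w + c * hecke_word Q xs f w)"

lemma hecke_word_append: "hecke_word Q (xs @ ys) f = hecke_word Q xs (hecke_word Q ys f)"
  by (induction xs) auto

abbreviation plain :: "nat list \<Rightarrow> (nat \<times> complex) list" where
  "plain \<equiv> map (\<lambda>i. (i, 0))"

lemma hecke_word_braid_equiv:
  assumes "Q \<noteq> 0"
  shows "braid_equiv xs ys \<Longrightarrow> hecke_word Q (plain xs) f = hecke_word Q (plain ys) f"
proof (induction arbitrary: f rule: braid_equiv.induct)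
  case (far_commute i j us vs)
  then show ?case using hecke_commute[OF far_commute] by (simp add: hecke_word_append)
next
  case (braid_move us i vs)
  then show ?case using hecke_braid[OF assms] by (simp add: hecke_word_append)
qed auto

text \<open>The quadratic relation says that T + 1/Q - Q inverts T. The constants carried by
  \<open>hecke_word\<close> exist so that the inverse of a plain word is again such a word.\<close>

lemma hecke_word_inverse:
  assumes "Q \<noteq> 0"
  shows "hecke_word Q (rev (map (\<lambda>i. (i, inverse Q - Q)) xs)) (hecke_word Q (plain xs) f) = f"
proof (induction xs arbitrary: f)
  case (Cons i xs)
  have "(\<lambda>w. hecke Q i (hecke Q i g) w + (inverse Q - Q) * hecke Q i g w) = g" for g
    by (simp add: hecke_quadratic[OF assms] algebra_simps)
  then show ?case using Cons by (simp add: hecke_word_append)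
qed simp

lemma hecke_word_inverse2:
  assumes "Q \<noteq> 0"
  shows "hecke_word Q (plain xs) (hecke_word Q (rev (map (\<lambda>i. (i, inverse Q - Q)) xs)) f) = f"
proof (induction xs arbitrary: f)
  case (Cons i xs)
  have "hecke Q i (\<lambda>w. hecke Q i g w + (inverse Q - Q) * g w) w = g w" for g w
    unfolding hecke_add hecke_scale hecke_quadratic[OF assms] by (simp add: algebra_simps)
  then have "hecke Q i (\<lambda>w. hecke Q i g w + (inverse Q - Q) * g w) = g" for g
    by blast
  then show ?case using Cons by (simp add: hecke_word_append)
qed simp

lemma hecke_word_sum:
  "hecke_word Q xs (\<lambda>w. \<Sum>x\<in>A. c x * f x w) w = (\<Sum>x\<in>A. c x * hecke_word Q xs (f x) w)"
proof (induction xs arbitrary: w)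
  case (Cons ic xs)
  obtain i d where ic: "ic = (i, d)" by force
  have "hecke_word Q xs (\<lambda>w. \<Sum>x\<in>A. c x * f x w) = (\<lambda>w. \<Sum>x\<in>A. c x * hecke_word Q xs (f x) w)"
    using Cons by auto
  then show ?case
    by (simp add: ic hecke_sum hecke_scale sum_distrib_left sum.distrib algebra_simps)
qed simp

lemma hecke_word_scale: "hecke_word Q xs (\<lambda>w. c * f w) = (\<lambda>w. c * hecke_word Q xs f w)"
  using hecke_word_sum[of Q xs "\<lambda>_. c" "\<lambda>_. f" "{()}"] by auto

lemma hecke_hecke_commute2:
  "hecke Q i (\<lambda>a. hecke Q j (X a) b) a = hecke Q j (\<lambda>b. hecke Q i (\<lambda>a. X a b) a) b"
  by (simp add: hecke_def algebra_simps)

lemma hecke_hecke_word_commute2: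
  "hecke Q i (\<lambda>a. hecke_word Q ys (X a) b) a = hecke_word Q ys (\<lambda>b. hecke Q i (\<lambda>a. X a b) a) b"
proof (induction ys arbitrary: b)
  case (Cons ic ys)
  obtain j d where ic: "ic = (j, d)" by force
  have "hecke Q i (\<lambda>a. hecke Q j (hecke_word Q ys (X a)) b) a
     = hecke Q j (\<lambda>b. hecke_word Q ys (\<lambda>b. hecke Q i (\<lambda>a. X a b) a) b) b"
    by (subst hecke_hecke_commute2) (simp add: Cons)
  then show ?case by (simp add: ic hecke_add hecke_scale Cons)
qed simp

text \<open>Operators on the first argument commute with operators on the second. Letters therefore
  cross one at a time, the innermost first, and arrive in reversed order.\<close>

lemma hecke_word_transfer:
  assumes "\<And>i a b. i \<in> fst ` set xs \<Longrightarrow> hecke Q i (\<lambda>a. X a b) a = hecke Q i (X a) b"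
  shows "hecke_word Q xs (\<lambda>a. X a b) a = hecke_word Q (rev xs) (X a) b"
  using assms
proof (induction xs arbitrary: a b)
  case (Cons ic xs)
  obtain i c where ic: "ic = (i, c)" by force
  have IH: "hecke_word Q xs (\<lambda>a. X a b) = (\<lambda>a. hecke_word Q (rev xs) (X a) b)" for b
    using Cons by auto
  have "hecke Q i (\<lambda>a. hecke_word Q (rev xs) (X a) b) a
      = hecke_word Q (rev xs) (hecke Q i (X a)) b"
    using Cons.prems by (simp add: hecke_hecke_word_commute2 ic)
  moreover have "hecke_word Q (rev xs) (\<lambda>b. hecke Q i (X a) b + c * X a b) b =
     hecke_word Q (rev xs) (hecke Q i (X a)) b + c * hecke_word Q (rev xs) (X a) b"
    using hecke_word_sum[of Q "rev xs" "\<lambda>t. if t then 1 else c" "\<lambda>t. if t then hecke Q i (X a) else X a" UNIV b]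
    by (simp add: UNIV_bool add.commute)
  ultimately show ?case by (simp add: ic IH hecke_word_append)
qed simp

definition words :: "nat \<Rightarrow> nat \<Rightarrow> word set" where
  "words N m = {..<N} \<rightarrow>\<^sub>E {1..m}"

lemma finite_words [simp]: "finite (words N m)"
  by (simp add: words_def finite_PiE)

lemma swap_at_words_iff:
  assumes "Suc i < N" shows "swap_at i w \<in> words N m \<longleftrightarrow> w \<in> words N m"
proof -
  have "swap_at i w \<in> words N m" if "w \<in> words N m" for w
    using that assms by (auto simp: words_def PiE_iff swap_at_def extensional_def)
  then show ?thesis using swap_at_swap_at by metis
qed

text \<open>In the basis of words the operator is a diagonal part \<open>d\<close> plus an exchange
  part \<open>s\<close> whose entries are 1 in both directions, so its matrix is symmetric. The
  pairing is bilinear, without complex conjugation.\<close>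

lemma hecke_symmetric:
  assumes "Suc i < N"
  shows "(\<Sum>w\<in>words N m. hecke Q i f w * g w) = (\<Sum>w\<in>words N m. f w * hecke Q i g w)"
proof -
  define d where "d f w = (if w i = w (Suc i) then Q * f w
      else if w i < w (Suc i) then (Q - inverse Q) * f w else 0)" for f :: "word \<Rightarrow> complex" and w
  define s where "s f w = (if w i = w (Suc i) then 0 else f (swap_at i w))" for f :: "word \<Rightarrow> complex" and w
  have h: "hecke Q i f w = d f w + s f w" for f w by (simp add: hecke_def d_def s_def)
  have "(\<Sum>w\<in>words N m. s f w * g w) = (\<Sum>w\<in>words N m. f w * s g w)"
    by (rule sum.reindex_bij_witness[of _ "swap_at i" "swap_at i"])
      (use assms in \<open>auto simp: swap_at_words_iff s_def\<close>)
  moreover have "d f w * g w = f w * d g w" for w by (simp add: d_def)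
  ultimately show ?thesis by (simp add: h algebra_simps sum.distrib)
qed

lemma hecke_word_adjoint:
  assumes "\<And>i. i \<in> fst ` set xs \<Longrightarrow> Suc i < N"
  shows "(\<Sum>w\<in>words N m. hecke_word Q xs f w * g w) = (\<Sum>w\<in>words N m. f w * hecke_word Q (rev xs) g w)"
  using assms
proof (induction xs arbitrary: g)
  case (Cons ic xs)
  obtain i c where ic: "ic = (i, c)" by force
  have "(\<Sum>w\<in>words N m. hecke_word Q (ic # xs) f w * g w)
     = (\<Sum>w\<in>words N m. hecke_word Q xs f w * (hecke Q i g w + c * g w))"
    using hecke_symmetric[of i N Q "hecke_word Q xs f" g m] Cons.prems
    by (simp add: ic algebra_simps sum.distrib)
  also have "\<dots> = (\<Sum>w\<in>words N m. f w * hecke_word Q (rev (ic # xs)) g w)"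
    using Cons.IH Cons.prems by (simp add: ic hecke_word_append)
  finally show ?case .
qed simp

section \<open>Block-antisymmetric functions\<close>

text \<open>The transposition \<open>t\<close> of the positions \<open>i\<close> and
  \<open>Suc i\<close> preserves the order of every other pair of positions, so it matches the
  remaining inversions of \<open>w\<close> with all inversions of the swapped word.\<close>

lemma inversion_number_swap_at:
  assumes "Suc i < k" and "w (Suc i) < w i"
  shows "inversion_number k w = Suc (inversion_number k (swap_at i w))"
proof -
  define I where "I w = {(a, b). a < b \<and> b < k \<and> w a > w b}" for w :: word
  define t where "t x = (if x = i then Suc i else if x = Suc i then i else x)" for x
  have "I w \<subseteq> {..<k} \<times> {..<k}" for w by (auto simp: I_def)
  then have fin: "finite (I w)" for w by (rule finite_subset) simp
  have tt: "t (t x) = x" for x by (simp add: t_def)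
  have sw: "swap_at i w x = w (t x)" for x by (simp add: t_def swap_at_def)
  have less: "t a < t b" if "a < b" "(a, b) \<noteq> (i, Suc i)" for a b
    using that unfolding t_def by (cases "a = i"; cases "b = i"; cases "a = Suc i") auto
  have tk: "t b < k" if "b < k" for b using that assms(1) by (simp add: t_def)
  have "bij_betw (map_prod t t) (I w - {(i, Suc i)}) (I (swap_at i w))"
  proof (rule bij_betw_byWitness[where f' = "map_prod t t"])
    show "map_prod t t ` (I w - {(i, Suc i)}) \<subseteq> I (swap_at i w)"
      by (auto simp: I_def sw tt less tk)
    have "(a, b) \<noteq> (i, Suc i)" if "(a, b) \<in> I (swap_at i w)" for a b
      using that assms(2) by (auto simp: I_def)
    moreover have "(t a, t b) \<noteq> (i, Suc i)" if "(a, b) \<in> I (swap_at i w)" for a b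
      using that by (auto simp: I_def t_def split: if_splits)
    ultimately show "map_prod t t ` I (swap_at i w) \<subseteq> I w - {(i, Suc i)}"
      by (auto simp: I_def sw less tk)
  qed (auto simp: tt)
  then have "card (I w - {(i, Suc i)}) = card (I (swap_at i w))" by (rule bij_betw_same_card)
  moreover have "(i, Suc i) \<in> I w" using assms by (simp add: I_def)
  ultimately have "card (I w) = Suc (card (I (swap_at i w)))"
    using fin by (metis card_Suc_Diff1)
  then show ?thesis by (simp add: inversion_number_def I_def)
qed

lemma inversion_number_eq_0:
  assumes "\<And>a b. a < b \<Longrightarrow> b < k \<Longrightarrow> w a \<le> w b"
  shows "inversion_number k w = 0"
proof -
  have "{(i, j). i < j \<and> j < k \<and> w i > w j} = {}" using assms leD by blast
  then show ?thesis unfolding inversion_number_def by (simp only: card.empty)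
qed

lemma no_descent_mono:
  fixes w :: word
  assumes "\<And>i. a \<le> i \<Longrightarrow> Suc i < n \<Longrightarrow> w i \<le> w (Suc i)" and "a \<le> b" and "b < n"
  shows "w a \<le> w b"
  using assms(2,3,1)
proof (induction b rule: dec_induct)
  case (step b)
  then have "w a \<le> w b" by auto
  also have "w b \<le> w (Suc b)" using step by auto
  finally show ?case .
qed simp

text \<open>If letters repeat within the block, the list is shorter than \<open>k\<close> and
  \<open>!\<close> runs past its end. This is harmless, since the sorted word is then always
  weighted with a sign that vanishes.\<close>

definition sort_block :: "nat \<Rightarrow> nat \<Rightarrow> word \<Rightarrow> word" where
  "sort_block p k w = (\<lambda>i. if p \<le> i \<and> i < p + k
     then sorted_list_of_set (w ` {p..<p + k}) ! (i - p) else w i)"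

definition append_word :: "nat \<Rightarrow> word \<Rightarrow> word \<Rightarrow> word" where
  "append_word l u v = (\<lambda>i. if i < l then u i else v (i - l))"

definition sorted_word :: "nat set \<Rightarrow> word" where
  "sorted_word J = (\<lambda>i\<in>{..<card J}. sorted_list_of_set J ! i)"

text \<open>Only the sets of letters are compared. For words that are injective on both blocks this
  means that they differ by a permutation inside each block; the other words are suppressed by the
  sign.\<close>

definition same_blocks :: "nat \<Rightarrow> nat \<Rightarrow> word \<Rightarrow> word \<Rightarrow> bool" where
  "same_blocks l k w w' \<longleftrightarrow>
    w ` {0..<l} = w' ` {0..<l} \<and> w ` {l..<l + k} = w' ` {l..<l + k}"

lemma same_blocks_sym: "same_blocks l k w w' \<longleftrightarrow> same_blocks l k w' w"
  by (auto simp: same_blocks_def)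

lemma swap_at_shift:
  "p \<le> i \<Longrightarrow> (\<lambda>j. swap_at i w (p + j)) = swap_at (i - p) (\<lambda>j. w (p + j))"
  by (rule ext) (auto simp: swap_at_def)

lemma image_swap_at:
  assumes "p \<le> i \<and> Suc i < p + k \<or> Suc i < p \<or> p + k \<le> i"
  shows "swap_at i w ` {p..<p + k} = w ` {p..<p + k}"
proof -
  have "swap_at i w ` {p..<p + k} \<subseteq> w ` {p..<p + k}" for w
    using assms by (auto simp: swap_at_def)
  from this[of w] this[of "swap_at i w"] show ?thesis by simp
qed

lemma inj_on_swap_at:
  assumes "p \<le> i" and "Suc i < p + k"
  shows "inj_on (swap_at i w) {p..<p + k} \<longleftrightarrow> inj_on w {p..<p + k}"
proof -
  have "inj_on (swap_at i w) {p..<p + k}" if "inj_on w {p..<p + k}" for w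
  proof (rule inj_onI)
    fix x y assume xy: "x \<in> {p..<p + k}" "y \<in> {p..<p + k}" "swap_at i w x = swap_at i w y"
    have w: "w x = w y \<longleftrightarrow> x = y" if "x \<in> {p..<p + k}" "y \<in> {p..<p + k}" for x y
      using that \<open>inj_on w _\<close> by (auto dest: inj_onD)
    show "x = y"
      using xy assms by (auto simp: swap_at_def w split: if_splits)
  qed
  from this[of w] this[of "swap_at i w"] show ?thesis by auto
qed

lemma same_blocks_swap_at:
  assumes "Suc i < l + k" and "Suc i \<noteq> l"
  shows "same_blocks l k (swap_at i w) w' \<longleftrightarrow> same_blocks l k w w'"
  using image_swap_at[of 0 i l w] image_swap_at[of l i k w] assms
  by (cases "Suc i < l") (auto simp: same_blocks_def)

text \<open>Positivity of \<open>q\<close> keeps q^2 + 1 and the sums of squares in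
  \<open>sign_norm\<close> away from zero. The first forces an antisymmetric function to vanish on
  repeated letters, the second makes the projectors well defined.\<close>

locale hecke_parameter =
  fixes q :: real
  assumes q_pos: "0 < q"
begin

abbreviation Q :: complex where "Q \<equiv> of_real q"

lemma Q_nonzero [simp]: "q \<noteq> 0" using q_pos by simp

definition antisymmetric_at :: "nat \<Rightarrow> (word \<Rightarrow> complex) \<Rightarrow> bool" where
  "antisymmetric_at i f \<longleftrightarrow> hecke Q i f = (\<lambda>w. - inverse Q * f w)"

lemma antisymmetric_at_iff:
  "antisymmetric_at i f \<longleftrightarrow> (\<forall>w. (w i = w (Suc i) \<longrightarrow> f w = 0) \<and>
     (w i < w (Suc i) \<longrightarrow> f (swap_at i w) = - Q * f w))"
proof safe
  fix w assume f: "antisymmetric_at i f"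
  then have h: "hecke Q i f w = - inverse Q * f w" by (simp add: antisymmetric_at_def)
  show "f w = 0" if "w i = w (Suc i)"
  proof -
    \<comment> \<open>On equal letters the operator is multiplication by \<open>Q\<close>, while
      antisymmetry asks for the eigenvalue -1/Q.\<close>
    have "(Q * Q + 1) * f w = 0" using h that by (simp add: hecke_def field_simps)
    moreover have "Q * Q + 1 \<noteq> 0"
    proof -
      have "q * q + 1 > 0" using q_pos by (simp add: add_pos_pos)
      then have "complex_of_real (q * q + 1) \<noteq> 0" by (metis of_real_eq_0_iff less_irrefl)
      then show ?thesis by simp
    qed
    ultimately show ?thesis by simp
  qed
  show "f (swap_at i w) = - Q * f w" if "w i < w (Suc i)"
  proof -
    have "f (swap_at i w) = - inverse Q * f w - (Q - inverse Q) * f w"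
      using h that by (simp add: hecke_def eq_diff_eq)
    then show ?thesis by (simp add: algebra_simps)
  qed
next
  assume f: "\<forall>w. (w i = w (Suc i) \<longrightarrow> f w = 0) \<and> (w i < w (Suc i) \<longrightarrow> f (swap_at i w) = - Q * f w)"
  have "hecke Q i f w = - inverse Q * f w" for w
  proof (cases "w i" "w (Suc i)" rule: linorder_cases)
    case less
    then show ?thesis using f by (simp add: hecke_def field_simps)
  next
    case equal
    then show ?thesis using f by (simp add: hecke_def)
  next
    case greater
    then have "f w = - Q * f (swap_at i w)"
      using f[THEN spec, of "swap_at i w"] by simp
    then show ?thesis using greater by (simp add: hecke_def field_simps)
  qed
  then show "antisymmetric_at i f" by (auto simp: antisymmetric_at_def)
qed

text \<open>The coordinates of the q-antisymmetric vectors, with the same weights as the terms of a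
  quantum minor. All letter sets are treated at once, each contributing its own vector.\<close>

definition block_sign :: "nat \<Rightarrow> nat \<Rightarrow> word \<Rightarrow> complex" where
  "block_sign p k w =
    (if inj_on w {p..<p + k} then (- Q) ^ inversion_number k (\<lambda>i. w (p + i)) else 0)"

lemma block_sign_swap_at:
  assumes "p \<le> i" and "Suc i < p + k" and "w i < w (Suc i)"
  shows "block_sign p k (swap_at i w) = - Q * block_sign p k w"
proof -
  have "(\<lambda>j. w (p + j)) = swap_at (i - p) (\<lambda>j. swap_at i w (p + j))"
    using assms by (simp add: swap_at_shift)
  then have "inversion_number k (\<lambda>j. swap_at i w (p + j)) = Suc (inversion_number k (\<lambda>j. w (p + j)))"
    using assms inversion_number_swap_at[of "i - p" k "\<lambda>j. swap_at i w (p + j)"]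
    by (simp add: less_diff_conv2 Suc_diff_le)
  then show ?thesis using assms by (simp add: block_sign_def inj_on_swap_at)
qed

lemma block_sign_swap_at_outside:
  assumes "Suc i < p \<or> p + k \<le> i"
  shows "block_sign p k (swap_at i w) = block_sign p k w"
proof -
  have *: "swap_at i w j = w j" if "j \<in> {p..<p + k}" for j
    using assms that by (auto simp: swap_at_def)
  then have "inj_on (swap_at i w) {p..<p + k} = inj_on w {p..<p + k}"
    by (intro inj_on_cong) auto
  moreover have "inversion_number k (\<lambda>j. swap_at i w (p + j)) = inversion_number k (\<lambda>j. w (p + j))"
    unfolding inversion_number_def using * by (intro arg_cong[where f = card]) auto
  ultimately show ?thesis by (simp add: block_sign_def)
qed

lemma block_sign_antisymmetric:
  assumes "p \<le> i" and "Suc i < p + k"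
  shows "antisymmetric_at i (block_sign p k)"
proof -
  have "block_sign p k w = 0" if "w i = w (Suc i)" for w
    using assms that inj_onD[of w "{p..<p + k}" i "Suc i"] by (auto simp: block_sign_def)
  then show ?thesis using assms by (auto simp: antisymmetric_at_iff block_sign_swap_at)
qed

text \<open>Induction on inversions: removing a descent by a swap costs the same factor
  \<open>- Q\<close> in \<open>f\<close> and in the sign. The process ends at a weakly increasing
  word, which is either sorted already or has two equal neighbours, where both sides vanish.\<close>

lemma antisymmetric_expand:
  assumes "\<And>i. p \<le> i \<Longrightarrow> Suc i < p + k \<Longrightarrow> antisymmetric_at i f"
  shows "f w = block_sign p k w * f (sort_block p k w)"
proof (induction "inversion_number k (\<lambda>i. w (p + i))" arbitrary: w rule: less_induct)
  case less
  show ?case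
  proof (cases "\<exists>i. p \<le> i \<and> Suc i < p + k \<and> w (Suc i) < w i")
    case True
    then obtain i where i: "p \<le> i" "Suc i < p + k" "w (Suc i) < w i" by blast
    let ?v = "swap_at i w"
    have "(\<lambda>j. ?v (p + j)) = swap_at (i - p) (\<lambda>j. w (p + j))"
      using i by (simp add: swap_at_shift)
    then have "inversion_number k (\<lambda>j. ?v (p + j)) < inversion_number k (\<lambda>j. w (p + j))"
      using i inversion_number_swap_at[of "i - p" k "\<lambda>j. w (p + j)"]
      by (simp add: less_diff_conv2 Suc_diff_le)
    then have IH: "f ?v = block_sign p k ?v * f (sort_block p k ?v)" by (rule less)
    have "f w = - Q * f ?v"
      using assms[OF i(1,2), unfolded antisymmetric_at_iff, THEN spec, of ?v] i by simp
    moreover have "block_sign p k w = - Q * block_sign p k ?v"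
      using block_sign_swap_at[of p i k ?v] i by simp
    moreover have "sort_block p k ?v = sort_block p k w"
      using i image_swap_at[of p i k w] by (auto simp: sort_block_def swap_at_def)
    ultimately show ?thesis using IH by simp
  next
    case False
    have step: "w i \<le> w (Suc i)" if "p \<le> i" "Suc i < p + k" for i
      using False that by (auto simp: not_less)
    have mono: "w a \<le> w b" if "p \<le> a" "a \<le> b" "b < p + k" for a b
      by (rule no_descent_mono[of a "p + k"]) (use step that in simp_all)
    show ?thesis
    proof (cases "inj_on w {p..<p + k}")
      case inj: True
      have "inversion_number k (\<lambda>i. w (p + i)) = 0"
        by (rule inversion_number_eq_0) (auto intro: mono)
      then have sign: "block_sign p k w = 1" using inj by (simp add: block_sign_def)
      have "sorted (map w [p..<p + k])" by (auto simp: sorted_iff_nth_mono intro: mono)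
      moreover have "distinct (map w [p..<p + k])" using inj by (simp add: distinct_map)
      ultimately have "sorted_list_of_set (w ` {p..<p + k}) = map w [p..<p + k]"
        using sorted_list_of_set.idem_if_sorted_distinct[of "map w [p..<p + k]"] by simp
      then have "sort_block p k w i = w i" for i
        by (auto simp: sort_block_def)
      then have "sort_block p k w = w" ..
      then show ?thesis using sign by simp
    next
      case noninj: False
      then obtain x y where xy: "x \<in> {p..<p + k}" "y \<in> {p..<p + k}" "w x = w y" "x \<noteq> y"
        unfolding inj_on_def by blast
      define a b where "a = min x y" and "b = max x y"
      then have ab: "a \<in> {p..<p + k}" "b \<in> {p..<p + k}" "w a = w b" "a < b"
        using xy by (auto simp: min_def max_def)
      \<comment> \<open>In a weakly increasing word the letters between two equal ones are squeezed,
        so a repetition shows up at adjacent positions.\<close>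
      then have "w a = w (Suc a)" using mono[of a "Suc a"] mono[of "Suc a" b] by auto
      then have "f w = 0" using assms[of a] ab by (auto simp: antisymmetric_at_iff)
      then show ?thesis using noninj by (simp add: block_sign_def)
    qed
  qed
qed

definition blocks_sign :: "nat \<Rightarrow> nat \<Rightarrow> word \<Rightarrow> complex" where
  "blocks_sign l k w = block_sign 0 l w * block_sign l k w"

definition block_antisymmetric :: "nat \<Rightarrow> nat \<Rightarrow> (word \<Rightarrow> complex) \<Rightarrow> bool" where
  "block_antisymmetric l k f \<longleftrightarrow> (\<forall>i. Suc i < l + k \<longrightarrow> Suc i \<noteq> l \<longrightarrow> antisymmetric_at i f)"

text \<open>A swap inside one block preserves the letter sets, multiplies the sign of that block by
  \<open>- Q\<close> at an ascent and leaves the other sign alone. The cut-off by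
  \<open>same_blocks\<close> is thus compatible with antisymmetry.\<close>

lemma block_antisymmetric_blocks_sign:
  "block_antisymmetric l k (\<lambda>w. if same_blocks l k w w' then blocks_sign l k w else 0)"
  unfolding block_antisymmetric_def
proof safe
  fix i assume i: "Suc i < l + k" "Suc i \<noteq> l"
  have "blocks_sign l k w = 0" if "w i = w (Suc i)" for w
  proof (cases "Suc i < l")
    case True
    then have "block_sign 0 l w = 0"
      using block_sign_antisymmetric[of 0 i l] that unfolding antisymmetric_at_iff by auto
    then show ?thesis by (simp add: blocks_sign_def)
  next
    case False
    then have "block_sign l k w = 0"
      using block_sign_antisymmetric[of l i k] i that unfolding antisymmetric_at_iff by auto
    then show ?thesis by (simp add: blocks_sign_def)
  qed
  moreover have "blocks_sign l k (swap_at i w) = - Q * blocks_sign l k w" if "w i < w (Suc i)" for w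
  proof (cases "Suc i < l")
    case True
    then show ?thesis using that block_sign_swap_at[of 0 i l w] block_sign_swap_at_outside[of i l k w]
      by (simp add: blocks_sign_def)
  next
    case False
    then show ?thesis using that i block_sign_swap_at[of l i k w] block_sign_swap_at_outside[of i 0 l w]
      by (simp add: blocks_sign_def)
  qed
  ultimately have "(w i = w (Suc i) \<longrightarrow> (if same_blocks l k w w' then blocks_sign l k w else 0) = 0) \<and>
     (w i < w (Suc i) \<longrightarrow> (if same_blocks l k w w' then blocks_sign l k (swap_at i w) else 0) =
        - Q * (if same_blocks l k w w' then blocks_sign l k w else 0))" for w
    by (cases "same_blocks l k w w'") (simp_all only: if_True if_False, auto)
  then show "antisymmetric_at i (\<lambda>w. if same_blocks l k w w' then blocks_sign l k w else 0)"
    unfolding antisymmetric_at_iff same_blocks_swap_at[OF i] by blast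
qed

lemma block_antisymmetric_expand:
  assumes "block_antisymmetric l k f"
  shows "f w = blocks_sign l k w * f (sort_block l k (sort_block 0 l w))"
proof -
  have "f w = block_sign 0 l w * f (sort_block 0 l w)"
    by (rule antisymmetric_expand) (use assms in \<open>simp add: block_antisymmetric_def\<close>)
  also have "f (sort_block 0 l w) = block_sign l k (sort_block 0 l w) * f (sort_block l k (sort_block 0 l w))"
    by (rule antisymmetric_expand) (use assms in \<open>simp add: block_antisymmetric_def\<close>)
  also have "block_sign l k (sort_block 0 l w) = block_sign l k w"
  proof -
    have "inj_on (sort_block 0 l w) {l..<l + k} = inj_on w {l..<l + k}"
      by (rule inj_on_cong) (auto simp: sort_block_def)
    then show ?thesis by (simp add: block_sign_def sort_block_def)
  qed
  finally show ?thesis by (simp add: blocks_sign_def)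
qed

end

section \<open>Concatenated words, and sums over permutations as sums over words\<close>

lemma append_word_less [simp]: "i < l \<Longrightarrow> append_word l u v i = u i"
  and append_word_add [simp]: "append_word l u v (l + i) = v i"
  by (simp_all add: append_word_def)

lemma append_word_in_words:
  assumes "u \<in> words l N" "v \<in> words k N"
  shows "append_word l u v \<in> words (l + k) N"
proof -
  have "append_word l u v i \<in> {1..N}" if "i < l + k" for i
    using that assms by (cases "i < l") (auto simp: words_def append_word_def PiE_iff)
  moreover have "append_word l u v i = undefined" if "\<not> i < l + k" for i
  proof -
    have "\<not> i - l < k" "\<not> i < l" using that by auto
    then show ?thesis using assms by (simp add: words_def append_word_def PiE_iff extensional_def)
  qed
  ultimately show ?thesis unfolding words_def by (intro PiE_I) auto
qed

lemma image_append_word: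
  "append_word l u v ` {0..<l} = u ` {..<l}"
  "append_word l u v ` {l..<l + k} = v ` {..<k}"
proof -
  show "append_word l u v ` {0..<l} = u ` {..<l}"
    by (intro image_cong) auto
  have "{l..<l + k} = (+) l ` {..<k}" by (simp add: lessThan_atLeast0 add.commute)
  then show "append_word l u v ` {l..<l + k} = v ` {..<k}"
    by (simp only: image_image append_word_add)
qed

lemma sum_words_append:
  "(\<Sum>w\<in>words (l + k) m. f w) = (\<Sum>u\<in>words l m. \<Sum>v\<in>words k m. f (append_word l u v))"
proof -
  have "(\<Sum>u\<in>words l m. \<Sum>v\<in>words k m. f (append_word l u v))
     = (\<Sum>(u, v)\<in>words l m \<times> words k m. f (append_word l u v))"
    by (rule sum.cartesian_product)
  also have "\<dots> = (\<Sum>w\<in>words (l + k) m. f w)"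
  proof (rule sum.reindex_bij_witness[of _ "\<lambda>w. (restrict w {..<l}, \<lambda>i. w (l + i))" "\<lambda>(u, v). append_word l u v"])
    fix p assume "p \<in> words l m \<times> words k m"
    then obtain u v where p: "p = (u, v)" "u \<in> words l m" "v \<in> words k m" by blast
    then have "restrict (append_word l u v) {..<l} = u"
      by (intro ext) (auto simp: words_def PiE_def extensional_def)
    then show "(restrict (case p of (u, v) \<Rightarrow> append_word l u v) {..<l},
        \<lambda>i. (case p of (u, v) \<Rightarrow> append_word l u v) (l + i)) = p"
      using p by simp
    have "append_word l u v i \<in> {1..m}" if "i < l + k" for i
      using that p by (cases "i < l") (auto simp: words_def append_word_def PiE_iff)
    moreover have "append_word l u v i = undefined" if "\<not> i < l + k" for i
    proof -
      have "\<not> i - l < k" "\<not> i < l" using that by auto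
      then show ?thesis using p by (simp add: words_def append_word_def PiE_iff extensional_def)
    qed
    ultimately show "(case p of (u, v) \<Rightarrow> append_word l u v) \<in> words (l + k) m"
      using p by (auto simp: words_def PiE_iff extensional_def)
  next
    fix w assume w: "w \<in> words (l + k) m"
    show "(case (restrict w {..<l}, \<lambda>i. w (l + i)) of (u, v) \<Rightarrow> append_word l u v) = w"
      by (auto simp: append_word_def)
    show "(restrict w {..<l}, \<lambda>i. w (l + i)) \<in> words l m \<times> words k m"
      using w by (auto simp: words_def PiE_iff extensional_def)
  qed auto
  finally show ?thesis by simp
qed

lemma nth_sorted_list_of_set_bij:
  assumes "finite J"
  shows "bij_betw (\<lambda>i. sorted_list_of_set J ! i) {..<card J} J"
  using bij_betw_nth[of "sorted_list_of_set J" "{..<card J}" J] assms by simp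

lemma sorted_word_bij:
  assumes "finite J" shows "bij_betw (sorted_word J) {..<card J} J"
proof -
  have "bij_betw (sorted_word J) {..<card J} J
      \<longleftrightarrow> bij_betw (\<lambda>i. sorted_list_of_set J ! i) {..<card J} J"
    by (rule bij_betw_cong) (simp add: sorted_word_def)
  then show ?thesis using nth_sorted_list_of_set_bij[OF assms] by simp
qed

lemma sorted_word_in_words:
  assumes "J \<subseteq> {1..m}" "card J = k"
  shows "sorted_word J \<in> words k m"
proof -
  have "finite J" using assms finite_subset by blast
  then have "sorted_word J i \<in> {1..m}" if "i < k" for i
    using sorted_word_bij[of J] assms that unfolding bij_betw_def by blast
  then show ?thesis using assms by (auto simp: words_def sorted_word_def)
qed

text \<open>Links the sum over permutations in a quantum minor with sums over words. Permutations
  are the identity from \<open>k\<close> on, where words are \<open>undefined\<close>; the inverse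
  map therefore has to restore the fixed points explicitly.\<close>

lemma sorted_word_permute:
  assumes J: "J \<subseteq> {1..m}" "card J = k"
  shows "bij_betw (\<lambda>s. restrict (sorted_word J \<circ> s) {..<k}) {s. s permutes {..<k}}
    {u \<in> words k m. u ` {..<k} = J}"
proof -
  have fin: "finite J" using J finite_subset by blast
  let ?h = "sorted_word J"
  have h: "bij_betw ?h {..<k} J" using sorted_word_bij[OF fin] J by simp
  define h' where "h' = inv_into {..<k} ?h"
  have h'1: "h' (?h i) = i" if "i < k" for i
    using h that by (simp add: h'_def bij_betw_def)
  have h'2: "?h (h' x) = x" "h' x < k" if "x \<in> J" for x
    using h that by (auto simp: h'_def f_inv_into_f bij_betw_def inv_into_into
      intro: inv_into_into[of x ?h "{..<k}", simplified])
  show ?thesis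
  proof (rule bij_betw_byWitness[where f' = "\<lambda>u i. if i < k then h' (u i) else i"])
    have "(if i < k then h' (restrict (?h \<circ> s) {..<k} i) else i) = s i" if "s permutes {..<k}" for s i
      using permutes_in_image[OF that, of i] permutes_not_in[OF that, of i] h'1 by auto
    then show "\<forall>s\<in>{s. s permutes {..<k}}. (\<lambda>i. if i < k then h' (restrict (?h \<circ> s) {..<k} i) else i) = s"
      by blast
    have "restrict (?h \<circ> (\<lambda>i. if i < k then h' (u i) else i)) {..<k} i = u i"
      if u: "u \<in> words k m" "u ` {..<k} = J" for u i
    proof -
      have "u i \<in> J" if "i < k" using that u(2) by auto
      then show ?thesis
        using u(1) h'2(1)[of "u i"] by (cases "i < k") (auto simp: words_def PiE_iff extensional_def)
    qed
    then show "\<forall>u\<in>{u \<in> words k m. u ` {..<k} = J}.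
        restrict (?h \<circ> (\<lambda>i. if i < k then h' (u i) else i)) {..<k} = u"
      by blast
    have im: "restrict (?h \<circ> s) {..<k} ` {..<k} = J" if "s permutes {..<k}" for s
    proof -
      have "restrict (?h \<circ> s) {..<k} ` {..<k} = ?h ` (s ` {..<k})" by auto
      then show ?thesis using h permutes_image[OF that] by (simp add: bij_betw_def)
    qed
    have "restrict (?h \<circ> s) {..<k} \<in> words k m" if "s permutes {..<k}" for s
    proof -
      have "restrict (?h \<circ> s) {..<k} i \<in> {1..m}" if "i < k" for i
        using that im[OF \<open>s permutes _\<close>] J(1) by (metis image_eqI lessThan_iff subsetD)
      then show ?thesis unfolding words_def by (intro PiE_I) auto
    qed
    with im show "(\<lambda>s. restrict (?h \<circ> s) {..<k}) ` {s. s permutes {..<k}} \<subseteq> {u \<in> words k m. u ` {..<k} = J}"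
      by blast
    have "(\<lambda>i. if i < k then h' (u i) else i) permutes {..<k}" if u: "u \<in> words k m" "u ` {..<k} = J" for u
    proof -
      have uJ: "u i \<in> J" if "i < k" for i using that u(2) by auto
      have "card (u ` {..<k}) = card {..<k}" using u J by simp
      then have inj: "inj_on u {..<k}" by (intro eq_card_imp_inj_on) auto
      have inj': "inj_on (\<lambda>i. h' (u i)) {..<k}"
      proof (rule inj_onI)
        fix i j assume ij: "i \<in> {..<k}" "j \<in> {..<k}" "h' (u i) = h' (u j)"
        then have "u i = u j" using h'2(1) uJ by (metis lessThan_iff)
        then show "i = j" using inj ij by (auto dest: inj_onD)
      qed
      have sub: "(\<lambda>i. h' (u i)) ` {..<k} \<subseteq> {..<k}" using uJ h'2(2) by auto
      have "bij_betw (\<lambda>i. h' (u i)) {..<k} {..<k}"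
        using inj' endo_inj_surj[OF _ sub inj'] by (simp add: bij_betw_def)
      moreover have "bij_betw (\<lambda>i. if i < k then h' (u i) else i) {..<k} {..<k}
          \<longleftrightarrow> bij_betw (\<lambda>i. h' (u i)) {..<k} {..<k}"
        by (rule bij_betw_cong) simp
      ultimately show ?thesis by (intro bij_imp_permutes) auto
    qed
    then show "(\<lambda>u i. if i < k then h' (u i) else i) ` {u \<in> words k m. u ` {..<k} = J} \<subseteq> {s. s permutes {..<k}}"
      by blast
  qed
qed

lemma inversion_number_sorted_word:
  assumes "finite J" "card J = k" "s permutes {..<k}"
  shows "inversion_number k (restrict (sorted_word J \<circ> s) {..<k}) = inversion_number k s"
proof -
  have "sorted_word J x > sorted_word J y \<longleftrightarrow> x > y" if "x < k" "y < k" for x y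
    using that assms sorted_list_of_set.strict_sorted_key_list_of_set
    by (auto simp: sorted_word_def) (metis  leD linorder_neqE_nat nat_less_le sorted_list_of_set.length_sorted_key_list_of_set
      strict_sorted_list_of_set sorted_wrt_nth_less)+
  moreover have "s x < k" if "x < k" for x using permutes_in_image[OF assms(3), of x] that by simp
  ultimately have "{(i, j). i < j \<and> j < k \<and> restrict (sorted_word J \<circ> s) {..<k} i > restrict (sorted_word J \<circ> s) {..<k} j}
     = {(i, j). i < j \<and> j < k \<and> s i > s j}" by auto
  then show ?thesis by (simp add: inversion_number_def)
qed

lemma sort_blocks_append_word:
  assumes "u \<in> words l m" "v \<in> words k m" "card (u ` {..<l}) = l" "card (v ` {..<k}) = k"
  shows "sort_block l k (sort_block 0 l (append_word l u v)) =
    append_word l (sorted_word (u ` {..<l})) (sorted_word (v ` {..<k}))"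
proof
  fix i
  have 1: "sort_block 0 l (append_word l u v) ` {l..<l + k} = v ` {..<k}"
  proof -
    have "sort_block 0 l (append_word l u v) ` {l..<l + k} = append_word l u v ` {l..<l + k}"
      by (intro image_cong) (auto simp: sort_block_def)
    then show ?thesis by (simp add: image_append_word)
  qed
  consider "i < l" | "l \<le> i" "i < l + k" | "l + k \<le> i" by linarith
  then show "sort_block l k (sort_block 0 l (append_word l u v)) i =
    append_word l (sorted_word (u ` {..<l})) (sorted_word (v ` {..<k})) i"
  proof cases
    case 1
    then show ?thesis using assms image_append_word(1)[of l u v] by (simp add: sort_block_def sorted_word_def)
  next
    case 2
    then show ?thesis using assms 1 by (simp add: sort_block_def[of l k] append_word_def sorted_word_def less_diff_conv2 ac_simps)
  next
    case 3
    then have "\<not> i - l < k" "\<not> i < l" by auto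
    then show ?thesis using 3 assms
      by (auto simp add: sort_block_def append_word_def sorted_word_def words_def PiE_iff extensional_def)
  qed
qed

context hecke_parameter
begin

lemma block_sign_append_word:
  "block_sign 0 l (append_word l u v) = block_sign 0 l u"
  "block_sign l k (append_word l u v) = block_sign 0 k v"
proof -
  have "inj_on (append_word l u v) {0..<l} = inj_on u {0..<l}"
    by (rule inj_on_cong) simp
  moreover have "inversion_number l (\<lambda>i. append_word l u v (0 + i)) = inversion_number l (\<lambda>i. u (0 + i))"
    unfolding inversion_number_def by (intro arg_cong[where f = card]) auto
  ultimately show "block_sign 0 l (append_word l u v) = block_sign 0 l u"
    by (simp add: block_sign_def)
  have "inj_on (append_word l u v) ((+) l ` {0..<k}) = inj_on (append_word l u v \<circ> (+) l) {0..<k}"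
    by (simp add: comp_inj_on_iff[symmetric])
  moreover have "append_word l u v \<circ> (+) l = v" by auto
  ultimately have "inj_on (append_word l u v) {l..<l + k} = inj_on v {0..<k}"
    by (simp add: add.commute)
  then show "block_sign l k (append_word l u v) = block_sign 0 k v"
    by (simp add: block_sign_def)
qed

lemma block_sign_sorted_word_permute:
  assumes "J \<subseteq> {1..m}" "card J = k" "s permutes {..<k}"
  shows "block_sign 0 k (restrict (sorted_word J \<circ> s) {..<k}) = (- Q) ^ inversion_number k s"
proof -
  have "restrict (sorted_word J \<circ> s) {..<k} \<in> {u \<in> words k m. u ` {..<k} = J}"
    using bij_betwE[OF sorted_word_permute[OF assms(1,2)]] assms(3) by blast
  then have "card (restrict (sorted_word J \<circ> s) {..<k} ` {..<k}) = card {..<k}" using assms by simp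
  then have "inj_on (restrict (sorted_word J \<circ> s) {..<k}) {..<k}" by (intro eq_card_imp_inj_on) auto
  then have "inj_on (restrict (sorted_word J \<circ> s) {..<k}) {0..<k}" by (simp only: lessThan_atLeast0)
  moreover have "block_sign 0 k w = (- Q) ^ inversion_number k w" if "inj_on w {0..<k}" for w
    using that by (simp add: block_sign_def)
  ultimately show ?thesis
    using inversion_number_sorted_word[OF _ assms(2,3)] finite_subset[OF assms(1)] by simp
qed

lemma sum_permutations_words:
  assumes "J \<subseteq> {1..m}" "card J = k"
  shows "(\<Sum>s | s permutes {..<k}. (- Q) ^ inversion_number k s * g (restrict (sorted_word J \<circ> s) {..<k}))
    = (\<Sum>u | u \<in> words k m \<and> u ` {..<k} = J. block_sign 0 k u * g u)"
  unfolding sum.reindex_bij_betw[OF sorted_word_permute[OF assms], symmetric]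
  by (rule sum.cong) (simp_all add: block_sign_sorted_word_permute[OF assms])

lemma block_sign_nonzero_card:
  assumes "block_sign 0 k u \<noteq> 0"
  shows "card (u ` {..<k}) = k"
proof -
  have "inj_on u {..<k}" using assms unfolding block_sign_def by (metis atLeast0LessThan add_0)
  then show ?thesis by (simp add: card_image)
qed

text \<open>Words with repeated letters have sign 0; the others are grouped by their set of letters,
  which then has exactly \<open>k\<close> elements.\<close>

lemma sum_words_by_image:
  "(\<Sum>u\<in>words k m. block_sign 0 k u * g u) =
    (\<Sum>J | J \<subseteq> {1..m} \<and> card J = k. \<Sum>u | u \<in> words k m \<and> u ` {..<k} = J. block_sign 0 k u * g u)"
proof -
  let ?U = "{u \<in> words k m. card (u ` {..<k}) = k}"
  have "(\<Sum>u\<in>words k m. block_sign 0 k u * g u) = (\<Sum>u\<in>?U. block_sign 0 k u * g u)"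
    using block_sign_nonzero_card by (intro sum.mono_neutral_right) auto
  also have "\<dots> = (\<Sum>J | J \<subseteq> {1..m} \<and> card J = k. \<Sum>u | u \<in> ?U \<and> u ` {..<k} = J. block_sign 0 k u * g u)"
  proof (rule sum.group[symmetric])
    show "(\<lambda>u. u ` {..<k}) ` ?U \<subseteq> {J. J \<subseteq> {1..m} \<and> card J = k}"
      by (auto simp: words_def)
  qed simp_all
  also have "\<dots> = (\<Sum>J | J \<subseteq> {1..m} \<and> card J = k. \<Sum>u | u \<in> words k m \<and> u ` {..<k} = J. block_sign 0 k u * g u)"
    by (intro sum.cong refl) auto
  finally show ?thesis .
qed

text \<open>The squared length, sum of q^(2 inv s), of a q-antisymmetric vector: the value of the
  q-factorial at q^2. It does not depend on the letter set, since only inversions enter the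
  coordinates.\<close>

definition sign_norm :: "nat \<Rightarrow> complex" where
  "sign_norm k = (\<Sum>s | s permutes {..<k}. ((- Q) ^ inversion_number k s)\<^sup>2)"

lemma sign_norm_nonzero: "sign_norm k \<noteq> 0"
proof -
  have "0 < (\<Sum>s | s permutes {..<k}. ((- q) ^ inversion_number k s)\<^sup>2)"
    by (rule sum_pos2[of _ id]) (auto simp: permutes_id finite_permutations)
  moreover have "sign_norm k = of_real (\<Sum>s | s permutes {..<k}. ((- q) ^ inversion_number k s)\<^sup>2)"
    by (simp add: sign_norm_def)
  ultimately show ?thesis by (metis less_irrefl of_real_eq_0_iff)
qed

lemma sum_block_sign_square:
  assumes "J \<subseteq> {1..m}" "card J = k"
  shows "(\<Sum>u | u \<in> words k m \<and> u ` {..<k} = J. (block_sign 0 k u)\<^sup>2) = sign_norm k"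
proof -
  have "(\<Sum>u | u \<in> words k m \<and> u ` {..<k} = J. block_sign 0 k u * block_sign 0 k u) = sign_norm k"
    unfolding sum_permutations_words[OF assms, symmetric] sign_norm_def
    by (rule sum.cong) (simp_all add: block_sign_sorted_word_permute[OF assms] power2_eq_square)
  then show ?thesis by (simp add: power2_eq_square)
qed

lemma sum_blocks_sign_square:
  assumes "blocks_sign l k w \<noteq> 0" "w \<in> words (l + k) m"
  shows "(\<Sum>w'\<in>words (l + k) m. if same_blocks l k w w' then (blocks_sign l k w')\<^sup>2 else 0)
     = sign_norm l * sign_norm k"
proof -
  let ?L = "w ` {0..<l}" and ?J = "w ` {l..<l + k}"
  have inj: "inj_on w {0..<l}" "inj_on w {l..<l + k}"
    using assms(1) by (auto simp: blocks_sign_def block_sign_def split: if_splits)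
  have sub: "?L \<subseteq> {1..m}" "?J \<subseteq> {1..m}" using assms(2) by (auto simp: words_def PiE_iff)
  have card: "card ?L = l" "card ?J = k" using inj by (simp_all add: card_image)
  have "(\<Sum>w'\<in>words (l + k) m. if same_blocks l k w w' then (blocks_sign l k w')\<^sup>2 else 0)
     = (\<Sum>u\<in>words l m. \<Sum>v\<in>words k m.
         (if u ` {..<l} = ?L then (block_sign 0 l u)\<^sup>2 else 0) * (if v ` {..<k} = ?J then (block_sign 0 k v)\<^sup>2 else 0))"
  proof -
    have "same_blocks l k w (append_word l u v) \<longleftrightarrow> u ` {..<l} = ?L \<and> v ` {..<k} = ?J" for u v
      unfolding same_blocks_def image_append_word by metis
    then show ?thesis
      unfolding sum_words_append
      by (intro sum.cong[OF refl]) (simp add: blocks_sign_def block_sign_append_word power_mult_distrib)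
  qed
  also have "\<dots> = (\<Sum>u\<in>words l m. if u ` {..<l} = ?L then (block_sign 0 l u)\<^sup>2 else 0) *
      (\<Sum>v\<in>words k m. if v ` {..<k} = ?J then (block_sign 0 k v)\<^sup>2 else 0)"
    by (rule sum_product[symmetric])
  also have "\<dots> = sign_norm l * sign_norm k"
    using sum_block_sign_square[OF sub(1) card(1)] sum_block_sign_square[OF sub(2) card(2)]
    by (simp add: sum.If_cases Int_def)
  finally show ?thesis .
qed

end

section \<open>Projectors, the trace identity, and sums over minors as traces\<close>

context hecke_parameter
begin

text \<open>The matrix of the orthogonal projector, for the bilinear pairing, onto the functions
  antisymmetric in both blocks: for each pair of letter sets the product of two q-antisymmetric
  vectors, normalised by its squared length.\<close>

definition projector :: "nat \<Rightarrow> nat \<Rightarrow> word \<Rightarrow> word \<Rightarrow> complex" where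
  "projector l k a a' =
    (if same_blocks l k a a' then blocks_sign l k a * blocks_sign l k a' else 0) / (sign_norm l * sign_norm k)"

lemma projector_sym: "projector l k a a' = projector l k a' a"
  by (simp add: projector_def same_blocks_sym mult.commute)

lemma block_antisymmetric_projector: "block_antisymmetric l k (\<lambda>a. projector l k a a')"
proof -
  define c where "c = blocks_sign l k a' / (sign_norm l * sign_norm k)"
  have *: "(\<lambda>a. projector l k a a') = (\<lambda>a. c * (if same_blocks l k a a' then blocks_sign l k a else 0))"
    by (auto simp: projector_def c_def)
  show ?thesis
    unfolding * using block_antisymmetric_blocks_sign[of l k a']
    by (auto simp: block_antisymmetric_def antisymmetric_at_def hecke_scale)
qed

lemma block_antisymmetric_projector2: "block_antisymmetric l k (projector l k a)"
proof -
  have "projector l k a = (\<lambda>a'. projector l k a' a)" by (intro ext projector_sym)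
  then show ?thesis using block_antisymmetric_projector by simp
qed

lemma projector_reproduces:
  assumes "block_antisymmetric l k f" "a \<in> words (l + k) m"
  shows "(\<Sum>a'\<in>words (l + k) m. projector l k a a' * f a') = f a"
proof -
  have expand: "f w = blocks_sign l k w * f (sort_block l k (sort_block 0 l w))" for w
    by (rule block_antisymmetric_expand[OF assms(1)])
  let ?c = "sign_norm l * sign_norm k"
  have "?c \<noteq> 0" by (simp add: sign_norm_nonzero)
  \<comment> \<open>Both words sort to the same word, so \<open>f\<close> at either of them is its
    sign times one common value. Agreement beyond position \<open>l + k\<close>, where both are
    \<open>undefined\<close>, is needed to make the sorted words equal as functions.\<close>
  have same: "blocks_sign l k a * f a' = blocks_sign l k a' * f a"
    if "same_blocks l k a a'" "a' \<in> words (l + k) m" for a'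
  proof -
    have out: "a i = a' i" if "l + k \<le> i" for i
      using that assms(2) \<open>a' \<in> _\<close> by (auto simp: words_def PiE_iff extensional_def)
    have "sort_block l k (sort_block 0 l w) = (\<lambda>i. if i < l then sorted_list_of_set (w ` {0..<l}) ! i
        else if i < l + k then sorted_list_of_set (w ` {l..<l + k}) ! (i - l) else w i)" for w
    proof -
      have "sort_block 0 l w ` {l..<l + k} = w ` {l..<l + k}"
        by (intro image_cong) (auto simp: sort_block_def)
      then show ?thesis by (auto simp: sort_block_def[of l k] sort_block_def[of 0 l])
    qed
    then have "sort_block l k (sort_block 0 l a) = sort_block l k (sort_block 0 l a')"
      using that out by (auto simp: same_blocks_def)
    then show ?thesis by (simp add: expand[of a] expand[of a'])
  qed
  have "(\<Sum>a'\<in>words (l + k) m. projector l k a a' * f a')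
     = (\<Sum>a'\<in>words (l + k) m. (if same_blocks l k a a' then (blocks_sign l k a')\<^sup>2 else 0) * (f a / ?c))"
    using same by (intro sum.cong refl) (auto simp: projector_def power2_eq_square)
  also have "\<dots> = (\<Sum>a'\<in>words (l + k) m. if same_blocks l k a a' then (blocks_sign l k a')\<^sup>2 else 0) * (f a / ?c)"
    by (rule sum_distrib_right[symmetric])
  also have "\<dots> = f a"
  \<comment> \<open>The evaluation of the sum of squares requires a nonzero sign at
    \<open>a\<close>; if the sign is 0, then \<open>f a = 0\<close> and both sides vanish.\<close>
  proof (cases "blocks_sign l k a = 0")
    case True
    then have "f a = 0" using expand[of a] by simp
    then show ?thesis by simp
  next
    case False
    then show ?thesis using sum_blocks_sign_square[OF False assms(2)] \<open>?c \<noteq> 0\<close> by simp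
  qed
  finally show ?thesis .
qed

lemma hecke_word_intertwine:
  assumes "braid_equiv (xs @ [i]) (j # xs)" "antisymmetric_at i f"
  shows "antisymmetric_at j (hecke_word Q (plain xs) f)"
proof -
  have "hecke_word Q (plain (j # xs)) f = hecke_word Q (plain (xs @ [i])) f"
    using hecke_word_braid_equiv[OF _ assms(1), of Q f] by simp
  then have "hecke Q j (hecke_word Q (plain xs) f) = hecke_word Q (plain xs) (hecke Q i f)"
    by (simp add: hecke_word_append)
  also have "hecke Q i f = (\<lambda>w. - inverse Q * f w)"
    using assms(2) by (simp only: antisymmetric_at_def)
  finally show ?thesis by (simp only: antisymmetric_at_def hecke_word_scale)
qed

text \<open>The generators inside the new first block come from those of the old second block by
  wrapping, and those inside the new second block from the old first block by shifting by
  \<open>k\<close>. The straddling generators are excluded on both sides.\<close>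

lemma block_antisymmetric_block_swap:
  assumes "block_antisymmetric l k f"
  shows "block_antisymmetric k l (hecke_word Q (plain (block_swap (l + k) k)) f)"
  unfolding block_antisymmetric_def
proof safe
  fix i assume i: "Suc i < k + l" "Suc i \<noteq> k"
  show "antisymmetric_at i (hecke_word Q (plain (block_swap (l + k) k)) f)"
  proof (cases "Suc i < k")
    case True
    then show ?thesis
      using assms block_swap_wrap[of i k l] by (intro hecke_word_intertwine[of _ "l + i"])
        (auto simp: block_antisymmetric_def)
  next
    case False
    then have "i = (i - k) + k" using i by simp
    then show ?thesis
      using assms block_swap_shift[of "i - k" k "l + k"] i False
      by (intro hecke_word_intertwine[of _ "i - k"]) (auto simp: block_antisymmetric_def)
  qed
qed

lemma block_antisymmetric_block_swap_rev:
  assumes "block_antisymmetric k l f"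
  shows "block_antisymmetric l k (hecke_word Q (plain (rev (block_swap (l + k) k))) f)"
  unfolding block_antisymmetric_def
proof safe
  fix i assume i: "Suc i < l + k" "Suc i \<noteq> l"
  have rev: "braid_equiv (rev xs @ [j]) (i # rev xs)" if "braid_equiv (xs @ [i]) (j # xs)" for xs i j
    using braid_equiv_rev[OF that] braid_equiv.equiv_sym by simp
  show "antisymmetric_at i (hecke_word Q (plain (rev (block_swap (l + k) k))) f)"
  proof (cases "Suc i < l")
    case True
    then show ?thesis
      using assms rev[OF block_swap_shift[of i k "l + k"]]
      by (intro hecke_word_intertwine[of _ "i + k"]) (auto simp: block_antisymmetric_def)
  next
    case False
    then have "i = l + (i - l)" using i by simp
    then show ?thesis
      using assms rev[OF block_swap_wrap[of "i - l" k l]] i False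
      by (intro hecke_word_intertwine[of _ "i - l"]) (auto simp: block_antisymmetric_def)
  qed
qed

text \<open>Conjugation by the block transposition carries one projector to the other, and the pairing
  with a kernel commuting with all generators is a trace.\<close>

lemma projector_trace:
  assumes tau: "\<And>i a b. Suc i < l + k \<Longrightarrow> hecke Q i (\<lambda>a. \<tau> a b) a = hecke Q i (\<tau> a) b"
  shows "(\<Sum>a\<in>words (l + k) m. \<Sum>a'\<in>words (l + k) m. projector l k a a' * \<tau> a a')
    = (\<Sum>a\<in>words (l + k) m. \<Sum>a'\<in>words (l + k) m. projector k l a a' * \<tau> a a')"
proof -
  let ?S = "words (l + k) m"
  define W where "W = plain (block_swap (l + k) k)"
  define V where "V = rev (map (\<lambda>i. (i, inverse Q - Q)) (block_swap (l + k) k))"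
  have VW: "hecke_word Q V (hecke_word Q W f) = f" and WV: "hecke_word Q W (hecke_word Q V f) = f" for f
    unfolding V_def W_def by (simp_all add: hecke_word_inverse hecke_word_inverse2)
  have idx: "Suc i < l + k" if "i \<in> fst ` set W \<or> i \<in> fst ` set V" for i
    using that by (auto simp: W_def V_def block_swap_def split: if_splits)
  have revW: "rev W = plain (rev (block_swap (l + k) k))" by (simp add: W_def rev_map)
  \<comment> \<open>In matrix terms W P = P' W, with P the projector for (l,k) and P' that for
    (k,l). The columns of W P are antisymmetric for (k,l), so W P = P' W P; the rows of P' W are
    antisymmetric for (l,k), so P' W P = P' W.\<close>
  have key: "hecke_word Q W (\<lambda>a. projector l k a a') a = hecke_word Q (rev W) (projector k l a) a'"
    if S: "a \<in> ?S" "a' \<in> ?S" for a a'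
  proof -
    have "hecke_word Q W (\<lambda>a. projector l k a a') a
       = (\<Sum>c\<in>?S. projector k l a c * hecke_word Q W (\<lambda>a. projector l k a a') c)"
      using projector_reproduces[OF block_antisymmetric_block_swap[OF block_antisymmetric_projector[of l k a']], of a m] S
      by (simp add: W_def add.commute)
    also have "\<dots> = (\<Sum>c\<in>?S. hecke_word Q (rev W) (projector k l a) c * projector l k c a')"
      using hecke_word_adjoint[of "rev W" "l + k" Q "projector k l a" "\<lambda>a. projector l k a a'" m] idx by simp
    also have "\<dots> = (\<Sum>c\<in>?S. projector l k a' c * hecke_word Q (rev W) (projector k l a) c)"
      by (rule sum.cong[OF refl]) (simp add: projector_sym[of l k a'] mult.commute)
    also have "\<dots> = hecke_word Q (rev W) (projector k l a) a'"
      unfolding revW by (rule projector_reproduces[OF block_antisymmetric_block_swap_rev[OF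
        block_antisymmetric_projector2] S(2)])
    finally show ?thesis .
  qed
  \<comment> \<open>Insert V W = 1 in front of the projector, use W P = P' W, and carry V round
    through \<open>\<tau>\<close> to the other index, where it meets W again and cancels.\<close>
  have "(\<Sum>a\<in>?S. \<Sum>a'\<in>?S. projector l k a a' * \<tau> a a')
      = (\<Sum>a'\<in>?S. \<Sum>a\<in>?S. hecke_word Q V (hecke_word Q W (\<lambda>a. projector l k a a')) a * \<tau> a a')"
    unfolding VW by (rule sum.swap)
  also have "\<dots> = (\<Sum>a'\<in>?S. \<Sum>a\<in>?S. hecke_word Q W (\<lambda>a. projector l k a a') a
      * hecke_word Q (rev V) (\<lambda>a. \<tau> a a') a)"
    by (rule sum.cong[OF refl], rule hecke_word_adjoint) (use idx in auto)
  also have "\<dots> = (\<Sum>a'\<in>?S. \<Sum>a\<in>?S. hecke_word Q (rev W) (projector k l a) a' * hecke_word Q V (\<tau> a) a')"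
  proof (rule sum.cong[OF refl], rule sum.cong[OF refl])
    fix a' a assume S: "a' \<in> ?S" "a \<in> ?S"
    have "hecke_word Q (rev V) (\<lambda>a. \<tau> a a') a = hecke_word Q V (\<tau> a) a'"
      using hecke_word_transfer[of "rev V" Q \<tau> a' a] tau idx by simp
    then show "hecke_word Q W (\<lambda>a. projector l k a a') a * hecke_word Q (rev V) (\<lambda>a. \<tau> a a') a
      = hecke_word Q (rev W) (projector k l a) a' * hecke_word Q V (\<tau> a) a'"
      using key S by simp
  qed
  also have "\<dots> = (\<Sum>a\<in>?S. \<Sum>a'\<in>?S. hecke_word Q (rev W) (projector k l a) a' * hecke_word Q V (\<tau> a) a')"
    by (rule sum.swap)
  also have "\<dots> = (\<Sum>a\<in>?S. \<Sum>a'\<in>?S. projector k l a a' * hecke_word Q (rev (rev W)) (hecke_word Q V (\<tau> a)) a')"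
    by (rule sum.cong[OF refl], rule hecke_word_adjoint) (use idx in auto)
  finally show ?thesis by (simp add: WV)
qed

text \<open>The expansion of a functional on the product of the components of chi_k and chi_l, where
  \<open>G\<close> holds its values on pairs of monomials. \<open>L\<close> and \<open>J\<close> are
  column sets; the row sets are hidden in \<open>same_blocks\<close>, which makes the row words of
  the two tensor factors share them.\<close>

definition minor_sum :: "nat \<Rightarrow> nat \<Rightarrow> (word \<Rightarrow> word \<Rightarrow> word \<Rightarrow> word \<Rightarrow> complex) \<Rightarrow> nat \<Rightarrow> nat \<Rightarrow> complex" where
  "minor_sum m n G l k = (\<Sum>L | L \<subseteq> {1..n} \<and> card L = l. \<Sum>J | J \<subseteq> {1..n} \<and> card J = k.
    \<Sum>a\<in>words (l + k) m. \<Sum>a'\<in>words (l + k) m.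
      (if same_blocks l k a a' then blocks_sign l k a * blocks_sign l k a' else 0) *
      G a (append_word l (sorted_word L) (sorted_word J)) a' (append_word l (sorted_word L) (sorted_word J)))"

lemma block_antisymmetric_sum:
  assumes "\<And>x. block_antisymmetric l k (f x)"
  shows "block_antisymmetric l k (\<lambda>w. \<Sum>x\<in>A. f x w)"
  unfolding block_antisymmetric_def antisymmetric_at_def
proof (intro allI impI ext)
  fix i w assume i: "Suc i < l + k" "Suc i \<noteq> l"
  have "hecke Q i (f x) w = - inverse Q * f x w" for x
    using assms[of x] i unfolding block_antisymmetric_def antisymmetric_at_def by simp
  then show "hecke Q i (\<lambda>w. \<Sum>x\<in>A. f x w) w = - inverse Q * (\<Sum>x\<in>A. f x w)"
    unfolding hecke_sum sum_distrib_left by (intro sum.cong HOL.refl)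
qed

text \<open>An operator on the free argument of \<open>g\<close> can be moved to the contracted one,
  and from there by symmetry onto \<open>p\<close>, where it acts as the scalar -1/Q.\<close>

lemma block_antisymmetric_contract:
  assumes p: "block_antisymmetric l k p"
    and g: "\<And>i a b. Suc i < l + k \<Longrightarrow> hecke Q i (\<lambda>a. g a b) a = hecke Q i (g a) b"
  shows "block_antisymmetric l k (\<lambda>b. \<Sum>a\<in>words (l + k) m. p a * g a b)"
  unfolding block_antisymmetric_def antisymmetric_at_def
proof (intro allI impI ext)
  fix i b assume i: "Suc i < l + k" "Suc i \<noteq> l"
  have "hecke Q i (\<lambda>b. \<Sum>a\<in>words (l + k) m. p a * g a b) b
      = (\<Sum>a\<in>words (l + k) m. p a * hecke Q i (\<lambda>a. g a b) a)"
    by (simp add: hecke_sum hecke_scale g[OF i(1)])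
  also have "\<dots> = (\<Sum>a\<in>words (l + k) m. hecke Q i p a * g a b)"
    by (rule hecke_symmetric[OF i(1), symmetric])
  also have "\<dots> = - inverse Q * (\<Sum>a\<in>words (l + k) m. p a * g a b)"
    using p i by (simp add: block_antisymmetric_def antisymmetric_at_def sum_distrib_left sum_negf mult.assoc)
  finally show "hecke Q i (\<lambda>b. \<Sum>a\<in>words (l + k) m. p a * g a b) b
      = - inverse Q * (\<Sum>a\<in>words (l + k) m. p a * g a b)" .
qed

text \<open>Contracting the row words with the projector makes the result antisymmetric in both
  column words. On the diagonal its value at \<open>b\<close> is the squared sign times the value at
  the sorted word, and summing the squares over all \<open>b\<close> with given letter sets yields
  exactly the norms in the denominator of the projector.\<close>

lemma minor_sum_projector:
  fixes G :: "word \<Rightarrow> word \<Rightarrow> word \<Rightarrow> word \<Rightarrow> complex"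
  assumes G1: "\<And>i a b a' b'. Suc i < l + k \<Longrightarrow> hecke Q i (\<lambda>a. G a b a' b') a = hecke Q i (\<lambda>b. G a b a' b') b"
    and G2: "\<And>i a b a' b'. Suc i < l + k \<Longrightarrow> hecke Q i (\<lambda>a'. G a b a' b') a' = hecke Q i (\<lambda>b'. G a b a' b') b'"
  shows "minor_sum m n G l k = (\<Sum>a\<in>words (l + k) m. \<Sum>a'\<in>words (l + k) m.
    projector l k a a' * (\<Sum>b\<in>words (l + k) n. G a b a' b))"
proof -
  let ?S = "words (l + k) m"
  define v where "v b b' = (\<Sum>a\<in>?S. \<Sum>a'\<in>?S. projector l k a a' * G a b a' b')" for b b'
  have anti1: "block_antisymmetric l k (\<lambda>b. v b b')" for b'
  proof -
    have "(\<lambda>b. v b b') = (\<lambda>b. \<Sum>a'\<in>?S. \<Sum>a\<in>?S. projector l k a a' * G a b a' b')"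
      unfolding v_def by (intro ext sum.swap)
    then show ?thesis
      by (simp only:) (intro block_antisymmetric_sum block_antisymmetric_contract block_antisymmetric_projector G1)
  qed
  have anti2: "block_antisymmetric l k (\<lambda>b'. v b b')" for b
    unfolding v_def
    by (intro block_antisymmetric_sum block_antisymmetric_contract block_antisymmetric_projector2 G2)
  define s where "s L J = append_word l (sorted_word L) (sorted_word J)" for L J
  \<comment> \<open>The same column word stands in both arguments, so the two expansions give the
    same sign and it appears squared.\<close>
  have diag: "v b b = (blocks_sign l k b)\<^sup>2 * v (sort_block l k (sort_block 0 l b)) (sort_block l k (sort_block 0 l b))" for b
    by (subst block_antisymmetric_expand[OF anti1], subst block_antisymmetric_expand[OF anti2])
      (simp add: power2_eq_square)
  have diag': "v (append_word l x y) (append_word l x y)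
      = block_sign 0 l x * (block_sign 0 l x * (block_sign 0 k y * (block_sign 0 k y * v (s (x ` {..<l}) (y ` {..<k})) (s (x ` {..<l}) (y ` {..<k})))))"
    if "x \<in> words l n" "y \<in> words k n" for x y
  proof (cases "block_sign 0 l x = 0 \<or> block_sign 0 k y = 0")
    case True
    then show ?thesis using diag[of "append_word l x y"]
      by (auto simp: blocks_sign_def block_sign_append_word)
  next
    case False
    then have "sort_block l k (sort_block 0 l (append_word l x y)) = s (x ` {..<l}) (y ` {..<k})"
      unfolding s_def using that by (intro sort_blocks_append_word block_sign_nonzero_card) auto
    then show ?thesis using diag[of "append_word l x y"]
      by (simp add: blocks_sign_def block_sign_append_word power2_eq_square)
  qed
  have "(\<Sum>a\<in>?S. \<Sum>a'\<in>?S. projector l k a a' * (\<Sum>b\<in>words (l + k) n. G a b a' b))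
      = (\<Sum>a\<in>?S. \<Sum>b\<in>words (l + k) n. \<Sum>a'\<in>?S. projector l k a a' * G a b a' b)"
    unfolding sum_distrib_left by (rule sum.cong[OF refl], rule sum.swap)
  also have "\<dots> = (\<Sum>b\<in>words (l + k) n. v b b)"
    unfolding v_def by (rule sum.swap)
  also have "\<dots> = (\<Sum>x\<in>words l n. block_sign 0 l x * (\<Sum>y\<in>words k n. block_sign 0 k y * (block_sign 0 l x * (block_sign 0 k y *
      v (s (x ` {..<l}) (y ` {..<k})) (s (x ` {..<l}) (y ` {..<k}))))))"
    unfolding sum_words_append sum_distrib_left
    by (rule sum.cong[OF refl], rule sum.cong[OF refl]) (simp add: diag' ac_simps)
  also have "\<dots> = (\<Sum>L | L \<subseteq> {1..n} \<and> card L = l. \<Sum>x | x \<in> words l n \<and> x ` {..<l} = L.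
      block_sign 0 l x * (\<Sum>J | J \<subseteq> {1..n} \<and> card J = k. \<Sum>y | y \<in> words k n \<and> y ` {..<k} = J.
        block_sign 0 k y * (block_sign 0 l x * (block_sign 0 k y *
      v (s (x ` {..<l}) (y ` {..<k})) (s (x ` {..<l}) (y ` {..<k}))))))"
    unfolding sum_words_by_image ..
  also have "\<dots> = (\<Sum>L | L \<subseteq> {1..n} \<and> card L = l. \<Sum>x | x \<in> words l n \<and> x ` {..<l} = L.
      \<Sum>J | J \<subseteq> {1..n} \<and> card J = k. \<Sum>y | y \<in> words k n \<and> y ` {..<k} = J.
        (block_sign 0 l x)\<^sup>2 * ((block_sign 0 k y)\<^sup>2 * v (s L J) (s L J)))"
    unfolding sum_distrib_left
    by (intro sum.cong[OF refl]) (auto simp: power2_eq_square)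
  also have "\<dots> = (\<Sum>L | L \<subseteq> {1..n} \<and> card L = l. \<Sum>J | J \<subseteq> {1..n} \<and> card J = k.
      \<Sum>x | x \<in> words l n \<and> x ` {..<l} = L. \<Sum>y | y \<in> words k n \<and> y ` {..<k} = J.
        (block_sign 0 l x)\<^sup>2 * ((block_sign 0 k y)\<^sup>2 * v (s L J) (s L J)))"
    by (rule sum.cong[OF refl], rule sum.swap)
  also have "\<dots> = (\<Sum>L | L \<subseteq> {1..n} \<and> card L = l. \<Sum>J | J \<subseteq> {1..n} \<and> card J = k.
      sign_norm l * (sign_norm k * v (s L J) (s L J)))"
  proof (rule sum.cong[OF refl], rule sum.cong[OF refl])
    fix L J assume LJ: "L \<in> {L. L \<subseteq> {1..n} \<and> card L = l}" "J \<in> {J. J \<subseteq> {1..n} \<and> card J = k}"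
    show "(\<Sum>x | x \<in> words l n \<and> x ` {..<l} = L. \<Sum>y | y \<in> words k n \<and> y ` {..<k} = J.
        (block_sign 0 l x)\<^sup>2 * ((block_sign 0 k y)\<^sup>2 * v (s L J) (s L J)))
      = sign_norm l * (sign_norm k * v (s L J) (s L J))"
      using sum_block_sign_square[of L n l] sum_block_sign_square[of J n k] LJ
      by (simp flip: sum_distrib_left sum_distrib_right)
  qed
  also have "\<dots> = minor_sum m n G l k"
    unfolding minor_sum_def v_def s_def[symmetric] projector_def sum_distrib_left
    by (intro sum.cong[OF refl]) (simp add: sign_norm_nonzero)
  finally show ?thesis ..
qed

lemma minor_sum_commute:
  fixes G :: "word \<Rightarrow> word \<Rightarrow> word \<Rightarrow> word \<Rightarrow> complex"
  assumes G1: "\<And>i a b a' b'. Suc i < l + k \<Longrightarrow> a \<in> words (l + k) m \<Longrightarrow> b \<in> words (l + k) n \<Longrightarrow>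
      a' \<in> words (l + k) m \<Longrightarrow> b' \<in> words (l + k) n \<Longrightarrow>
      hecke Q i (\<lambda>a. G a b a' b') a = hecke Q i (\<lambda>b. G a b a' b') b"
    and G2: "\<And>i a b a' b'. Suc i < l + k \<Longrightarrow> a \<in> words (l + k) m \<Longrightarrow> b \<in> words (l + k) n \<Longrightarrow>
      a' \<in> words (l + k) m \<Longrightarrow> b' \<in> words (l + k) n \<Longrightarrow>
      hecke Q i (\<lambda>a'. G a b a' b') a' = hecke Q i (\<lambda>b'. G a b a' b') b'"
  shows "minor_sum m n G l k = minor_sum m n G k l"
proof -
  let ?S = "words (l + k) m" and ?T = "words (l + k) n"
  \<comment> \<open>The hypotheses concern genuine words only, whereas the trace argument applies
    Hecke operators to functions of arbitrary words. Extension by 0 is compatible with the operators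
    because swaps inside the range preserve the sets of words.\<close>
  define G0 where "G0 a b a' b' = (if a \<in> ?S \<and> b \<in> ?T \<and> a' \<in> ?S \<and> b' \<in> ?T then G a b a' b' else 0)"
    for a b a' b'
  have app: "append_word l' (sorted_word L) (sorted_word J) \<in> words (l' + k') n"
    if "L \<subseteq> {1..n}" "card L = l'" "J \<subseteq> {1..n}" "card J = k'" for l' k' L J
    using that append_word_in_words sorted_word_in_words by blast
  have eq: "minor_sum m n G l' k' = minor_sum m n G0 l' k'" if "l' + k' = l + k" for l' k'
    unfolding minor_sum_def using app[of _ l' _ k'] that
    by (intro sum.cong[OF refl]) (simp add: G0_def)
  have H1: "hecke Q i (\<lambda>a. G0 a b a' b') a = hecke Q i (\<lambda>b. G0 a b a' b') b" if "Suc i < l + k" for i a b a' b'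
  proof (cases "a \<in> ?S \<and> b \<in> ?T \<and> a' \<in> ?S \<and> b' \<in> ?T")
    case True
    then have "hecke Q i (\<lambda>a. G0 a b a' b') a = hecke Q i (\<lambda>a. G a b a' b') a"
      "hecke Q i (\<lambda>b. G0 a b a' b') b = hecke Q i (\<lambda>b. G a b a' b') b"
      using that by (simp_all add: hecke_def G0_def swap_at_words_iff)
    then show ?thesis using G1[OF that, of a b a' b'] True by simp
  next
    case False
    then show ?thesis using that by (auto simp: hecke_def G0_def swap_at_words_iff)
  qed
  have H2: "hecke Q i (\<lambda>a'. G0 a b a' b') a' = hecke Q i (\<lambda>b'. G0 a b a' b') b'" if "Suc i < l + k" for i a b a' b'
  proof (cases "a \<in> ?S \<and> b \<in> ?T \<and> a' \<in> ?S \<and> b' \<in> ?T")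
    case True
    then have "hecke Q i (\<lambda>a'. G0 a b a' b') a' = hecke Q i (\<lambda>a'. G a b a' b') a'"
      "hecke Q i (\<lambda>b'. G0 a b a' b') b' = hecke Q i (\<lambda>b'. G a b a' b') b'"
      using that by (simp_all add: hecke_def G0_def swap_at_words_iff)
    then show ?thesis using G2[OF that, of a b a' b'] True by simp
  next
    case False
    then show ?thesis using that by (auto simp: hecke_def G0_def swap_at_words_iff)
  qed
  define \<tau> where "\<tau> a a' = (\<Sum>b\<in>?T. G0 a b a' b)" for a a'
  \<comment> \<open>The operator travels from \<open>a\<close> to the first column word, along the
    diagonal sum to the second column word, and from there to \<open>a'\<close>.\<close>
  have tau: "hecke Q i (\<lambda>a. \<tau> a a') a = hecke Q i (\<tau> a) a'" if i: "Suc i < l + k" for i a a'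
  proof -
    define g where "g b b' = G0 a b a' b'" for b b'
    \<comment> \<open>Invariance of the diagonal sum under an operator whose matrix is symmetric:
      the exchange terms correspond under \<open>b\<close> to \<open>swap_at i b\<close>, and the
      diagonal terms agree.\<close>
    have dg: "(\<Sum>b\<in>?T. hecke Q i (\<lambda>c. g c b) b) = (\<Sum>b\<in>?T. hecke Q i (\<lambda>c. g b c) b)"
    proof -
      have "(\<Sum>b\<in>?T. if b i = b (Suc i) then 0 else g (swap_at i b) b)
          = (\<Sum>b\<in>?T. if b i = b (Suc i) then 0 else g b (swap_at i b))"
        by (rule sum.reindex_bij_witness[of _ "swap_at i" "swap_at i"])
          (use i in \<open>auto simp: swap_at_words_iff\<close>)
      moreover have "hecke Q i (\<lambda>c. g c b) b = (if b i = b (Suc i) then 0 else g (swap_at i b) b)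
          + (if b i = b (Suc i) then Q else if b i < b (Suc i) then Q - inverse Q else 0) * g b b"
        "hecke Q i (\<lambda>c. g b c) b = (if b i = b (Suc i) then 0 else g b (swap_at i b))
          + (if b i = b (Suc i) then Q else if b i < b (Suc i) then Q - inverse Q else 0) * g b b" for b
        by (simp_all add: hecke_def)
      ultimately show ?thesis by (simp add: sum.distrib)
    qed
    have "hecke Q i (\<lambda>a. \<tau> a a') a = (\<Sum>b\<in>?T. hecke Q i (\<lambda>c. g c b) b)"
      unfolding \<tau>_def g_def using H1[OF i] by (simp add: hecke_sum)
    also have "\<dots> = (\<Sum>b\<in>?T. hecke Q i (\<lambda>a'. G0 a b a' b) a')"
      unfolding dg unfolding g_def using H2[OF i] by simp
    also have "\<dots> = hecke Q i (\<tau> a) a'"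
      unfolding \<tau>_def by (simp add: hecke_sum)
    finally show ?thesis .
  qed
  have "minor_sum m n G l k = (\<Sum>a\<in>?S. \<Sum>a'\<in>?S. projector l k a a' * \<tau> a a')"
    unfolding eq[OF refl] \<tau>_def by (rule minor_sum_projector) (fact H1 H2)+
  also have "\<dots> = (\<Sum>a\<in>?S. \<Sum>a'\<in>?S. projector k l a a' * \<tau> a a')"
    by (rule projector_trace) (fact tau)
  also have "\<dots> = minor_sum m n G0 k l"
    using minor_sum_projector[of k l G0 m n] H1 H2 unfolding \<tau>_def by (simp add: add.commute)
  also have "\<dots> = minor_sum m n G k l" by (rule eq[symmetric]) simp
  finally show ?thesis .
qed

end

section \<open>Noncommutative complex algebras\<close>

locale complex_algebra = ring A for A :: "(complex, 'a) module" (structure) +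
  assumes smult_closed [simp]: "x \<in> carrier A \<Longrightarrow> c \<odot> x \<in> carrier A"
    and smult_add_left: "x \<in> carrier A \<Longrightarrow> (c + d) \<odot> x = c \<odot> x \<oplus> d \<odot> x"
    and smult_add_right: "x \<in> carrier A \<Longrightarrow> y \<in> carrier A \<Longrightarrow> c \<odot> (x \<oplus> y) = c \<odot> x \<oplus> c \<odot> y"
    and smult_smult: "x \<in> carrier A \<Longrightarrow> c \<odot> (d \<odot> x) = (c * d) \<odot> x"
    and smult_one [simp]: "x \<in> carrier A \<Longrightarrow> 1 \<odot> x = x"
    and smult_mult_left: "x \<in> carrier A \<Longrightarrow> y \<in> carrier A \<Longrightarrow> (c \<odot> x) \<otimes> y = c \<odot> (x \<otimes> y)"
    and smult_mult_right: "x \<in> carrier A \<Longrightarrow> y \<in> carrier A \<Longrightarrow> x \<otimes> (c \<odot> y) = c \<odot> (x \<otimes> y)"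
begin

lemma smult_zero_left [simp]:
  assumes "x \<in> carrier A" shows "0 \<odot> x = \<zero>"
proof -
  have "0 \<odot> x \<oplus> 0 \<odot> x = 0 \<odot> x" using smult_add_left[OF assms, of 0 0] by simp
  then show ?thesis using assms by (metis add.l_cancel_one' smult_closed)
qed

lemma smult_zero_right [simp]: "c \<odot> \<zero> = \<zero>"
proof -
  have "c \<odot> \<zero> \<oplus> c \<odot> \<zero> = c \<odot> \<zero>" using smult_add_right[of \<zero> \<zero> c] by simp
  then show ?thesis by (metis add.l_cancel_one' smult_closed zero_closed)
qed

lemma smult_minus_one:
  assumes "x \<in> carrier A" shows "(- 1) \<odot> x = \<ominus> x"
proof -
  have "(- 1) \<odot> x \<oplus> 1 \<odot> x = \<zero>" using smult_add_left[OF assms, of "- 1" 1] assms by simp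
  then show ?thesis using assms by (intro minus_equality[symmetric]) auto
qed

text \<open>Linearity is assumed on a subspace because it is later applied to functionals given on
  \<open>carrier M\<close> or on a single bidegree. Membership of the sum in the subspace is proved
  along with the value.\<close>

lemma linear_functional_finsum_subspace:
  assumes "linear_functional A V \<phi>" "V \<subseteq> carrier A" "\<zero> \<in> V"
    and "\<And>x y. x \<in> V \<Longrightarrow> y \<in> V \<Longrightarrow> x \<oplus> y \<in> V"
    and "finite S" "\<And>i. i \<in> S \<Longrightarrow> f i \<in> V"
  shows "(\<Oplus>i\<in>S. f i) \<in> V \<and> \<phi> (\<Oplus>i\<in>S. f i) = (\<Sum>i\<in>S. \<phi> (f i))"
proof -
  have \<phi>_zero: "\<phi> \<zero> = 0" using assms(1,3) unfolding linear_functional_def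
    by (metis mult_zero_left smult_zero_left zero_closed)
  have \<phi>_add: "\<phi> (x \<oplus> y) = \<phi> x + \<phi> y" if "x \<in> V" "y \<in> V" for x y
    using that assms(1) by (simp add: linear_functional_def)
  have "f \<in> S \<rightarrow> carrier A" using assms(2,6) by auto
  with assms(5,6) show ?thesis
  proof (induction S rule: finite_induct)
    case (insert i S)
    then show ?case using assms(2,4) by (auto simp: \<phi>_add Pi_iff)
  qed (simp add: \<phi>_zero assms(3))
qed

lemma linear_functional_finsum:
  assumes "linear_functional A (carrier A) \<phi>" "finite S" "\<And>i. i \<in> S \<Longrightarrow> f i \<in> carrier A"
  shows "\<phi> (\<Oplus>i\<in>S. f i) = (\<Sum>i\<in>S. \<phi> (f i))"
  using linear_functional_finsum_subspace[OF assms(1) _ _ _ assms(2)] assms(3) by simp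

lemma ideal_smult_closed:
  assumes "ideal I A" "x \<in> I" shows "c \<odot> x \<in> I"
proof -
  interpret ideal I A by fact
  have "c \<odot> x = (c \<odot> \<one>) \<otimes> x" using assms(2) by (simp add: smult_mult_left)
  then show ?thesis using assms(2) by (simp add: I_l_closed)
qed

end

section \<open>Monoid algebras\<close>

definition mon_mult :: "('w, 'c) monoid_scheme \<Rightarrow> ('w \<Rightarrow>\<^sub>0 complex) \<Rightarrow> ('w \<Rightarrow>\<^sub>0 complex) \<Rightarrow> ('w \<Rightarrow>\<^sub>0 complex)" where
  "mon_mult M f g = (\<Sum>x\<in>Poly_Mapping.keys f. \<Sum>y\<in>Poly_Mapping.keys g.
       Poly_Mapping.single (x \<otimes>\<^bsub>M\<^esub> y) (Poly_Mapping.lookup f x * Poly_Mapping.lookup g y))"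

abbreviation pm_scale :: "complex \<Rightarrow> ('w \<Rightarrow>\<^sub>0 complex) \<Rightarrow> ('w \<Rightarrow>\<^sub>0 complex)" where
  "pm_scale c \<equiv> Poly_Mapping.map ((*) c)"

lemma lookup_pm_scale [simp]: "Poly_Mapping.lookup (pm_scale c f) x = c * Poly_Mapping.lookup f x"
  by (simp add: map.rep_eq when_def)

lemma pm_scale_single [simp]: "pm_scale c (Poly_Mapping.single x a) = Poly_Mapping.single x (c * a)"
  by (rule poly_mapping_eqI) (simp add: lookup_single when_def)

lemma keys_pm_scale: "Poly_Mapping.keys (pm_scale c f) \<subseteq> Poly_Mapping.keys f"
  by (auto simp: in_keys_iff)

lemma pm_scale_vector_space: "vector_space pm_scale"
  by unfold_locales (auto intro!: poly_mapping_eqI simp: lookup_add algebra_simps)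

lemma sum_single_keys: "(\<Sum>x\<in>Poly_Mapping.keys f. Poly_Mapping.single x (Poly_Mapping.lookup f x)) = f"
  by (rule poly_mapping_eqI)
    (simp add: lookup_sum lookup_single when_def in_keys_iff)

text \<open>The supports in the definition vary with the arguments. Enlarging them to common finite
  sets reduces bilinearity to termwise identities.\<close>

lemma mon_mult_superset:
  assumes "finite S" "finite T" "Poly_Mapping.keys f \<subseteq> S" "Poly_Mapping.keys g \<subseteq> T"
  shows "mon_mult M f g = (\<Sum>x\<in>S. \<Sum>y\<in>T.
    Poly_Mapping.single (x \<otimes>\<^bsub>M\<^esub> y) (Poly_Mapping.lookup f x * Poly_Mapping.lookup g y))"
proof -
  have "(\<Sum>x\<in>S. \<Sum>y\<in>T. Poly_Mapping.single (x \<otimes>\<^bsub>M\<^esub> y) (Poly_Mapping.lookup f x * Poly_Mapping.lookup g y))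
     = (\<Sum>x\<in>S. \<Sum>y\<in>Poly_Mapping.keys g. Poly_Mapping.single (x \<otimes>\<^bsub>M\<^esub> y) (Poly_Mapping.lookup f x * Poly_Mapping.lookup g y))"
    using assms by (intro sum.cong[OF refl] sum.mono_neutral_right) (auto simp: in_keys_iff)
  also have "\<dots> = mon_mult M f g"
    unfolding mon_mult_def using assms by (intro sum.mono_neutral_right) (auto simp: in_keys_iff)
  finally show ?thesis by simp
qed

lemma mon_mult_single [simp]:
  "mon_mult M (Poly_Mapping.single x a) (Poly_Mapping.single y b) = Poly_Mapping.single (x \<otimes>\<^bsub>M\<^esub> y) (a * b)"
  by (subst mon_mult_superset[of "{x}" "{y}"]) (auto split: if_splits)

lemma mon_mult_add_left: "mon_mult M (f + f') g = mon_mult M f g + mon_mult M f' g"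
  by (simp add: mon_mult_superset[of "Poly_Mapping.keys f \<union> Poly_Mapping.keys f'" "Poly_Mapping.keys g"] keys_add
    lookup_add single_add distrib_right sum.distrib)

lemma mon_mult_add_right: "mon_mult M f (g + g') = mon_mult M f g + mon_mult M f g'"
  by (simp add: mon_mult_superset[of "Poly_Mapping.keys f" "Poly_Mapping.keys g \<union> Poly_Mapping.keys g'"] keys_add
    lookup_add single_add distrib_left sum.distrib)

lemma mon_mult_zero [simp]: "mon_mult M 0 g = 0" "mon_mult M f 0 = 0"
  by (simp_all add: mon_mult_def)

lemma mon_mult_sum_left: "mon_mult M (\<Sum>i\<in>S. f i) g = (\<Sum>i\<in>S. mon_mult M (f i) g)"
  by (induction S rule: infinite_finite_induct) (simp_all add: mon_mult_add_left)

lemma mon_mult_sum_right: "mon_mult M f (\<Sum>i\<in>S. g i) = (\<Sum>i\<in>S. mon_mult M f (g i))"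
  by (induction S rule: infinite_finite_induct) (simp_all add: mon_mult_add_right)

lemma pm_scale_sum: "pm_scale c (\<Sum>i\<in>S. f i) = (\<Sum>i\<in>S. pm_scale c (f i))"
  by (rule poly_mapping_eqI) (simp add: lookup_sum sum_distrib_left)

lemma mon_mult_expand:
  "mon_mult M f g = (\<Sum>x\<in>Poly_Mapping.keys f. mon_mult M (Poly_Mapping.single x (Poly_Mapping.lookup f x)) g)"
  by (subst sum_single_keys[of f, symmetric]) (simp only: mon_mult_sum_left)

lemma mon_mult_single_left:
  "mon_mult M (Poly_Mapping.single x a) g =
    (\<Sum>y\<in>Poly_Mapping.keys g. Poly_Mapping.single (x \<otimes>\<^bsub>M\<^esub> y) (a * Poly_Mapping.lookup g y))"
  by (subst mon_mult_superset[of "{x}" "Poly_Mapping.keys g"]) auto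

lemma mon_mult_assoc:
  assumes "monoid M" "Poly_Mapping.keys f \<subseteq> carrier M" "Poly_Mapping.keys g \<subseteq> carrier M"
    "Poly_Mapping.keys h \<subseteq> carrier M"
  shows "mon_mult M (mon_mult M f g) h = mon_mult M f (mon_mult M g h)"
proof -
  have "mon_mult M (mon_mult M f g) h = (\<Sum>x\<in>Poly_Mapping.keys f. \<Sum>y\<in>Poly_Mapping.keys g. \<Sum>z\<in>Poly_Mapping.keys h.
     Poly_Mapping.single ((x \<otimes>\<^bsub>M\<^esub> y) \<otimes>\<^bsub>M\<^esub> z) (Poly_Mapping.lookup f x * Poly_Mapping.lookup g y * Poly_Mapping.lookup h z))"
    by (simp only: mon_mult_def[of M f g] mon_mult_sum_left mon_mult_single_left)
  also have "\<dots> = (\<Sum>x\<in>Poly_Mapping.keys f. \<Sum>y\<in>Poly_Mapping.keys g. \<Sum>z\<in>Poly_Mapping.keys h.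
     Poly_Mapping.single (x \<otimes>\<^bsub>M\<^esub> (y \<otimes>\<^bsub>M\<^esub> z)) (Poly_Mapping.lookup f x * (Poly_Mapping.lookup g y * Poly_Mapping.lookup h z)))"
    using assms by (intro sum.cong[OF refl]) (auto simp: monoid.m_assoc mult.assoc subset_iff)
  also have "\<dots> = mon_mult M f (mon_mult M g h)"
    unfolding mon_mult_expand[of M f] unfolding mon_mult_def[of M g h]
    by (simp only: mon_mult_sum_right mon_mult_single)
  finally show ?thesis .
qed

lemma mon_mult_scale_left: "mon_mult M (pm_scale c f) g = pm_scale c (mon_mult M f g)"
  by (simp add: mon_mult_superset[of "Poly_Mapping.keys f" "Poly_Mapping.keys g"] keys_pm_scale pm_scale_sum mult.assoc)

lemma mon_mult_scale_right: "mon_mult M f (pm_scale c g) = pm_scale c (mon_mult M f g)"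
  by (simp add: mon_mult_superset[of "Poly_Mapping.keys f" "Poly_Mapping.keys g"] keys_pm_scale pm_scale_sum mult.left_commute)

lemma keys_mon_mult:
  assumes "monoid M" "Poly_Mapping.keys f \<subseteq> carrier M" "Poly_Mapping.keys g \<subseteq> carrier M"
  shows "Poly_Mapping.keys (mon_mult M f g) \<subseteq> carrier M"
proof -
  have "Poly_Mapping.keys (mon_mult M f g) \<subseteq> (\<Union>x\<in>Poly_Mapping.keys f. \<Union>y\<in>Poly_Mapping.keys g.
     Poly_Mapping.keys (Poly_Mapping.single (x \<otimes>\<^bsub>M\<^esub> y) (Poly_Mapping.lookup f x * Poly_Mapping.lookup g y)))"
    unfolding mon_mult_def by (intro order.trans[OF keys_sum] UN_mono order.refl)
  also have "\<dots> \<subseteq> carrier M"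
    using assms monoid.m_closed[OF assms(1)] by (auto split: if_splits)
  finally show ?thesis .
qed

lemma mon_mult_one:
  assumes "monoid M" "Poly_Mapping.keys f \<subseteq> carrier M"
  shows "mon_mult M (Poly_Mapping.single \<one>\<^bsub>M\<^esub> 1) f = f" "mon_mult M f (Poly_Mapping.single \<one>\<^bsub>M\<^esub> 1) = f"
proof -
  have "mon_mult M (Poly_Mapping.single \<one>\<^bsub>M\<^esub> 1) f = (\<Sum>x\<in>Poly_Mapping.keys f. Poly_Mapping.single x (Poly_Mapping.lookup f x))"
    using assms by (subst sum_single_keys[of f, symmetric], subst mon_mult_sum_right)
      (intro sum.cong[OF refl], auto simp: monoid.l_one subset_iff)
  then show "mon_mult M (Poly_Mapping.single \<one>\<^bsub>M\<^esub> 1) f = f" by (simp add: sum_single_keys)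
  have "mon_mult M f (Poly_Mapping.single \<one>\<^bsub>M\<^esub> 1) = (\<Sum>x\<in>Poly_Mapping.keys f. Poly_Mapping.single x (Poly_Mapping.lookup f x))"
    using assms by (subst sum_single_keys[of f, symmetric], subst mon_mult_sum_left)
      (intro sum.cong[OF refl], auto simp: monoid.r_one subset_iff)
  then show "mon_mult M f (Poly_Mapping.single \<one>\<^bsub>M\<^esub> 1) = f" by (simp add: sum_single_keys)
qed

lemma monoid_algebra_simps [simp]:
  "carrier (monoid_algebra M) = {f. Poly_Mapping.keys f \<subseteq> carrier M}"
  "mult (monoid_algebra M) = mon_mult M"
  "one (monoid_algebra M) = Poly_Mapping.single \<one>\<^bsub>M\<^esub> 1"
  "zero (monoid_algebra M) = 0"
  "add (monoid_algebra M) = (+)"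
  "smult (monoid_algebra M) = pm_scale"
  by (simp_all add: monoid_algebra_def mon_mult_def fun_eq_iff)

lemma complex_algebra_monoid_algebra:
  assumes "monoid M"
  shows "complex_algebra (monoid_algebra M)"
proof -
  interpret V: vector_space "pm_scale :: complex \<Rightarrow> ('a \<Rightarrow>\<^sub>0 complex) \<Rightarrow> _" by (rule pm_scale_vector_space)
  have scale: "Poly_Mapping.keys (pm_scale c f) \<subseteq> carrier M"
    if "Poly_Mapping.keys f \<subseteq> carrier M" for c and f :: "'a \<Rightarrow>\<^sub>0 complex"
    using that keys_pm_scale[of c f] by blast
  have add: "Poly_Mapping.keys (f + g) \<subseteq> carrier M"
    if "Poly_Mapping.keys f \<subseteq> carrier M" "Poly_Mapping.keys g \<subseteq> carrier M" for f g :: "'a \<Rightarrow>\<^sub>0 complex"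
    using that keys_add[of f g] by blast
  interpret ring "monoid_algebra M"
  proof (rule ringI)
    show "abelian_group (monoid_algebra M)"
    proof (rule abelian_groupI)
      fix x assume "x \<in> carrier (monoid_algebra M)"
      then show "\<exists>y\<in>carrier (monoid_algebra M). y \<oplus>\<^bsub>monoid_algebra M\<^esub> x = \<zero>\<^bsub>monoid_algebra M\<^esub>"
        by (intro bexI[of _ "- x"]) auto
    qed (auto simp: add ac_simps)
    show "Group.monoid (monoid_algebra M)"
      by (rule monoidI) (use assms in \<open>auto simp: keys_mon_mult mon_mult_assoc mon_mult_one monoid.one_closed\<close>)
  qed (auto simp: mon_mult_add_left mon_mult_add_right)
  show ?thesis
    by unfold_locales
      (simp_all add: scale mon_mult_scale_left mon_mult_scale_right V.scale_left_distrib
        V.scale_right_distrib)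
qed

section \<open>Quotients, subalgebras and separating functionals\<close>

lemma (in ring) coset_eq_iff:
  assumes "ideal I R" "x \<in> carrier R" "y \<in> carrier R"
  shows "I +> x = I +> y \<longleftrightarrow> x \<ominus> y \<in> I"
proof -
  interpret I: ideal I R by fact
  show ?thesis
  proof
    assume "I +> x = I +> y"
    then have "x \<in> I +> y" using I.a_rcos_self[OF assms(2)] by simp
    then obtain h where "h \<in> I" "x = h \<oplus> y" by (auto simp: a_r_coset_def')
    then show "x \<ominus> y \<in> I" using assms(3) by (simp add: a_minus_def a_assoc r_neg I.a_Hcarr)
  next
    assume h: "x \<ominus> y \<in> I"
    have "x = (x \<ominus> y) \<oplus> y" using assms by (simp add: a_minus_def a_assoc l_neg)
    then have "x \<in> I +> y" using h by (auto simp: a_r_coset_def')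
    then show "I +> x = I +> y"
      using a_repr_independence[OF _ assms(3)] I.additive_subgroup_axioms
      by (metis I.a_subgroup additive_subgroup_def)
  qed
qed

locale quotient_setup = complex_algebra A for A :: "(complex, 'a) module" (structure) + fixes I
  assumes ideal: "ideal I A"
begin

abbreviation Quo where "Quo \<equiv> quotient_algebra A I"

lemma carrier_quotient: "carrier Quo = (\<lambda>x. I +> x) ` carrier A"
  by (auto simp: quotient_algebra_def FactRing_def A_RCOSETS_def')

lemma coset_hom:
  assumes "x \<in> carrier A" "y \<in> carrier A"
  shows "(I +> x) \<oplus>\<^bsub>Quo\<^esub> (I +> y) = I +> (x \<oplus> y)"
    "(I +> x) \<otimes>\<^bsub>Quo\<^esub> (I +> y) = I +> (x \<otimes> y)"
    "c \<odot>\<^bsub>Quo\<^esub> (I +> x) = I +> (c \<odot> x)"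
proof -
  interpret I: ideal I A by (rule ideal)
  show "(I +> x) \<oplus>\<^bsub>Quo\<^esub> (I +> y) = I +> (x \<oplus> y)" "(I +> x) \<otimes>\<^bsub>Quo\<^esub> (I +> y) = I +> (x \<otimes> y)"
    using ring_hom_add[OF I.rcos_ring_hom assms] ring_hom_mult[OF I.rcos_ring_hom assms]
    by (simp_all add: quotient_algebra_def)
  \<comment> \<open>Scalar multiples of cosets are unions over representatives. All members of the
    union coincide, since two representatives differ by an element of the ideal, which is closed
    under scalars.\<close>
  have same: "I +> (c \<odot> z) = I +> (c \<odot> x)" if z: "z \<in> I +> x" for z
  proof -
    obtain h where h: "h \<in> I" "z = h \<oplus> x" using z by (auto simp: a_r_coset_def')
    then have hc: "h \<in> carrier A" by (simp add: I.a_Hcarr)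
    have "c \<odot> z = c \<odot> h \<oplus> c \<odot> x" using h hc assms by (simp add: smult_add_right)
    then have "c \<odot> z \<ominus> c \<odot> x = c \<odot> h"
      using hc assms by (simp add: a_minus_def a_assoc r_neg)
    then show ?thesis
      using coset_eq_iff[OF ideal, of "c \<odot> z" "c \<odot> x"] ideal_smult_closed[OF ideal h(1)] h hc assms by simp
  qed
  have "I +> x \<noteq> {}" using I.a_rcos_self[OF assms(1)] by blast
  have "c \<odot>\<^bsub>Quo\<^esub> (I +> x) = (\<Union>z\<in>I +> x. I +> (c \<odot> z))" by (simp add: quotient_algebra_def)
  also have "\<dots> = (\<Union>z\<in>I +> x. I +> (c \<odot> x))" by (rule SUP_cong[OF refl]) (rule same)
  also have "\<dots> = I +> (c \<odot> x)" using \<open>I +> x \<noteq> {}\<close> by (rule cSUP_const)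
  finally show "c \<odot>\<^bsub>Quo\<^esub> (I +> x) = I +> (c \<odot> x)" .
qed

lemma one_quotient: "\<one>\<^bsub>Quo\<^esub> = I +> \<one>" and zero_quotient: "\<zero>\<^bsub>Quo\<^esub> = I +> \<zero>"
proof -
  interpret I: ideal I A by (rule ideal)
  show "\<one>\<^bsub>Quo\<^esub> = I +> \<one>" by (simp add: quotient_algebra_def FactRing_def)
  have "I +> \<zero> = I"
    using I.a_Hcarr by (auto simp: a_r_coset_def')
  then show "\<zero>\<^bsub>Quo\<^esub> = I +> \<zero>"
    by (simp add: quotient_algebra_def FactRing_def)
qed

lemma complex_algebra_quotient: "complex_algebra Quo"
proof -
  interpret I: ideal I A by (rule ideal)
  interpret Q: ring "A Quot I" by (rule I.quotient_is_ring)
  have Q: "ring (A Quot I)" ..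
  interpret B: ring Quo
  proof (rule ringI)
    show "abelian_group Quo"
      by (rule abelian_groupI) (use Q.a_closed Q.a_assoc Q.a_comm Q.l_zero Q.zero_closed Q.l_neg Q.a_inv_closed
        in \<open>auto simp: quotient_algebra_def\<close>)
    show "Group.monoid Quo"
      by (rule monoidI) (use Q.m_assoc in \<open>auto simp: quotient_algebra_def\<close>)
  qed (use Q.l_distr Q.r_distr in \<open>auto simp: quotient_algebra_def\<close>)
  show ?thesis
    by unfold_locales (auto simp: carrier_quotient coset_hom smult_add_left smult_add_right smult_smult
        smult_mult_left smult_mult_right)
qed

end

text \<open>Closure under scalars supplies the missing ring data: zero is 0 times the unit, and
  negatives are multiples by -1.\<close>

lemma (in complex_algebra) complex_algebra_subalgebra:
  assumes "H \<subseteq> carrier A" "\<one> \<in> H" "\<And>x y. x \<in> H \<Longrightarrow> y \<in> H \<Longrightarrow> x \<oplus> y \<in> H"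
    "\<And>x y. x \<in> H \<Longrightarrow> y \<in> H \<Longrightarrow> x \<otimes> y \<in> H" "\<And>c x. x \<in> H \<Longrightarrow> c \<odot> x \<in> H"
  shows "complex_algebra (A\<lparr>carrier := H\<rparr>)"
proof -
  have sub: "x \<in> carrier A" if "x \<in> H" for x using assms(1) that by blast
  have "\<zero> \<in> H" using assms(5)[OF assms(2), of 0] by simp
  have inv: "\<exists>y\<in>H. y \<oplus> x = \<zero>" if "x \<in> H" for x
    using assms(5)[OF that, of "- 1"] smult_minus_one sub[OF that] that l_neg by (intro bexI[of _ "\<ominus> x"]) auto
  interpret H: ring "A\<lparr>carrier := H\<rparr>"
  proof (rule ringI)
    show "abelian_group (A\<lparr>carrier := H\<rparr>)"
      by (rule abelian_groupI) (simp_all add: sub assms \<open>\<zero> \<in> H\<close> inv a_assoc, simp add: sub a_comm)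
    show "Group.monoid (A\<lparr>carrier := H\<rparr>)"
      by (rule monoidI) (simp_all add: sub assms m_assoc)
  qed (simp_all add: sub l_distr r_distr)
  show ?thesis
    by unfold_locales (simp_all add: sub assms smult_add_left smult_add_right smult_smult smult_mult_left smult_mult_right)
qed

lemma (in complex_algebra) complex_algebra_opposite: "complex_algebra (opposite_algebra A)"
proof -
  have inv: "\<exists>y\<in>carrier A. y \<oplus> x = \<zero>" if "x \<in> carrier A" for x
    using that l_neg by (intro bexI[of _ "\<ominus> x"]) auto
  interpret O: ring "opposite_algebra A"
  proof (rule ringI)
    show "abelian_group (opposite_algebra A)"
      by (rule abelian_groupI) (simp_all add: opposite_algebra_def a_assoc inv, rule a_comm)
    show "Group.monoid (opposite_algebra A)"
      by (rule monoidI) (simp_all add: opposite_algebra_def m_assoc)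
  qed (simp_all add: opposite_algebra_def l_distr r_distr)
  show ?thesis
    by unfold_locales
      (simp_all add: opposite_algebra_def smult_add_left smult_add_right smult_smult smult_mult_left smult_mult_right)
qed

lemma monoid_algebra_minus:
  assumes "monoid M" "f \<in> carrier (monoid_algebra M)" "g \<in> carrier (monoid_algebra M)"
  shows "f \<ominus>\<^bsub>monoid_algebra M\<^esub> g = f - g"
proof -
  interpret complex_algebra "monoid_algebra M" by (rule complex_algebra_monoid_algebra) fact
  have "\<ominus>\<^bsub>monoid_algebra M\<^esub> g = - g"
    using assms by (intro minus_equality) auto
  then show ?thesis by (simp add: a_minus_def)
qed

lemma monoid_algebra_coset_eq_iff:
  assumes "monoid M" "ideal I (monoid_algebra M)" "f \<in> carrier (monoid_algebra M)" "g \<in> carrier (monoid_algebra M)"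
  shows "I +>\<^bsub>monoid_algebra M\<^esub> f = I +>\<^bsub>monoid_algebra M\<^esub> g \<longleftrightarrow> f - g \<in> I"
proof -
  interpret complex_algebra "monoid_algebra M" by (rule complex_algebra_monoid_algebra) fact
  show ?thesis using coset_eq_iff[OF assms(2-4)] monoid_algebra_minus[OF assms(1,3,4)] by simp
qed

lemma quotient_setup_monoid_algebra:
  "monoid M \<Longrightarrow> ideal I (monoid_algebra M) \<Longrightarrow> quotient_setup (monoid_algebra M) I"
  by (intro quotient_setup.intro complex_algebra_monoid_algebra quotient_setup_axioms.intro)

text \<open>The functional is obtained by extending a basis of the ideal by a representative of \<open>X\<close>.\<close>

lemma quotient_separating_functional:
  assumes M: "monoid M" and I: "ideal I (monoid_algebra M)"
    and X: "X \<in> carrier (quotient_algebra (monoid_algebra M) I)"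
    and nonzero: "X \<noteq> \<zero>\<^bsub>quotient_algebra (monoid_algebra M) I\<^esub>"
  shows "\<exists>\<phi>. linear_functional (quotient_algebra (monoid_algebra M) I)
    (carrier (quotient_algebra (monoid_algebra M) I)) \<phi> \<and> \<phi> X \<noteq> 0"
proof -
  interpret quotient_setup "monoid_algebra M" I by (rule quotient_setup_monoid_algebra) fact+
  interpret I: ideal I "monoid_algebra M" by fact
  interpret V: vector_space "pm_scale :: complex \<Rightarrow> ('a \<Rightarrow>\<^sub>0 complex) \<Rightarrow> _" by (rule pm_scale_vector_space)
  interpret P: vector_space_pair "pm_scale :: complex \<Rightarrow> ('a \<Rightarrow>\<^sub>0 complex) \<Rightarrow> _" "(*) :: complex \<Rightarrow> complex \<Rightarrow> complex"
    by unfold_locales (simp_all add: algebra_simps)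
  have sub: "V.subspace I"
    by (rule V.subspaceI) (use I.zero_closed I.a_closed ideal_smult_closed[OF I] in auto)
  obtain x where x: "x \<in> carrier (monoid_algebra M)" "X = I +>\<^bsub>monoid_algebra M\<^esub> x"
    using X unfolding carrier_quotient by blast
  have "x \<notin> I"
    using nonzero x monoid_algebra_coset_eq_iff[OF M I x(1), of 0] unfolding zero_quotient by auto
  obtain B where B: "B \<subseteq> I" "V.independent B" "I \<subseteq> V.span B"
    using V.maximal_independent_subset by blast
  then have span: "V.span B = I" using V.span_minimal[OF B(1) sub] by blast
  then have ind: "V.independent (insert x B)" using \<open>x \<notin> I\<close> B by (simp add: V.independent_insert)
  obtain \<psi> where \<psi>: "Vector_Spaces.linear pm_scale (*) \<psi>" "\<And>y. y \<in> insert x B \<Longrightarrow> \<psi> y = (if y = x then 1 else 0)"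
    using P.linear_independent_extend[OF ind, of "\<lambda>y. if y = x then 1 else 0"] by blast
  have \<psi>I: "\<psi> y = 0" if "y \<in> I" for y
  proof (rule P.linear_eq_0_on_span[OF \<psi>(1)])
    show "\<psi> z = 0" if "z \<in> B" for z using \<psi>(2)[of z] that B(1) \<open>x \<notin> I\<close> by auto
    show "y \<in> V.span B" using that span by simp
  qed
  interpret \<psi>: Vector_Spaces.linear pm_scale "(*) :: complex \<Rightarrow> complex \<Rightarrow> complex" \<psi> by (rule \<psi>(1))
  \<comment> \<open>The choice of representative has no effect because the functional on the big
    space vanishes on the ideal.\<close>
  define \<phi> where "\<phi> Y = \<psi> (SOME y. y \<in> Y)" for Y
  have \<phi>: "\<phi> (I +>\<^bsub>monoid_algebra M\<^esub> y) = \<psi> y" if y: "y \<in> carrier (monoid_algebra M)" for y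
  proof -
    have "(SOME z. z \<in> I +>\<^bsub>monoid_algebra M\<^esub> y) \<in> I +>\<^bsub>monoid_algebra M\<^esub> y"
      using I.a_rcos_self[OF y] by (rule someI)
    then obtain h where "h \<in> I" "(SOME z. z \<in> I +>\<^bsub>monoid_algebra M\<^esub> y) = h + y"
      by (auto simp: a_r_coset_def')
    then show ?thesis by (simp add: \<phi>_def \<psi>.add \<psi>I)
  qed
  have "linear_functional Quo (carrier Quo) \<phi>"
    unfolding linear_functional_def carrier_quotient
    using a_closed smult_closed by (auto simp: coset_hom \<phi> \<psi>.add \<psi>.scale simp del: monoid_algebra_simps(1))
  moreover have "\<phi> X \<noteq> 0" using \<phi>[OF x(1)] x(2) \<psi>(2)[of x] by simp
  ultimately show ?thesis by blast
qed

text \<open>The bridge to complex numbers: with this rule an identity between nested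
  \<open>finsum\<close> terms in a quotient becomes one between ordinary finite sums.\<close>

lemma quotient_functional_eqI:
  assumes M: "monoid M" and I: "ideal I (monoid_algebra M)"
    and X: "X \<in> carrier (quotient_algebra (monoid_algebra M) I)"
    and Y: "Y \<in> carrier (quotient_algebra (monoid_algebra M) I)"
    and eq: "\<And>\<phi>. linear_functional (quotient_algebra (monoid_algebra M) I)
    (carrier (quotient_algebra (monoid_algebra M) I)) \<phi> \<Longrightarrow> \<phi> X = \<phi> Y"
  shows "X = Y"
proof (rule ccontr)
  assume "X \<noteq> Y"
  interpret S: quotient_setup "monoid_algebra M" I by (rule quotient_setup_monoid_algebra) fact+
  interpret B: complex_algebra S.Quo by (rule S.complex_algebra_quotient)
  have "X \<ominus>\<^bsub>S.Quo\<^esub> Y \<noteq> \<zero>\<^bsub>S.Quo\<^esub>"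
    using X Y \<open>X \<noteq> Y\<close> B.minus_equality[of X "\<ominus>\<^bsub>S.Quo\<^esub> Y"]
    by (auto simp: a_minus_def)
  then obtain \<phi> where \<phi>: "linear_functional S.Quo (carrier S.Quo) \<phi>" "\<phi> (X \<ominus>\<^bsub>S.Quo\<^esub> Y) \<noteq> 0"
    using quotient_separating_functional[OF M I, of "X \<ominus>\<^bsub>S.Quo\<^esub> Y"] X Y by auto
  have "X \<ominus>\<^bsub>S.Quo\<^esub> Y = X \<oplus>\<^bsub>S.Quo\<^esub> (- 1) \<odot>\<^bsub>S.Quo\<^esub> Y"
    using Y by (simp add: B.smult_minus_one a_minus_def)
  then have "\<phi> (X \<ominus>\<^bsub>S.Quo\<^esub> Y) = \<phi> X - \<phi> Y"
    using \<phi>(1) X Y B.smult_closed[OF Y, of "- 1"] by (simp add: linear_functional_def)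
  then show False using \<phi> eq by simp
qed

abbreviation word_monoid :: "'g set \<Rightarrow> 'g list monoid" where
  "word_monoid G \<equiv> \<lparr>carrier = lists G, mult = (@), one = []\<rparr>"

lemma word_monoid: "monoid (word_monoid G)"
  by (rule monoidI) auto

section \<open>Quantum matrices\<close>

lemma gen_star_gen_star [simp]: "gen_star (gen_star g) = g"
  by (cases g) auto

lemma gen_star_generators [simp]: "gen_star g \<in> generators m n \<longleftrightarrow> g \<in> generators m n"
  by (cases g) (auto simp: generators_def)

definition word_star :: "gen list \<Rightarrow> gen list" where
  "word_star w = rev (map gen_star w)"

lemma word_star_word_star [simp]: "word_star (word_star w) = w"
  by (simp add: word_star_def rev_map comp_def)

lemma word_star_append: "word_star (u @ v) = word_star v @ word_star u"
  by (simp add: word_star_def)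

lemma free_star_eq:
  "free_star f = (\<Sum>w\<in>Poly_Mapping.keys f. Poly_Mapping.single (word_star w) (cnj (Poly_Mapping.lookup f w)))"
  by (simp add: free_star_def word_star_def)

lemma lookup_free_star: "Poly_Mapping.lookup (free_star f) w = cnj (Poly_Mapping.lookup f (word_star w))"
proof -
  have "word_star v = w \<longleftrightarrow> v = word_star w" for v by auto
  then show ?thesis
    by (simp add: free_star_eq lookup_sum lookup_single when_def in_keys_iff)
qed

lemma free_star_add: "free_star (f + g) = free_star f + free_star g"
  by (rule poly_mapping_eqI) (simp add: lookup_free_star lookup_add)

lemma free_star_zero [simp]: "free_star 0 = 0"
  by (rule poly_mapping_eqI) (simp add: lookup_free_star)

lemma free_star_scale: "free_star (pm_scale c f) = pm_scale (cnj c) (free_star f)"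
  by (rule poly_mapping_eqI) (simp add: lookup_free_star)

lemma free_star_free_star [simp]: "free_star (free_star f) = f"
  by (rule poly_mapping_eqI) (simp add: lookup_free_star)

lemma free_star_single [simp]: "free_star (Poly_Mapping.single w c) = Poly_Mapping.single (word_star w) (cnj c)"
  by (simp add: free_star_eq)

lemma free_star_sum: "free_star (\<Sum>i\<in>S. f i) = (\<Sum>i\<in>S. free_star (f i))"
  by (induction S rule: infinite_finite_induct) (simp_all add: free_star_add)

lemma free_star_mult:
  "free_star (mon_mult (word_monoid G) f g) = mon_mult (word_monoid G) (free_star g) (free_star f)"
proof -
  have "free_star (mon_mult (word_monoid G) f g) = (\<Sum>x\<in>Poly_Mapping.keys f. \<Sum>y\<in>Poly_Mapping.keys g.
     Poly_Mapping.single (word_star y @ word_star x) (cnj (Poly_Mapping.lookup g y) * cnj (Poly_Mapping.lookup f x)))"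
    by (simp add: mon_mult_def free_star_sum word_star_append mult.commute)
  also have "\<dots> = mon_mult (word_monoid G) (free_star g) (free_star f)"
    unfolding free_star_eq[of f] free_star_eq[of g]
    by (simp add: mon_mult_sum_left mon_mult_sum_right)
  finally show ?thesis .
qed

lemma keys_free_star: "Poly_Mapping.keys (free_star f) = word_star ` Poly_Mapping.keys f"
proof -
  have "w \<in> Poly_Mapping.keys (free_star f) \<longleftrightarrow> w \<in> word_star ` Poly_Mapping.keys f" for w
    using image_iff[of w word_star "Poly_Mapping.keys f"] word_star_word_star
    by (metis complex_cnj_zero_iff in_keys_iff lookup_free_star)
  then show ?thesis by blast
qed

context
  fixes q :: real and m n :: nat
begin

abbreviation free_alg where "free_alg \<equiv> free_algebra (generators m n)"

lemma free_alg_eq: "free_alg = monoid_algebra (word_monoid (generators m n))"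
  by (simp add: free_algebra_def)

lemma free_star_carrier: "f \<in> carrier free_alg \<Longrightarrow> free_star f \<in> carrier free_alg"
proof -
  assume "f \<in> carrier free_alg"
  then have w: "w \<in> lists (generators m n)" if "w \<in> Poly_Mapping.keys f" for w
    using that by (auto simp: free_alg_eq)
  have "set (word_star w) \<subseteq> generators m n" if "w \<in> Poly_Mapping.keys f" for w
    using w[OF that] by (auto simp: word_star_def)
  then show "free_star f \<in> carrier free_alg" by (auto simp: free_alg_eq keys_free_star lists_eq_set)
qed

lemma single_carrier: "set w \<subseteq> generators m n \<Longrightarrow> Poly_Mapping.single w c \<in> carrier free_alg"
  by (auto simp: free_alg_eq)

lemma Z_generators: "a \<in> {1..n} \<Longrightarrow> \<alpha> \<in> {1..m} \<Longrightarrow> Z a \<alpha> \<in> generators m n"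
  and Zstar_generators: "a \<in> {1..n} \<Longrightarrow> \<alpha> \<in> {1..m} \<Longrightarrow> Zstar a \<alpha> \<in> generators m n"
  by (auto simp: generators_def)

lemma mat_relations_carrier: "mat_relations q m n \<subseteq> carrier free_alg"
proof -
  have diff: "f - g \<in> carrier free_alg" if "f \<in> carrier free_alg" "g \<in> carrier free_alg" for f g
    using that keys_diff[of f g] by (auto simp: free_alg_eq)
  have sum: "(\<Sum>i\<in>S. f i) \<in> carrier free_alg" if "\<And>i. i \<in> S \<Longrightarrow> f i \<in> carrier free_alg" for S :: "nat set" and f
    using that keys_sum[of f S] by (fastforce simp: free_alg_eq)
  show ?thesis
    unfolding mat_relations_def
    by (intro Un_least subsetI; elim CollectE exE conjE; hypsubst; intro diff single_carrier sum)
      (auto simp: Z_generators Zstar_generators)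
qed

lemma relations_carrier: "mat_relations q m n \<union> free_star ` mat_relations q m n \<subseteq> carrier free_alg"
  using mat_relations_carrier free_star_carrier by blast

lemma complex_algebra_free: "complex_algebra free_alg"
  unfolding free_alg_eq by (intro complex_algebra_monoid_algebra word_monoid)

lemma pol_ideal: "ideal (pol_ideal q m n) free_alg"
proof -
  interpret complex_algebra free_alg by (rule complex_algebra_free)
  show ?thesis unfolding pol_ideal_def by (rule genideal_ideal[OF relations_carrier])
qed

lemma mat_relations_pol_ideal: "f \<in> mat_relations q m n \<Longrightarrow> f \<in> pol_ideal q m n"
proof -
  interpret complex_algebra free_alg by (rule complex_algebra_free)
  show "f \<in> mat_relations q m n \<Longrightarrow> f \<in> pol_ideal q m n"
    using genideal_self[OF relations_carrier] unfolding pol_ideal_def by blast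
qed

text \<open>The elements whose star lies in the ideal again form an ideal, the involution exchanging
  left and right multiples. It contains the generators because their set was closed under the star,
  so minimality of the generated ideal applies.\<close>

lemma free_star_pol_ideal: "free_star f \<in> pol_ideal q m n" if f: "f \<in> pol_ideal q m n"
proof -
  interpret complex_algebra free_alg by (rule complex_algebra_free)
  interpret I: ideal "pol_ideal q m n" free_alg by (rule pol_ideal)
  let ?J = "{f \<in> carrier free_alg. free_star f \<in> pol_ideal q m n}"
  have "ideal ?J free_alg"
  proof (rule idealI)
    show "ring free_alg" ..
    show "subgroup ?J (add_monoid free_alg)"
    proof (rule add.subgroupI)
      show "?J \<noteq> {}" using I.zero_closed by (auto simp: free_alg_eq intro!: exI[of _ 0])
      show "\<ominus>\<^bsub>free_alg\<^esub> x \<in> ?J" if "x \<in> ?J" for x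
      proof -
        have "\<ominus>\<^bsub>free_alg\<^esub> x = pm_scale (- 1) x" using smult_minus_one[of x] that by (simp add: free_alg_eq)
        moreover have "free_star (pm_scale (- 1) x) = pm_scale (- 1) (free_star x)" by (simp add: free_star_scale)
        ultimately show ?thesis
          using that ideal_smult_closed[OF pol_ideal, of "free_star x" "- 1"] a_inv_closed[of x] by (simp add: free_alg_eq)
      qed
      show "x \<oplus>\<^bsub>free_alg\<^esub> y \<in> ?J" if "x \<in> ?J" "y \<in> ?J" for x y
        using that I.a_closed a_closed[of x y] by (auto simp: free_alg_eq free_star_add)
    qed auto
    show "x \<otimes>\<^bsub>free_alg\<^esub> a \<in> ?J" "a \<otimes>\<^bsub>free_alg\<^esub> x \<in> ?J" if "a \<in> ?J" "x \<in> carrier free_alg" for a x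
      using that m_closed[of x a] m_closed[of a x] I.I_l_closed[of "free_star a" "free_star x"]
        I.I_r_closed[of "free_star a" "free_star x"] free_star_carrier[of x]
      by (auto simp: free_alg_eq free_star_mult)
  qed
  moreover have "mat_relations q m n \<union> free_star ` mat_relations q m n \<subseteq> ?J"
    using relations_carrier genideal_self[OF relations_carrier] unfolding pol_ideal_def by auto
  ultimately have "pol_ideal q m n \<subseteq> ?J"
    unfolding pol_ideal_def[of q m n] by (rule genideal_minimal)
  then show ?thesis using f by blast
qed

abbreviation pol_class :: "(gen list \<Rightarrow>\<^sub>0 complex) \<Rightarrow> pol" where
  "pol_class f \<equiv> pol_ideal q m n +>\<^bsub>free_alg\<^esub> f"

interpretation QP: quotient_setup free_alg "pol_ideal q m n"
  by (intro quotient_setup.intro complex_algebra_free quotient_setup_axioms.intro pol_ideal)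

lemma Pol_Mat_eq: "Pol_Mat q m n = quotient_algebra free_alg (pol_ideal q m n)"
  by (simp add: Pol_Mat_def)

lemma complex_algebra_Pol: "complex_algebra (Pol_Mat q m n)"
  unfolding Pol_Mat_eq by (rule QP.complex_algebra_quotient)

lemma carrier_Pol: "carrier (Pol_Mat q m n) = pol_class ` carrier free_alg"
  unfolding Pol_Mat_eq by (rule QP.carrier_quotient)

lemmas pol_class_hom = QP.coset_hom[folded Pol_Mat_eq]
lemmas pol_class_one = QP.one_quotient[folded Pol_Mat_eq]

lemma pol_class_eqI: "f \<in> carrier free_alg \<Longrightarrow> g \<in> carrier free_alg \<Longrightarrow> f - g \<in> pol_ideal q m n \<Longrightarrow> pol_class f = pol_class g"
  using monoid_algebra_coset_eq_iff[OF word_monoid[of "generators m n"], of "pol_ideal q m n" f g] pol_ideal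
  by (simp only: free_alg_eq)

text \<open>The involution maps the ideal onto itself and not merely into itself, so the image of a
  coset is a whole coset.\<close>

lemma pol_star_pol_class:
  assumes "f \<in> carrier free_alg"
  shows "pol_star (pol_class f) = pol_class (free_star f)"
proof -
  have add: "add free_alg = (+)" by (simp add: free_alg_eq)
  have "pol_star (pol_class f) = (\<lambda>h. free_star (h + f)) ` pol_ideal q m n"
    by (auto simp: pol_star_def a_r_coset_def' add)
  also have "\<dots> = (\<lambda>h. h + free_star f) ` (free_star ` pol_ideal q m n)"
    by (simp add: free_star_add image_image)
  also have "free_star ` pol_ideal q m n = pol_ideal q m n"
  proof -
    have "f \<in> free_star ` pol_ideal q m n" if "f \<in> pol_ideal q m n" for f
      using free_star_pol_ideal[OF that] free_star_free_star[of f] by (metis imageI)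
    then show ?thesis using free_star_pol_ideal by blast
  qed
  also have "(\<lambda>h. h + free_star f) ` pol_ideal q m n = pol_class (free_star f)"
    by (auto simp: a_r_coset_def' add)
  finally show ?thesis .
qed

lemma pol_star_closed: "x \<in> carrier (Pol_Mat q m n) \<Longrightarrow> pol_star x \<in> carrier (Pol_Mat q m n)"
  unfolding carrier_Pol using pol_star_pol_class free_star_carrier by auto

lemma pol_star_add:
  assumes "x \<in> carrier (Pol_Mat q m n)" "y \<in> carrier (Pol_Mat q m n)"
  shows "pol_star (x \<oplus>\<^bsub>Pol_Mat q m n\<^esub> y) = pol_star x \<oplus>\<^bsub>Pol_Mat q m n\<^esub> pol_star y"
proof -
  obtain f g where fg: "f \<in> carrier free_alg" "x = pol_class f" "g \<in> carrier free_alg" "y = pol_class g"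
    using assms unfolding carrier_Pol by blast
  have "free_star (f \<oplus>\<^bsub>free_alg\<^esub> g) = free_star f \<oplus>\<^bsub>free_alg\<^esub> free_star g"
    by (simp add: free_alg_eq free_star_add)
  then show ?thesis using fg by (simp add: pol_class_hom pol_star_pol_class free_star_carrier)
qed

lemma pol_star_mult:
  assumes "x \<in> carrier (Pol_Mat q m n)" "y \<in> carrier (Pol_Mat q m n)"
  shows "pol_star (x \<otimes>\<^bsub>Pol_Mat q m n\<^esub> y) = pol_star y \<otimes>\<^bsub>Pol_Mat q m n\<^esub> pol_star x"
proof -
  obtain f g where fg: "f \<in> carrier free_alg" "x = pol_class f" "g \<in> carrier free_alg" "y = pol_class g"
    using assms unfolding carrier_Pol by blast
  have "free_star (f \<otimes>\<^bsub>free_alg\<^esub> g) = free_star g \<otimes>\<^bsub>free_alg\<^esub> free_star f"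
    by (simp add: free_alg_eq free_star_mult)
  then show ?thesis using fg by (simp add: pol_class_hom pol_star_pol_class free_star_carrier)
qed

lemma pol_star_smult:
  assumes "x \<in> carrier (Pol_Mat q m n)"
  shows "pol_star (c \<odot>\<^bsub>Pol_Mat q m n\<^esub> x) = cnj c \<odot>\<^bsub>Pol_Mat q m n\<^esub> pol_star x"
proof -
  obtain f where f: "f \<in> carrier free_alg" "x = pol_class f"
    using assms unfolding carrier_Pol by blast
  have "free_star (c \<odot>\<^bsub>free_alg\<^esub> f) = cnj c \<odot>\<^bsub>free_alg\<^esub> free_star f"
    by (simp add: free_alg_eq free_star_scale)
  then show ?thesis using f by (simp add: pol_class_hom pol_star_pol_class free_star_carrier)
qed

lemma pol_star_one: "pol_star \<one>\<^bsub>Pol_Mat q m n\<^esub> = \<one>\<^bsub>Pol_Mat q m n\<^esub>"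
proof -
  have "free_star \<one>\<^bsub>free_alg\<^esub> = \<one>\<^bsub>free_alg\<^esub>" by (simp add: free_alg_eq word_star_def)
  then show ?thesis using pol_star_pol_class[of "\<one>\<^bsub>free_alg\<^esub>"] by (simp add: pol_class_one)
qed

lemma z_gen_closed: "a \<in> {1..n} \<Longrightarrow> \<alpha> \<in> {1..m} \<Longrightarrow> z_gen q m n a \<alpha> \<in> carrier (Pol_Mat q m n)"
  unfolding carrier_Pol z_gen_def by (intro imageI single_carrier) (simp add: Z_generators)

lemma z_gen_mult:
  assumes "a \<in> {1..n}" "\<alpha> \<in> {1..m}" "b \<in> {1..n}" "\<beta> \<in> {1..m}"
  shows "z_gen q m n a \<alpha> \<otimes>\<^bsub>Pol_Mat q m n\<^esub> z_gen q m n b \<beta> = pol_class (Poly_Mapping.single [Z a \<alpha>, Z b \<beta>] 1)"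
proof -
  have "Poly_Mapping.single [Z a \<alpha>] 1 \<in> carrier free_alg" "Poly_Mapping.single [Z b \<beta>] 1 \<in> carrier free_alg"
    using assms by (auto intro!: single_carrier simp: Z_generators)
  from pol_class_hom(2)[OF this] show ?thesis unfolding z_gen_def by (simp add: free_alg_eq)
qed

lemma z_gen_relations:
  assumes "a \<in> {1..n}" "\<alpha> \<in> {1..m}" "b \<in> {1..n}" "\<beta> \<in> {1..m}"
  shows "a = b \<and> \<alpha> < \<beta> \<or> a < b \<and> \<alpha> = \<beta> \<Longrightarrow>
      z_gen q m n a \<alpha> \<otimes>\<^bsub>Pol_Mat q m n\<^esub> z_gen q m n b \<beta>
      = of_real q \<odot>\<^bsub>Pol_Mat q m n\<^esub> (z_gen q m n b \<beta> \<otimes>\<^bsub>Pol_Mat q m n\<^esub> z_gen q m n a \<alpha>)"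
    and "\<alpha> < \<beta> \<Longrightarrow> a > b \<Longrightarrow>
      z_gen q m n a \<alpha> \<otimes>\<^bsub>Pol_Mat q m n\<^esub> z_gen q m n b \<beta>
      = z_gen q m n b \<beta> \<otimes>\<^bsub>Pol_Mat q m n\<^esub> z_gen q m n a \<alpha>"
    and "\<alpha> < \<beta> \<Longrightarrow> a < b \<Longrightarrow>
      z_gen q m n a \<alpha> \<otimes>\<^bsub>Pol_Mat q m n\<^esub> z_gen q m n b \<beta>
      = z_gen q m n b \<beta> \<otimes>\<^bsub>Pol_Mat q m n\<^esub> z_gen q m n a \<alpha> \<oplus>\<^bsub>Pol_Mat q m n\<^esub>
        of_real (q - inverse q) \<odot>\<^bsub>Pol_Mat q m n\<^esub> (z_gen q m n a \<beta> \<otimes>\<^bsub>Pol_Mat q m n\<^esub> z_gen q m n b \<alpha>)"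
proof -
  have s: "Poly_Mapping.single [Z a \<alpha>, Z b \<beta>] c \<in> carrier free_alg"
    if "a \<in> {1..n}" "\<alpha> \<in> {1..m}" "b \<in> {1..n}" "\<beta> \<in> {1..m}" for a b \<alpha> \<beta> c
    using that by (auto intro!: single_carrier simp: Z_generators)
  have sm: "c \<odot>\<^bsub>Pol_Mat q m n\<^esub> pol_class (Poly_Mapping.single [Z a \<alpha>, Z b \<beta>] 1) = pol_class (Poly_Mapping.single [Z a \<alpha>, Z b \<beta>] c)"
    if "a \<in> {1..n}" "\<alpha> \<in> {1..m}" "b \<in> {1..n}" "\<beta> \<in> {1..m}" for a b \<alpha> \<beta> c
    using pol_class_hom(3)[OF s[OF that, of 1] s[OF that, of 1], of c] by (simp add: free_alg_eq)
  show "z_gen q m n a \<alpha> \<otimes>\<^bsub>Pol_Mat q m n\<^esub> z_gen q m n b \<beta>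
      = of_real q \<odot>\<^bsub>Pol_Mat q m n\<^esub> (z_gen q m n b \<beta> \<otimes>\<^bsub>Pol_Mat q m n\<^esub> z_gen q m n a \<alpha>)"
    if "a = b \<and> \<alpha> < \<beta> \<or> a < b \<and> \<alpha> = \<beta>"
    unfolding z_gen_mult[OF assms] z_gen_mult[OF assms(3,4,1,2)] sm[OF assms(3,4,1,2)]
    by (rule pol_class_eqI[OF s[OF assms] s[OF assms(3,4,1,2)]], rule mat_relations_pol_ideal)
      (unfold mat_relations_def, use that assms in blast)
  show "z_gen q m n a \<alpha> \<otimes>\<^bsub>Pol_Mat q m n\<^esub> z_gen q m n b \<beta>
      = z_gen q m n b \<beta> \<otimes>\<^bsub>Pol_Mat q m n\<^esub> z_gen q m n a \<alpha>"
    if "\<alpha> < \<beta>" "a > b"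
    unfolding z_gen_mult[OF assms] z_gen_mult[OF assms(3,4,1,2)]
    by (rule pol_class_eqI[OF s[OF assms] s[OF assms(3,4,1,2)]], rule mat_relations_pol_ideal)
      (unfold mat_relations_def, use that assms in blast)
  show "z_gen q m n a \<alpha> \<otimes>\<^bsub>Pol_Mat q m n\<^esub> z_gen q m n b \<beta>
      = z_gen q m n b \<beta> \<otimes>\<^bsub>Pol_Mat q m n\<^esub> z_gen q m n a \<alpha> \<oplus>\<^bsub>Pol_Mat q m n\<^esub>
        of_real (q - inverse q) \<odot>\<^bsub>Pol_Mat q m n\<^esub> (z_gen q m n a \<beta> \<otimes>\<^bsub>Pol_Mat q m n\<^esub> z_gen q m n b \<alpha>)"
    if "\<alpha> < \<beta>" "a < b"
    unfolding z_gen_mult[OF assms] z_gen_mult[OF assms(3,4,1,2)] z_gen_mult[OF assms(1,4,3,2)] sm[OF assms(1,4,3,2)]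
      pol_class_hom(1)[OF s[OF assms(3,4,1,2)] s[OF assms(1,4,3,2)]]
  proof (rule pol_class_eqI[OF s[OF assms] QP.a_closed[OF s[OF assms(3,4,1,2)] s[OF assms(1,4,3,2)]]], rule mat_relations_pol_ideal)
    have "Poly_Mapping.single [Z a \<alpha>, Z b \<beta>] 1 - Poly_Mapping.single [Z b \<beta>, Z a \<alpha>] 1
       - Poly_Mapping.single [Z a \<beta>, Z b \<alpha>] (of_real (q - inverse q)) \<in> mat_relations q m n"
      unfolding mat_relations_def using that assms by blast
    then show "Poly_Mapping.single [Z a \<alpha>, Z b \<beta>] 1 - (Poly_Mapping.single [Z b \<beta>, Z a \<alpha>] 1
       \<oplus>\<^bsub>free_alg\<^esub> Poly_Mapping.single [Z a \<beta>, Z b \<alpha>] (of_real (q - inverse q))) \<in> mat_relations q m n"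
      by (simp add: free_alg_eq diff_diff_eq)
  qed
qed

end

text \<open>Rewrites the row part of \<open>minor_sum\<close> as a sum over row sets. The four
  nested sums are those that appear when two products of minors, one in each tensor factor, are
  expanded into monomials.\<close>

lemma (in hecke_parameter) sum_same_blocks:
  "(\<Sum>a\<in>words (l + k) m. \<Sum>a'\<in>words (l + k) m.
      (if same_blocks l k a a' then blocks_sign l k a * blocks_sign l k a' else 0) * g a a')
   = (\<Sum>L | L \<subseteq> {1..m} \<and> card L = l. \<Sum>J | J \<subseteq> {1..m} \<and> card J = k.
      \<Sum>u | u \<in> words l m \<and> u ` {..<l} = L. block_sign 0 l u * (\<Sum>v | v \<in> words k m \<and> v ` {..<k} = J. block_sign 0 k v *
      (\<Sum>u' | u' \<in> words l m \<and> u' ` {..<l} = L. block_sign 0 l u' * (\<Sum>v' | v' \<in> words k m \<and> v' ` {..<k} = J. block_sign 0 k v' *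
        g (append_word l u v) (append_word l u' v')))))"
proof -
  define h where "h L J u v = (\<Sum>u' | u' \<in> words l m \<and> u' ` {..<l} = L. block_sign 0 l u' *
     (\<Sum>v' | v' \<in> words k m \<and> v' ` {..<k} = J. block_sign 0 k v' * g (append_word l u v) (append_word l u' v')))"
    for L J u v
  have "(\<Sum>a\<in>words (l + k) m. \<Sum>a'\<in>words (l + k) m.
      (if same_blocks l k a a' then blocks_sign l k a * blocks_sign l k a' else 0) * g a a')
    = (\<Sum>u\<in>words l m. \<Sum>v\<in>words k m. \<Sum>u'\<in>words l m. \<Sum>v'\<in>words k m.
        if u' ` {..<l} = u ` {..<l} then if v' ` {..<k} = v ` {..<k} then
          block_sign 0 l u * (block_sign 0 k v * (block_sign 0 l u' * (block_sign 0 k v' *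
            g (append_word l u v) (append_word l u' v')))) else 0 else 0)"
  proof -
    have "same_blocks l k (append_word l u v) (append_word l u' v') \<longleftrightarrow>
        u' ` {..<l} = u ` {..<l} \<and> v' ` {..<k} = v ` {..<k}" for u v u' v'
      unfolding same_blocks_def image_append_word by metis
    then show ?thesis
      unfolding sum_words_append
      by (intro sum.cong[OF refl]) (simp add: blocks_sign_def block_sign_append_word)
  qed
  also have "\<dots> = (\<Sum>u\<in>words l m. \<Sum>v\<in>words k m.
       block_sign 0 l u * (block_sign 0 k v * h (u ` {..<l}) (v ` {..<k}) u v))"
  proof (rule sum.cong[OF refl], rule sum.cong[OF refl])
    fix u v
    have "h (u ` {..<l}) (v ` {..<k}) u v = (\<Sum>u'\<in>words l m. if u' ` {..<l} = u ` {..<l} then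
        (\<Sum>v'\<in>words k m. if v' ` {..<k} = v ` {..<k} then block_sign 0 l u' * (block_sign 0 k v' *
            g (append_word l u v) (append_word l u' v')) else 0) else 0)"
      unfolding h_def by (simp add: sum.If_cases Int_def sum_distrib_left)
    also have "\<dots> = (\<Sum>u'\<in>words l m. \<Sum>v'\<in>words k m. if u' ` {..<l} = u ` {..<l} then
         if v' ` {..<k} = v ` {..<k} then block_sign 0 l u' * (block_sign 0 k v' *
            g (append_word l u v) (append_word l u' v')) else 0 else 0)"
      by (rule sum.cong[OF refl]) simp
    finally have step: "h (u ` {..<l}) (v ` {..<k}) u v = (\<Sum>u'\<in>words l m. \<Sum>v'\<in>words k m.
         if u' ` {..<l} = u ` {..<l} then
         if v' ` {..<k} = v ` {..<k} then block_sign 0 l u' * (block_sign 0 k v' *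
            g (append_word l u v) (append_word l u' v')) else 0 else 0)" .
    show "(\<Sum>u'\<in>words l m. \<Sum>v'\<in>words k m.
        if u' ` {..<l} = u ` {..<l} then if v' ` {..<k} = v ` {..<k} then
          block_sign 0 l u * (block_sign 0 k v * (block_sign 0 l u' * (block_sign 0 k v' *
            g (append_word l u v) (append_word l u' v')))) else 0 else 0)
      = block_sign 0 l u * (block_sign 0 k v * h (u ` {..<l}) (v ` {..<k}) u v)"
      unfolding step sum_distrib_left by (intro sum.cong[OF refl]) simp
  qed
  also have "\<dots> = (\<Sum>u\<in>words l m. block_sign 0 l u * (\<Sum>v\<in>words k m. block_sign 0 k v * h (u ` {..<l}) (v ` {..<k}) u v))"
    by (simp add: sum_distrib_left)
  also have "\<dots> = (\<Sum>L | L \<subseteq> {1..m} \<and> card L = l. \<Sum>u | u \<in> words l m \<and> u ` {..<l} = L.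
      block_sign 0 l u * (\<Sum>J | J \<subseteq> {1..m} \<and> card J = k. \<Sum>v | v \<in> words k m \<and> v ` {..<k} = J.
        block_sign 0 k v * h (u ` {..<l}) (v ` {..<k}) u v))"
    unfolding sum_words_by_image ..
  also have "\<dots> = (\<Sum>L | L \<subseteq> {1..m} \<and> card L = l. \<Sum>u | u \<in> words l m \<and> u ` {..<l} = L.
      \<Sum>J | J \<subseteq> {1..m} \<and> card J = k. block_sign 0 l u * (\<Sum>v | v \<in> words k m \<and> v ` {..<k} = J.
        block_sign 0 k v * h L J u v))"
    unfolding sum_distrib_left by (intro sum.cong[OF refl]) auto
  also have "\<dots> = (\<Sum>L | L \<subseteq> {1..m} \<and> card L = l. \<Sum>J | J \<subseteq> {1..m} \<and> card J = k.
      \<Sum>u | u \<in> words l m \<and> u ` {..<l} = L. block_sign 0 l u * (\<Sum>v | v \<in> words k m \<and> v ` {..<k} = J.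
        block_sign 0 k v * h L J u v))"
    by (rule sum.cong[OF refl], rule sum.swap)
  finally show ?thesis unfolding h_def .
qed

context complex_algebra
begin

lemma list_prod_closed: "set xs \<subseteq> carrier A \<Longrightarrow> list_prod A xs \<in> carrier A"
  by (induction xs) (simp_all add: list_prod_def)

lemma list_prod_append:
  "set xs \<subseteq> carrier A \<Longrightarrow> set ys \<subseteq> carrier A \<Longrightarrow> list_prod A (xs @ ys) = list_prod A xs \<otimes> list_prod A ys"
proof (induction xs)
  case Nil
  then show ?case using list_prod_closed[of ys] by (simp add: list_prod_def)
next
  case (Cons x xs)
  then show ?case using list_prod_closed[of ys] list_prod_closed[of xs]
    by (simp add: list_prod_def m_assoc)
qed

lemma generated_subalgebra_closed:
  "S \<subseteq> carrier A \<Longrightarrow> x \<in> generated_subalgebra A S \<Longrightarrow> x \<in> carrier A"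
proof -
  assume S: "S \<subseteq> carrier A" and x: "x \<in> generated_subalgebra A S"
  show ?thesis using x by induction (use S in auto)
qed

lemma complex_algebra_generated_subalgebra:
  "S \<subseteq> carrier A \<Longrightarrow> complex_algebra (A\<lparr>carrier := generated_subalgebra A S\<rparr>)"
  by (rule complex_algebra_subalgebra)
    (auto intro: generated_subalgebra.intros generated_subalgebra_closed)

lemma linear_functional_mult:
  assumes "linear_functional A (carrier A) \<phi>" "x \<in> carrier A" "y \<in> carrier A"
  shows "linear_functional A (carrier A) (\<lambda>z. \<phi> (x \<otimes> (z \<otimes> y)))"
  using assms
  by (simp add: linear_functional_def l_distr r_distr smult_mult_left smult_mult_right)

end

section \<open>Tensor products of algebras\<close>

locale tensor_setup = A: complex_algebra A + B: complex_algebra B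
  for A :: "(complex, 'a) module" and B :: "(complex, 'b) module"
begin

abbreviation F where "F \<equiv> monoid_algebra (A \<times>\<times> B)"

lemma monoid_prod: "monoid (A \<times>\<times> B)"
  by (intro DirProd_monoid A.monoid_axioms B.monoid_axioms)

abbreviation tensor_relations where "tensor_relations \<equiv>
    ({Poly_Mapping.single (a \<oplus>\<^bsub>A\<^esub> a', b) 1
        - Poly_Mapping.single (a, b) 1 - Poly_Mapping.single (a', b) 1 | a a' b.
        a \<in> carrier A \<and> a' \<in> carrier A \<and> b \<in> carrier B} \<union>
     {Poly_Mapping.single (a, b \<oplus>\<^bsub>B\<^esub> b') 1
        - Poly_Mapping.single (a, b) 1 - Poly_Mapping.single (a, b') 1 | a b b'.
        a \<in> carrier A \<and> b \<in> carrier B \<and> b' \<in> carrier B} \<union>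
     {Poly_Mapping.single (c \<odot>\<^bsub>A\<^esub> a, b) 1 - Poly_Mapping.single (a, b) c | a b c.
        a \<in> carrier A \<and> b \<in> carrier B} \<union>
     {Poly_Mapping.single (a, c \<odot>\<^bsub>B\<^esub> b) 1 - Poly_Mapping.single (a, b) c | a b c.
        a \<in> carrier A \<and> b \<in> carrier B} :: ('a \<times> 'b \<Rightarrow>\<^sub>0 complex) set)"

lemma single_closed: "a \<in> carrier A \<Longrightarrow> b \<in> carrier B \<Longrightarrow> Poly_Mapping.single (a, b) c \<in> carrier F"
  by auto

lemma diff_closed: "f \<in> carrier F \<Longrightarrow> g \<in> carrier F \<Longrightarrow> f - g \<in> carrier F"
  using keys_diff[of f g] by auto

lemma tensor_relations_closed: "tensor_relations \<subseteq> carrier F"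
  by (intro Un_least subsetI; elim CollectE exE conjE; hypsubst; intro diff_closed single_closed) auto

sublocale F: complex_algebra F
  by (rule complex_algebra_monoid_algebra[OF monoid_prod])

lemma ideal_tensor: "ideal (tensor_ideal A B) F"
  unfolding tensor_ideal_def by (rule F.genideal_ideal[OF tensor_relations_closed])

lemma tensor_relationsI:
  assumes "f \<in> tensor_relations" shows "f \<in> tensor_ideal A B"
  unfolding tensor_ideal_def by (rule subsetD[OF F.genideal_self[OF tensor_relations_closed] assms])

sublocale Q: quotient_setup F "tensor_ideal A B"
  by (intro quotient_setup.intro quotient_setup_axioms.intro F.complex_algebra_axioms ideal_tensor)

abbreviation T where "T \<equiv> tensor_algebra A B"

lemma complex_algebra_tensor: "complex_algebra T"
  unfolding tensor_algebra_def by (rule Q.complex_algebra_quotient)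

lemma tensor_functional_eqI:
  assumes "X \<in> carrier T" "Y \<in> carrier T"
    and "\<And>\<phi>. linear_functional T (carrier T) \<phi> \<Longrightarrow> \<phi> X = \<phi> Y"
  shows "X = Y"
  using quotient_functional_eqI[OF monoid_prod ideal_tensor] assms unfolding tensor_algebra_def by blast

lemmas tensor_hom = Q.coset_hom[folded tensor_algebra_def]

lemma pure_tensor_closed: "a \<in> carrier A \<Longrightarrow> b \<in> carrier B \<Longrightarrow> pure_tensor A B a b \<in> carrier T"
  unfolding pure_tensor_def tensor_algebra_def Q.carrier_quotient by (intro imageI single_closed)

lemma coset_eqI: "f \<in> carrier F \<Longrightarrow> g \<in> carrier F \<Longrightarrow> f - g \<in> tensor_ideal A B \<Longrightarrow>
  tensor_ideal A B +>\<^bsub>F\<^esub> f = tensor_ideal A B +>\<^bsub>F\<^esub> g"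
  using monoid_algebra_coset_eq_iff[OF monoid_prod ideal_tensor] by blast

lemma pure_tensor_mult:
  assumes "a \<in> carrier A" "b \<in> carrier B" "a' \<in> carrier A" "b' \<in> carrier B"
  shows "pure_tensor A B a b \<otimes>\<^bsub>T\<^esub> pure_tensor A B a' b' = pure_tensor A B (a \<otimes>\<^bsub>A\<^esub> a') (b \<otimes>\<^bsub>B\<^esub> b')"
  unfolding pure_tensor_def
  using tensor_hom(2)[OF single_closed[OF assms(1,2), of 1] single_closed[OF assms(3,4), of 1]] by simp

lemma pure_tensor_one: "\<one>\<^bsub>T\<^esub> = pure_tensor A B \<one>\<^bsub>A\<^esub> \<one>\<^bsub>B\<^esub>"
  unfolding pure_tensor_def tensor_algebra_def Q.one_quotient by simp

lemma smult_single:
  assumes "a \<in> carrier A" "b \<in> carrier B"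
  shows "c \<odot>\<^bsub>T\<^esub> pure_tensor A B a b = tensor_ideal A B +>\<^bsub>F\<^esub> Poly_Mapping.single (a, b) c"
  unfolding pure_tensor_def
  using tensor_hom(3)[OF single_closed[OF assms, of 1] single_closed[OF assms, of 1], of c] by simp

lemma pure_tensor_add_left:
  assumes "a \<in> carrier A" "a' \<in> carrier A" "b \<in> carrier B"
  shows "pure_tensor A B (a \<oplus>\<^bsub>A\<^esub> a') b = pure_tensor A B a b \<oplus>\<^bsub>T\<^esub> pure_tensor A B a' b"
  unfolding pure_tensor_def tensor_hom(1)[OF single_closed[OF assms(1,3)] single_closed[OF assms(2,3)]]
proof (rule coset_eqI)
  have "Poly_Mapping.single (a \<oplus>\<^bsub>A\<^esub> a', b) 1 - Poly_Mapping.single (a, b) 1 - Poly_Mapping.single (a', b) 1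
     \<in> tensor_ideal A B"
    by (rule tensor_relationsI) (use assms in blast)
  then show "Poly_Mapping.single (a \<oplus>\<^bsub>A\<^esub> a', b) 1 - (Poly_Mapping.single (a, b) 1 \<oplus>\<^bsub>F\<^esub> Poly_Mapping.single (a', b) 1)
     \<in> tensor_ideal A B" by (simp add: diff_diff_eq)
qed (use assms in \<open>auto intro!: F.a_closed single_closed simp del: monoid_algebra_simps\<close>)

lemma pure_tensor_add_right:
  assumes "a \<in> carrier A" "b \<in> carrier B" "b' \<in> carrier B"
  shows "pure_tensor A B a (b \<oplus>\<^bsub>B\<^esub> b') = pure_tensor A B a b \<oplus>\<^bsub>T\<^esub> pure_tensor A B a b'"
  unfolding pure_tensor_def tensor_hom(1)[OF single_closed[OF assms(1,2)] single_closed[OF assms(1,3)]]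
proof (rule coset_eqI)
  have "Poly_Mapping.single (a, b \<oplus>\<^bsub>B\<^esub> b') 1 - Poly_Mapping.single (a, b) 1 - Poly_Mapping.single (a, b') 1
     \<in> tensor_ideal A B"
    by (rule tensor_relationsI) (use assms in blast)
  then show "Poly_Mapping.single (a, b \<oplus>\<^bsub>B\<^esub> b') 1 - (Poly_Mapping.single (a, b) 1 \<oplus>\<^bsub>F\<^esub> Poly_Mapping.single (a, b') 1)
     \<in> tensor_ideal A B" by (simp add: diff_diff_eq)
qed (use assms in \<open>auto intro!: F.a_closed single_closed simp del: monoid_algebra_simps\<close>)

lemma pure_tensor_smult_left:
  assumes "a \<in> carrier A" "b \<in> carrier B"
  shows "pure_tensor A B (c \<odot>\<^bsub>A\<^esub> a) b = c \<odot>\<^bsub>T\<^esub> pure_tensor A B a b"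
  unfolding smult_single[OF assms] unfolding pure_tensor_def
proof (rule coset_eqI)
  show "Poly_Mapping.single (c \<odot>\<^bsub>A\<^esub> a, b) 1 - Poly_Mapping.single (a, b) c \<in> tensor_ideal A B"
    by (rule tensor_relationsI) (use assms in blast)
qed (use assms in \<open>auto intro!: single_closed simp del: monoid_algebra_simps\<close>)

lemma pure_tensor_smult_right:
  assumes "a \<in> carrier A" "b \<in> carrier B"
  shows "pure_tensor A B a (c \<odot>\<^bsub>B\<^esub> b) = c \<odot>\<^bsub>T\<^esub> pure_tensor A B a b"
  unfolding smult_single[OF assms] unfolding pure_tensor_def
proof (rule coset_eqI)
  show "Poly_Mapping.single (a, c \<odot>\<^bsub>B\<^esub> b) 1 - Poly_Mapping.single (a, b) c \<in> tensor_ideal A B"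
    by (rule tensor_relationsI) (use assms in blast)
qed (use assms in \<open>auto intro!: single_closed simp del: monoid_algebra_simps\<close>)

end

section \<open>Quantum matrices and the exchange relation for monomials\<close>

locale quantum_matrices = hecke_parameter q for q :: real +
  fixes m n :: nat
begin

abbreviation P where "P \<equiv> Pol_Mat q m n"
abbreviation M where "M \<equiv> Mat_algebra q m n"
abbreviation Mb where "Mb \<equiv> Matbar_algebra q m n"
abbreviation E where "E \<equiv> kernel_algebra q m n"
abbreviation z where "z \<equiv> z_gen q m n"

sublocale P: complex_algebra P by (rule complex_algebra_Pol)

lemma z_set_closed: "z_set q m n \<subseteq> carrier P" "pol_star ` z_set q m n \<subseteq> carrier P"
  using z_gen_closed pol_star_closed by (auto simp: z_set_def)

sublocale M: complex_algebra M
  unfolding Mat_algebra_def by (rule P.complex_algebra_generated_subalgebra[OF z_set_closed(1)])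

sublocale Mb: complex_algebra Mb
  unfolding Matbar_algebra_def by (rule P.complex_algebra_generated_subalgebra[OF z_set_closed(2)])

lemma M_simps [simp]: "mult M = mult P" "add M = add P" "smult M = smult P" "one M = one P" "zero M = zero P"
  "mult Mb = mult P" "add Mb = add P" "smult Mb = smult P" "one Mb = one P" "zero Mb = zero P"
  by (simp_all add: Mat_algebra_def Matbar_algebra_def fun_eq_iff)

lemma carrier_M: "carrier M = generated_subalgebra P (z_set q m n)"
  and carrier_Mb: "carrier Mb = generated_subalgebra P (pol_star ` z_set q m n)"
  by (simp_all add: Mat_algebra_def Matbar_algebra_def)

lemma M_subset: "x \<in> carrier M \<Longrightarrow> x \<in> carrier P"
  and Mb_subset: "x \<in> carrier Mb \<Longrightarrow> x \<in> carrier P"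
  using P.generated_subalgebra_closed[OF z_set_closed(1)] P.generated_subalgebra_closed[OF z_set_closed(2)]
  by (auto simp: carrier_M carrier_Mb)

lemma z_closed: "a \<in> {1..n} \<Longrightarrow> \<alpha> \<in> {1..m} \<Longrightarrow> z a \<alpha> \<in> carrier M"
  unfolding carrier_M by (rule generated_subalgebra.gen) (auto simp: z_set_def)

lemma star_closed: "x \<in> carrier M \<Longrightarrow> pol_star x \<in> carrier Mb"
  unfolding carrier_M
proof (induction rule: generated_subalgebra.induct)
  case one
  show ?case using Mb.one_closed by (simp add: pol_star_one)
next
  case (gen s)
  then show ?case unfolding carrier_Mb by (intro generated_subalgebra.gen imageI)
next
  case (add x y)
  then show ?case using Mb.a_closed[of "pol_star x" "pol_star y"] M_subset
    by (simp add: pol_star_add carrier_M)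
next
  case (mult x y)
  then show ?case using Mb.m_closed[of "pol_star y" "pol_star x"] M_subset
    by (simp add: pol_star_mult carrier_M)
next
  case (smult x c)
  then show ?case using Mb.smult_closed[of "pol_star x" "cnj c"] M_subset
    by (simp add: pol_star_smult carrier_M)
qed

lemma opposite_M_simps [simp]:
  "carrier (opposite_algebra M) = carrier M" "mult (opposite_algebra M) x y = y \<otimes>\<^bsub>P\<^esub> x"
  "add (opposite_algebra M) = add P" "smult (opposite_algebra M) = smult P"
  "one (opposite_algebra M) = one P"
  by (simp_all add: opposite_algebra_def)

sublocale K: tensor_setup "opposite_algebra M" Mb
  by (intro tensor_setup.intro M.complex_algebra_opposite Mb.complex_algebra_axioms)

sublocale E: complex_algebra E
  unfolding kernel_algebra_def by (rule K.complex_algebra_tensor)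

abbreviation kt where "kt \<equiv> ktensor q m n"

lemma kt_closed: "x \<in> carrier M \<Longrightarrow> y \<in> carrier Mb \<Longrightarrow> kt x y \<in> carrier E"
  using K.pure_tensor_closed by (simp add: ktensor_def kernel_algebra_def)

lemma kt_mult:
  assumes "x \<in> carrier M" "y \<in> carrier Mb" "x' \<in> carrier M" "y' \<in> carrier Mb"
  shows "kt x y \<otimes>\<^bsub>E\<^esub> kt x' y' = kt (x' \<otimes>\<^bsub>P\<^esub> x) (y \<otimes>\<^bsub>P\<^esub> y')"
  using K.pure_tensor_mult[of x y x' y'] assms by (simp add: ktensor_def kernel_algebra_def)

lemma kt_one: "\<one>\<^bsub>E\<^esub> = kt \<one>\<^bsub>P\<^esub> \<one>\<^bsub>P\<^esub>"
  using K.pure_tensor_one by (simp add: ktensor_def kernel_algebra_def)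

lemma kt_add:
  "x \<in> carrier M \<Longrightarrow> x' \<in> carrier M \<Longrightarrow> y \<in> carrier Mb \<Longrightarrow> kt (x \<oplus>\<^bsub>P\<^esub> x') y = kt x y \<oplus>\<^bsub>E\<^esub> kt x' y"
  "x \<in> carrier M \<Longrightarrow> y \<in> carrier Mb \<Longrightarrow> y' \<in> carrier Mb \<Longrightarrow> kt x (y \<oplus>\<^bsub>P\<^esub> y') = kt x y \<oplus>\<^bsub>E\<^esub> kt x y'"
  using K.pure_tensor_add_left[of x x' y] K.pure_tensor_add_right[of x y y']
  by (simp_all add: ktensor_def kernel_algebra_def)

lemma kt_smult:
  "x \<in> carrier M \<Longrightarrow> y \<in> carrier Mb \<Longrightarrow> kt (c \<odot>\<^bsub>P\<^esub> x) y = c \<odot>\<^bsub>E\<^esub> kt x y"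
  "x \<in> carrier M \<Longrightarrow> y \<in> carrier Mb \<Longrightarrow> kt x (c \<odot>\<^bsub>P\<^esub> y) = c \<odot>\<^bsub>E\<^esub> kt x y"
  using K.pure_tensor_smult_left[of x y c] K.pure_tensor_smult_right[of x y c]
  by (simp_all add: ktensor_def kernel_algebra_def)

lemma E_eqI:
  assumes "X \<in> carrier E" "Y \<in> carrier E"
    and "\<And>\<phi>. linear_functional E (carrier E) \<phi> \<Longrightarrow> \<phi> X = \<phi> Y"
  shows "X = Y"
  using K.tensor_functional_eqI assms unfolding kernel_algebra_def by blast

text \<open>The word \<open>a\<close> carries the upper indices, bounded by \<open>m\<close>, and
  \<open>b\<close> the lower ones, bounded by \<open>n\<close>; \<open>z\<close> takes them in the
  opposite order.\<close>

definition monomial :: "nat \<Rightarrow> word \<Rightarrow> word \<Rightarrow> pol" where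
  "monomial N a b = list_prod P (map (\<lambda>i. z (b i) (a i)) [0..<N])"

lemma list_prod_M_closed: "set xs \<subseteq> carrier M \<Longrightarrow> list_prod P xs \<in> carrier M"
  using M.list_prod_closed[of xs] by (simp add: list_prod_def)

lemma monomial_closed:
  assumes "a \<in> words N m" "b \<in> words N n"
  shows "monomial N a b \<in> carrier M"
  unfolding monomial_def using assms z_closed
  by (intro list_prod_M_closed) (auto simp: words_def PiE_iff)

text \<open>This is the RTT form of the relations between the \<open>z a \<alpha>\<close>.\<close>

lemma hecke_monomial:
  assumes \<phi>: "linear_functional M (carrier M) \<phi>"
    and a: "a \<in> words N m" and b: "b \<in> words N n" and i: "Suc i < N"
  shows "hecke Q i (\<lambda>a. \<phi> (monomial N a b)) a = hecke Q i (\<lambda>b. \<phi> (monomial N a b)) b"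
proof -
  define L where "L = list_prod P (map (\<lambda>i. z (b i) (a i)) [0..<i])"
  define R where "R = list_prod P (map (\<lambda>i. z (b i) (a i)) [Suc (Suc i)..<N])"
  have range: "a j \<in> {1..m}" "b j \<in> {1..n}" if "j < N" for j
    using a b that by (auto simp: words_def PiE_iff)
  have LR: "L \<in> carrier M" "R \<in> carrier M"
    unfolding L_def R_def using i by (auto intro!: list_prod_M_closed z_closed range)
  \<comment> \<open>All letters away from \<open>i\<close> and \<open>Suc i\<close> are frozen into
    \<open>L\<close> and \<open>R\<close>, so the claim becomes a relation between values on
    products of two generators.\<close>
  define \<nu> where "\<nu> \<alpha> \<beta> c d = \<phi> (L \<otimes>\<^bsub>M\<^esub> ((z c \<alpha> \<otimes>\<^bsub>M\<^esub> z d \<beta>) \<otimes>\<^bsub>M\<^esub> R))" for \<alpha> \<beta> c d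
  have lin: "linear_functional M (carrier M) (\<lambda>x. \<phi> (L \<otimes>\<^bsub>M\<^esub> (x \<otimes>\<^bsub>M\<^esub> R)))"
    by (rule M.linear_functional_mult[OF \<phi> LR])
  have upt: "[0..<N] = [0..<i] @ i # Suc i # [Suc (Suc i)..<N]"
    using i upt_add_eq_append[of 0 i "N - i"] by (simp add: upt_conv_Cons)
  have mono: "\<phi> (monomial N a' b') = \<nu> (a' i) (a' (Suc i)) (b' i) (b' (Suc i))"
    if "\<And>j. j \<noteq> i \<Longrightarrow> j \<noteq> Suc i \<Longrightarrow> a' j = a j \<and> b' j = b j"
      and "a' i \<in> {1..m}" "a' (Suc i) \<in> {1..m}" "b' i \<in> {1..n}" "b' (Suc i) \<in> {1..n}" for a' b'
  proof -
    have L': "map (\<lambda>i. z (b' i) (a' i)) [0..<i] = map (\<lambda>i. z (b i) (a i)) [0..<i]"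
      "map (\<lambda>i. z (b' i) (a' i)) [Suc (Suc i)..<N] = map (\<lambda>i. z (b i) (a i)) [Suc (Suc i)..<N]"
      using that(1) by auto
    have zc: "z (b' i) (a' i) \<in> carrier M" "z (b' (Suc i)) (a' (Suc i)) \<in> carrier M"
      using that by (auto intro: z_closed)
    have "set (map (\<lambda>i. z (b i) (a i)) [0..<i]) \<subseteq> carrier M"
      "set (map (\<lambda>i. z (b i) (a i)) [Suc (Suc i)..<N]) \<subseteq> carrier M"
      using i by (auto intro!: z_closed range)
    then have "monomial N a' b' = L \<otimes>\<^bsub>P\<^esub> (z (b' i) (a' i) \<otimes>\<^bsub>P\<^esub> (z (b' (Suc i)) (a' (Suc i)) \<otimes>\<^bsub>P\<^esub> R))"
      unfolding monomial_def upt map_append list.map L' L_def R_def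
      using M_subset zc by (subst P.list_prod_append) (auto simp: list_prod_def)
    then show ?thesis unfolding \<nu>_def using M.m_assoc[of "z (b' i) (a' i)" "z (b' (Suc i)) (a' (Suc i))" R] zc LR by simp
  qed
  have smult: "\<phi> (L \<otimes>\<^bsub>M\<^esub> ((c \<odot>\<^bsub>P\<^esub> x) \<otimes>\<^bsub>M\<^esub> R)) = c * \<phi> (L \<otimes>\<^bsub>M\<^esub> (x \<otimes>\<^bsub>M\<^esub> R))"
    if "x \<in> carrier M" for c x
    using lin that by (simp add: linear_functional_def)
  have add: "\<phi> (L \<otimes>\<^bsub>M\<^esub> ((x \<oplus>\<^bsub>P\<^esub> y) \<otimes>\<^bsub>M\<^esub> R)) = \<phi> (L \<otimes>\<^bsub>M\<^esub> (x \<otimes>\<^bsub>M\<^esub> R)) + \<phi> (L \<otimes>\<^bsub>M\<^esub> (y \<otimes>\<^bsub>M\<^esub> R))"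
    if "x \<in> carrier M" "y \<in> carrier M" for x y
    using lin that by (simp add: linear_functional_def)
  have zz: "z c \<alpha> \<otimes>\<^bsub>P\<^esub> z d \<beta> \<in> carrier M"
    if "c \<in> {1..n}" "d \<in> {1..n}" "\<alpha> \<in> {1..m}" "\<beta> \<in> {1..m}" for c d \<alpha> \<beta>
    using M.m_closed[of "z c \<alpha>" "z d \<beta>"] z_closed that by simp
  have r1: "\<nu> \<alpha> \<beta> c d = Q * \<nu> \<beta> \<alpha> d c"
    if "c \<in> {1..n}" "d \<in> {1..n}" "\<alpha> \<in> {1..m}" "\<beta> \<in> {1..m}" "c = d \<and> \<alpha> < \<beta> \<or> c < d \<and> \<alpha> = \<beta>" for c d \<alpha> \<beta>
    unfolding \<nu>_def using z_gen_relations(1)[of c n \<alpha> m d \<beta> q] that zz smult by simp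
  have r2: "\<nu> \<alpha> \<beta> c d = \<nu> \<beta> \<alpha> d c"
    if "c \<in> {1..n}" "d \<in> {1..n}" "\<alpha> \<in> {1..m}" "\<beta> \<in> {1..m}" "\<alpha> < \<beta>" "c > d" for c d \<alpha> \<beta>
    unfolding \<nu>_def using z_gen_relations(2)[of c n \<alpha> m d \<beta> q] that by simp
  have r3: "\<nu> \<alpha> \<beta> c d = \<nu> \<beta> \<alpha> d c + (Q - inverse Q) * \<nu> \<beta> \<alpha> c d"
    if "c \<in> {1..n}" "d \<in> {1..n}" "\<alpha> \<in> {1..m}" "\<beta> \<in> {1..m}" "\<alpha> < \<beta>" "c < d" for c d \<alpha> \<beta>
    unfolding \<nu>_def using z_gen_relations(3)[of c n \<alpha> m d \<beta> q] that zz smult add P.smult_closed M.smult_closed by simp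
  define \<alpha> \<beta> c d where "\<alpha> = a i" and "\<beta> = a (Suc i)" and "c = b i" and "d = b (Suc i)"
  have rg: "\<alpha> \<in> {1..m}" "\<beta> \<in> {1..m}" "c \<in> {1..n}" "d \<in> {1..n}"
    using range i by (auto simp: \<alpha>_def \<beta>_def c_def d_def)
  have "hecke Q i (\<lambda>a. \<phi> (monomial N a b)) a = (if \<alpha> = \<beta> then Q * \<nu> \<alpha> \<beta> c d
     else \<nu> \<beta> \<alpha> c d + (if \<alpha> < \<beta> then (Q - inverse Q) * \<nu> \<alpha> \<beta> c d else 0))"
    unfolding hecke_def using mono[of a b] mono[of "swap_at i a" b] rg
    by (simp add: \<alpha>_def \<beta>_def c_def d_def)
  moreover have "hecke Q i (\<lambda>b. \<phi> (monomial N a b)) b = (if c = d then Q * \<nu> \<alpha> \<beta> c d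
     else \<nu> \<alpha> \<beta> d c + (if c < d then (Q - inverse Q) * \<nu> \<alpha> \<beta> c d else 0))"
    unfolding hecke_def using mono[of a b] mono[of a "swap_at i b"] rg
    by (simp add: \<alpha>_def \<beta>_def c_def d_def)
  moreover have "(if \<alpha> = \<beta> then Q * \<nu> \<alpha> \<beta> c d
     else \<nu> \<beta> \<alpha> c d + (if \<alpha> < \<beta> then (Q - inverse Q) * \<nu> \<alpha> \<beta> c d else 0))
    = (if c = d then Q * \<nu> \<alpha> \<beta> c d
     else \<nu> \<alpha> \<beta> d c + (if c < d then (Q - inverse Q) * \<nu> \<alpha> \<beta> c d else 0))"
  \<comment> \<open>If the upper and the lower pair are ordered alike, the correction terms agree
    and the plain commutation is enough. If they are ordered oppositely, only one side has a
    correction term, which the three-term relation supplies. One equal pair gives q-commutation,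
    combined with Q - (Q - 1/Q) = 1/Q where a correction occurs.\<close>
  proof (cases \<alpha> \<beta> rule: linorder_cases)
    case less
    show ?thesis
    proof (cases c d rule: linorder_cases)
      case c_less: less
      then show ?thesis using less r2[of d c \<alpha> \<beta>] rg by simp
    next
      case c_equal: equal
      have "\<nu> \<alpha> \<beta> c d = Q * \<nu> \<beta> \<alpha> c d" using less c_equal r1[of c d \<alpha> \<beta>] rg by simp
      then show ?thesis using less c_equal by (simp add: left_diff_distrib)
    next
      case c_greater: greater
      then show ?thesis using less r3[of d c \<alpha> \<beta>] r2[of c d \<alpha> \<beta>] rg by simp
    qed
  next
    case equal
    show ?thesis
    proof (cases c d rule: linorder_cases)
      case c_less: less
      have "\<nu> \<alpha> \<beta> c d = Q * \<nu> \<alpha> \<beta> d c" using c_less equal r1[of c d \<alpha> \<beta>] rg by simp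
      then show ?thesis using equal c_less by (simp add: left_diff_distrib)
    next
      case c_equal: equal
      then show ?thesis using equal by simp
    next
      case c_greater: greater
      then show ?thesis using equal r1[of d c \<alpha> \<beta>] rg by simp
    qed
  next
    case greater
    show ?thesis
    proof (cases c d rule: linorder_cases)
      case c_less: less
      then show ?thesis using greater r3[of c d \<beta> \<alpha>] rg by simp
    next
      case c_equal: equal
      then show ?thesis using greater r1[of c d \<beta> \<alpha>] rg by simp
    next
      case c_greater: greater
      then show ?thesis using greater r2[of c d \<beta> \<alpha>] rg by simp
    qed
  qed
  ultimately show ?thesis by simp
qed

end

section \<open>Quantum minors and commutativity of the elements chi_k\<close>

context complex_algebra
begin

lemma linear_functional_mult_left:
  "linear_functional A (carrier A) \<phi> \<Longrightarrow> x \<in> carrier A \<Longrightarrow> linear_functional A (carrier A) (\<lambda>y. \<phi> (x \<otimes> y))"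
  by (simp add: linear_functional_def r_distr smult_mult_right)

lemma linear_functional_mult_right:
  "linear_functional A (carrier A) \<phi> \<Longrightarrow> x \<in> carrier A \<Longrightarrow> linear_functional A (carrier A) (\<lambda>y. \<phi> (y \<otimes> x))"
  by (simp add: linear_functional_def l_distr smult_mult_left)

lemma finsum_finsum_closed:
  "(\<And>i j. i \<in> S \<Longrightarrow> j \<in> T \<Longrightarrow> f i j \<in> carrier A) \<Longrightarrow> (\<Oplus>i\<in>S. \<Oplus>j\<in>T. f i j) \<in> carrier A"
  by (intro finsum_closed Pi_I) auto

lemma linear_functional_finsum2:
  assumes "linear_functional A (carrier A) \<phi>" "finite S" "finite T"
    "\<And>i j. i \<in> S \<Longrightarrow> j \<in> T \<Longrightarrow> f i j \<in> carrier A"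
  shows "\<phi> (\<Oplus>i\<in>S. \<Oplus>j\<in>T. f i j) = (\<Sum>i\<in>S. \<Sum>j\<in>T. \<phi> (f i j))"
proof -
  have "\<phi> (\<Oplus>i\<in>S. \<Oplus>j\<in>T. f i j) = (\<Sum>i\<in>S. \<phi> (\<Oplus>j\<in>T. f i j))"
    by (rule linear_functional_finsum[OF assms(1,2)]) (use assms(4) in \<open>auto intro!: finsum_closed\<close>)
  also have "\<dots> = (\<Sum>i\<in>S. \<Sum>j\<in>T. \<phi> (f i j))"
    by (rule sum.cong[OF refl], rule linear_functional_finsum[OF assms(1,3)]) (use assms(4) in auto)
  finally show ?thesis .
qed

end

lemma hecke_cnj: "hecke (of_real q) i (\<lambda>w. cnj (f w)) w = cnj (hecke (of_real q) i f w)"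
  by (simp add: hecke_def)

context quantum_matrices
begin

lemma cnj_block_sign [simp]: "cnj (block_sign p k w) = block_sign p k w"
  by (simp add: block_sign_def)

lemma linear_functional_M_P: "linear_functional M V \<phi> \<longleftrightarrow> linear_functional P V \<phi>"
  by (simp add: linear_functional_def)

text \<open>The permutation acts on the upper indices only, so the column word stays sorted while
  the row word runs through all arrangements of \<open>J'\<close>.\<close>

lemma functional_q_minor:
  assumes \<phi>: "linear_functional M (carrier M) \<phi>"
    and J': "J' \<subseteq> {1..m}" "card J' = k" and J'': "J'' \<subseteq> {1..n}" "card J'' = k"
  shows "q_minor q m n k J' J'' \<in> carrier M \<and> \<phi> (q_minor q m n k J' J'') =
    (\<Sum>u | u \<in> words k m \<and> u ` {..<k} = J'. block_sign 0 k u * \<phi> (monomial k u (sorted_word J'')))"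
proof -
  have mono: "list_prod P (map (\<lambda>i. z (sorted_list_of_set J'' ! i) (sorted_list_of_set J' ! s i)) [0..<k])
      = monomial k (restrict (sorted_word J' \<circ> s) {..<k}) (sorted_word J'')" if "s permutes {..<k}" for s
  proof -
    have "s i < k" if "i < k" for i using permutes_in_image[OF \<open>s permutes _\<close>, of i] that by simp
    then show ?thesis unfolding monomial_def
      by (intro arg_cong[where f = "list_prod P"]) (auto simp: sorted_word_def J' J'')
  qed
  have closed: "monomial k u (sorted_word J'') \<in> carrier M" if "u \<in> words k m" for u
    using that J'' by (intro monomial_closed sorted_word_in_words)
  have in_words: "restrict (sorted_word J' \<circ> s) {..<k} \<in> words k m" if "s permutes {..<k}" for s
    using bij_betwE[OF sorted_word_permute[OF J']] that by blast
  let ?f = "\<lambda>s. of_real ((- q) ^ inversion_number k s) \<odot>\<^bsub>P\<^esub>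
    list_prod P (map (\<lambda>i. z (sorted_list_of_set J'' ! i) (sorted_list_of_set J' ! s i)) [0..<k])"
  have f: "?f s \<in> carrier M" if "s permutes {..<k}" for s
    using M.smult_closed[OF closed[OF in_words[OF that]]] mono[OF that] by simp
  have "q_minor q m n k J' J'' \<in> carrier M \<and> \<phi> (q_minor q m n k J' J'') = (\<Sum>s | s permutes {..<k}. \<phi> (?f s))"
    unfolding q_minor_def
  proof (rule P.linear_functional_finsum_subspace)
    show "linear_functional P (carrier M) \<phi>" using \<phi> linear_functional_M_P by blast
    show "carrier M \<subseteq> carrier P" using M_subset by blast
    show "\<zero>\<^bsub>P\<^esub> \<in> carrier M" using M.zero_closed by simp
    show "x \<oplus>\<^bsub>P\<^esub> y \<in> carrier M" if "x \<in> carrier M" "y \<in> carrier M" for x y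
      using M.a_closed[OF that] by simp
    show "finite {s. s permutes {..<k}}" by (simp add: finite_permutations)
    show "?f s \<in> carrier M" if "s \<in> {s. s permutes {..<k}}" for s using f that by blast
  qed
  moreover have "\<phi> (?f s) = (- Q) ^ inversion_number k s * \<phi> (monomial k (restrict (sorted_word J' \<circ> s) {..<k}) (sorted_word J''))"
    if "s permutes {..<k}" for s
    using \<phi> closed[OF in_words[OF that]] mono[OF that] by (simp add: linear_functional_def)
  ultimately show ?thesis
    using sum_permutations_words[OF J', of "\<lambda>u. \<phi> (monomial k u (sorted_word J''))"] by simp
qed

text \<open>The zero functional is linear, so the membership half of the preceding lemma can be read
  off.\<close>

lemma q_minor_closed:
  "J' \<subseteq> {1..m} \<Longrightarrow> card J' = k \<Longrightarrow> J'' \<subseteq> {1..n} \<Longrightarrow> card J'' = k \<Longrightarrow> q_minor q m n k J' J'' \<in> carrier M"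
  using functional_q_minor[of "\<lambda>_. 0"] by (simp add: linear_functional_def)

lemma monomial_mult:
  assumes "a \<in> words l m" "b \<in> words l n" "a' \<in> words k m" "b' \<in> words k n"
  shows "monomial l a b \<otimes>\<^bsub>P\<^esub> monomial k a' b' = monomial (l + k) (append_word l a a') (append_word l b b')"
proof -
  have split: "map f [0..<l + k] = map f [0..<l] @ map (\<lambda>i. f (l + i)) [0..<k]" for f :: "nat \<Rightarrow> pol"
    by (rule nth_equalityI) (auto simp: nth_append)
  have "map (\<lambda>i. z (append_word l b b' i) (append_word l a a' i)) [0..<l] = map (\<lambda>i. z (b i) (a i)) [0..<l]"
    by (rule map_cong[OF HOL.refl]) simp
  moreover have "set (map (\<lambda>i. z (b i) (a i)) [0..<l]) \<subseteq> carrier P" "set (map (\<lambda>i. z (b' i) (a' i)) [0..<k]) \<subseteq> carrier P"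
    using assms by (auto simp: words_def PiE_iff intro!: M_subset z_closed)
  ultimately show ?thesis
    unfolding monomial_def split by (simp only: P.list_prod_append append_word_add)
qed

text \<open>One minor is expanded at a time, the other factor being absorbed into the functional as
  left or right multiplication.\<close>

lemma functional_minor_product:
  assumes \<phi>: "linear_functional M (carrier M) \<phi>"
    and L: "L' \<subseteq> {1..m}" "card L' = l" "L'' \<subseteq> {1..n}" "card L'' = l"
    and J: "J' \<subseteq> {1..m}" "card J' = k" "J'' \<subseteq> {1..n}" "card J'' = k"
  shows "\<phi> (q_minor q m n l L' L'' \<otimes>\<^bsub>P\<^esub> q_minor q m n k J' J'') =
    (\<Sum>u | u \<in> words l m \<and> u ` {..<l} = L'. block_sign 0 l u *
      (\<Sum>v | v \<in> words k m \<and> v ` {..<k} = J'. block_sign 0 k v *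
        \<phi> (monomial (l + k) (append_word l u v) (append_word l (sorted_word L'') (sorted_word J'')))))"
proof -
  have "\<phi> (q_minor q m n l L' L'' \<otimes>\<^bsub>P\<^esub> q_minor q m n k J' J'') =
    (\<Sum>u | u \<in> words l m \<and> u ` {..<l} = L'. block_sign 0 l u *
      \<phi> (monomial l u (sorted_word L'') \<otimes>\<^bsub>P\<^esub> q_minor q m n k J' J''))"
    using functional_q_minor[OF M.linear_functional_mult_right[OF \<phi> q_minor_closed[OF J]] L] by simp
  moreover have "\<phi> (monomial l u (sorted_word L'') \<otimes>\<^bsub>P\<^esub> q_minor q m n k J' J'') =
      (\<Sum>v | v \<in> words k m \<and> v ` {..<k} = J'. block_sign 0 k v *
        \<phi> (monomial (l + k) (append_word l u v) (append_word l (sorted_word L'') (sorted_word J''))))"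
    if u: "u \<in> words l m" for u
  proof -
    have "\<phi> (monomial l u (sorted_word L'') \<otimes>\<^bsub>P\<^esub> q_minor q m n k J' J'') =
      (\<Sum>v | v \<in> words k m \<and> v ` {..<k} = J'. block_sign 0 k v *
        \<phi> (monomial l u (sorted_word L'') \<otimes>\<^bsub>P\<^esub> monomial k v (sorted_word J'')))"
      using functional_q_minor[OF M.linear_functional_mult_left[OF \<phi> monomial_closed[OF u sorted_word_in_words[OF L(3,4)]]] J]
      by simp
    then show ?thesis
      using monomial_mult[OF u sorted_word_in_words[OF L(3,4)] _ sorted_word_in_words[OF J(3,4)]] by simp
  qed
  ultimately show ?thesis by simp
qed

lemma functional_kt_left:
  assumes "linear_functional E (carrier E) \<phi>" "y \<in> carrier M"
  shows "linear_functional M (carrier M) (\<lambda>x. \<phi> (kt x (pol_star y)))"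
  using assms star_closed[OF assms(2)] kt_closed by (simp add: linear_functional_def kt_add kt_smult)

text \<open>The star is antilinear, so conjugating the value restores linearity. The block signs are
  real and unaffected by this conjugation.\<close>

lemma functional_kt_right:
  assumes "linear_functional E (carrier E) \<phi>" "x \<in> carrier M"
  shows "linear_functional M (carrier M) (\<lambda>y. cnj (\<phi> (kt x (pol_star y))))"
  using assms star_closed kt_closed M_subset
  by (simp add: linear_functional_def kt_add kt_smult pol_star_add pol_star_smult)

definition chi_component :: "nat \<Rightarrow> kern" where
  "chi_component k = (\<Oplus>\<^bsub>E\<^esub> J' \<in> {J'. J' \<subseteq> {1..m} \<and> card J' = k}. \<Oplus>\<^bsub>E\<^esub> J'' \<in> {J''. J'' \<subseteq> {1..n} \<and> card J'' = k}.
     kt (q_minor q m n k J' J'') (pol_star (q_minor q m n k J' J'')))"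

lemma chi_eq: "chi q m n k i j = (if i = k \<and> j = k then chi_component k else \<zero>\<^bsub>E\<^esub>)"
  by (simp add: chi_def chi_component_def)

lemma chi_term_closed:
  assumes "J' \<in> {J'. J' \<subseteq> {1..m} \<and> card J' = k}" "J'' \<in> {J''. J'' \<subseteq> {1..n} \<and> card J'' = k}"
  shows "kt (q_minor q m n k J' J'') (pol_star (q_minor q m n k J' J'')) \<in> carrier E"
  using assms kt_closed star_closed q_minor_closed by blast

lemma chi_component_closed: "chi_component k \<in> carrier E"
  unfolding chi_component_def by (rule E.finsum_finsum_closed) (rule chi_term_closed)

text \<open>The opposite multiplication reverses the first tensor factor and the star reverses the
  second. A term of chi_k times a term of chi_l is thus x tensor x^*, with x the minor of size
  \<open>l\<close> times the minor of size \<open>k\<close>; hence the block lengths (l,k).\<close>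

lemma functional_chi_mult:
  assumes \<phi>: "linear_functional E (carrier E) \<phi>"
  shows "\<phi> (chi_component k \<otimes>\<^bsub>E\<^esub> chi_component l) = minor_sum m n
    (\<lambda>a b a' b'. \<phi> (kt (monomial (l + k) a b) (pol_star (monomial (l + k) a' b')))) l k"
proof -
  let ?m = "q_minor q m n"
  let ?Sm = "\<lambda>k. {J'. J' \<subseteq> {1..m} \<and> card J' = k}" and ?Sn = "\<lambda>k. {J'. J' \<subseteq> {1..n} \<and> card J' = k}"
  define G where "G a b a' b' = \<phi> (kt (monomial (l + k) a b) (pol_star (monomial (l + k) a' b')))" for a b a' b'
  define s where "s L J = append_word l (sorted_word L) (sorted_word J)" for L J
  define H where "H L' J' L'' J'' = (\<Sum>u | u \<in> words l m \<and> u ` {..<l} = L'. block_sign 0 l u * (\<Sum>v | v \<in> words k m \<and> v ` {..<k} = J'. block_sign 0 k v *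
      (\<Sum>u' | u' \<in> words l m \<and> u' ` {..<l} = L'. block_sign 0 l u' * (\<Sum>v' | v' \<in> words k m \<and> v' ` {..<k} = J'. block_sign 0 k v' *
        G (append_word l u v) (s L'' J'') (append_word l u' v') (s L'' J'')))))" for L' J' L'' J''
  have fin: "finite (?Sm k)" "finite (?Sn k)" for k by simp_all
  have s: "s L J \<in> words (l + k) n" if "L \<in> ?Sn l" "J \<in> ?Sn k" for L J
    unfolding s_def using that append_word_in_words sorted_word_in_words by blast
  have summand: "\<phi> (kt (?m k J' J'') (pol_star (?m k J' J'')) \<otimes>\<^bsub>E\<^esub> kt (?m l L' L'') (pol_star (?m l L' L'')))
      = H L' J' L'' J''"
    if J: "J' \<in> ?Sm k" "J'' \<in> ?Sn k" and L: "L' \<in> ?Sm l" "L'' \<in> ?Sn l" for J' J'' L' L''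
  proof -
    have c: "?m k J' J'' \<in> carrier M" "?m l L' L'' \<in> carrier M" using J L q_minor_closed by blast+
    let ?x = "?m l L' L'' \<otimes>\<^bsub>P\<^esub> ?m k J' J''"
    have x: "?x \<in> carrier M" using M.m_closed[OF c(2,1)] by simp
    have "kt (?m k J' J'') (pol_star (?m k J' J'')) \<otimes>\<^bsub>E\<^esub> kt (?m l L' L'') (pol_star (?m l L' L'')) = kt ?x (pol_star ?x)"
      using c star_closed M_subset by (simp add: kt_mult pol_star_mult)
    then have "\<phi> (kt (?m k J' J'') (pol_star (?m k J' J'')) \<otimes>\<^bsub>E\<^esub> kt (?m l L' L'') (pol_star (?m l L' L'')))
        = \<phi> (kt ?x (pol_star ?x))" by simp
    also have "\<dots> = (\<Sum>u | u \<in> words l m \<and> u ` {..<l} = L'. block_sign 0 l u *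
      (\<Sum>v | v \<in> words k m \<and> v ` {..<k} = J'. block_sign 0 k v *
        \<phi> (kt (monomial (l + k) (append_word l u v) (s L'' J'')) (pol_star ?x))))"
      using functional_minor_product[OF functional_kt_left[OF \<phi> x], of L' l L'' J' k J''] J L by (simp add: s_def)
    also have "\<dots> = H L' J' L'' J''"
      unfolding H_def
    proof (rule sum.cong[OF refl], rule arg_cong2[where f = "(*)", OF refl], rule sum.cong[OF refl],
        rule arg_cong2[where f = "(*)", OF refl])
      fix u v assume u: "u \<in> {u \<in> words l m. u ` {..<l} = L'}" and v: "v \<in> {v \<in> words k m. v ` {..<k} = J'}"
      let ?y = "monomial (l + k) (append_word l u v) (s L'' J'')"
      have y: "?y \<in> carrier M"
        using u v s[OF L(2) J(2)] monomial_closed append_word_in_words by blast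
      \<comment> \<open>The second tensor factor is expanded through the conjugated functional;
        conjugating once more removes the conjugation, as all coefficients are real.\<close>
      have "cnj (\<phi> (kt ?y (pol_star ?x))) = (\<Sum>u | u \<in> words l m \<and> u ` {..<l} = L'. block_sign 0 l u *
      (\<Sum>v | v \<in> words k m \<and> v ` {..<k} = J'. block_sign 0 k v *
        cnj (\<phi> (kt ?y (pol_star (monomial (l + k) (append_word l u v) (s L'' J'')))))))"
        using functional_minor_product[OF functional_kt_right[OF \<phi> y], of L' l L'' J' k J''] J L by (simp add: s_def)
      then have "cnj (cnj (\<phi> (kt ?y (pol_star ?x)))) = (\<Sum>u | u \<in> words l m \<and> u ` {..<l} = L'. block_sign 0 l u *
      (\<Sum>v | v \<in> words k m \<and> v ` {..<k} = J'. block_sign 0 k v *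
        \<phi> (kt ?y (pol_star (monomial (l + k) (append_word l u v) (s L'' J''))))))"
        by simp
      then show "\<phi> (kt ?y (pol_star ?x)) = (\<Sum>u' | u' \<in> words l m \<and> u' ` {..<l} = L'. block_sign 0 l u' * (\<Sum>v' | v' \<in> words k m \<and> v' ` {..<k} = J'. block_sign 0 k v' *
        G (append_word l u v) (s L'' J'') (append_word l u' v') (s L'' J'')))"
        by (simp add: G_def)
    qed
    finally show ?thesis .
  qed
  have "\<phi> (chi_component k \<otimes>\<^bsub>E\<^esub> chi_component l) = (\<Sum>J'\<in>?Sm k. \<Sum>J''\<in>?Sn k.
      \<phi> (kt (?m k J' J'') (pol_star (?m k J' J'')) \<otimes>\<^bsub>E\<^esub> chi_component l))"
    unfolding chi_component_def[of k]
    by (rule E.linear_functional_finsum2[OF E.linear_functional_mult_right[OF \<phi> chi_component_closed] fin])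
      (rule chi_term_closed)
  also have "\<dots> = (\<Sum>J'\<in>?Sm k. \<Sum>J''\<in>?Sn k. \<Sum>L'\<in>?Sm l. \<Sum>L''\<in>?Sn l. H L' J' L'' J'')"
  proof (rule sum.cong[OF refl], rule sum.cong[OF refl])
    fix J' J'' assume J: "J' \<in> ?Sm k" "J'' \<in> ?Sn k"
    have c: "kt (?m k J' J'') (pol_star (?m k J' J'')) \<in> carrier E" by (rule chi_term_closed[OF J])
    have "\<phi> (kt (?m k J' J'') (pol_star (?m k J' J'')) \<otimes>\<^bsub>E\<^esub> chi_component l) = (\<Sum>L'\<in>?Sm l. \<Sum>L''\<in>?Sn l.
      \<phi> (kt (?m k J' J'') (pol_star (?m k J' J'')) \<otimes>\<^bsub>E\<^esub> kt (?m l L' L'') (pol_star (?m l L' L''))))"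
      unfolding chi_component_def
      by (rule E.linear_functional_finsum2[OF E.linear_functional_mult_left[OF \<phi> c] fin])
        (rule chi_term_closed)
    also have "\<dots> = (\<Sum>L'\<in>?Sm l. \<Sum>L''\<in>?Sn l. H L' J' L'' J'')"
      by (intro sum.cong[OF refl] summand J)
    finally show "\<phi> (kt (?m k J' J'') (pol_star (?m k J' J'')) \<otimes>\<^bsub>E\<^esub> chi_component l)
      = (\<Sum>L'\<in>?Sm l. \<Sum>L''\<in>?Sn l. H L' J' L'' J'')" .
  qed
  \<comment> \<open>The interchanges bring the column sets outside the row sets, with the sets of
    size \<open>l\<close> before those of size \<open>k\<close>, as \<open>minor_sum\<close> and
    \<open>sum_same_blocks\<close> expect.\<close>
  also have "\<dots> = (\<Sum>J'\<in>?Sm k. \<Sum>J''\<in>?Sn k. \<Sum>L''\<in>?Sn l. \<Sum>L'\<in>?Sm l. H L' J' L'' J'')"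
    by (rule sum.cong[OF refl], rule sum.cong[OF refl], rule sum.swap)
  also have "\<dots> = (\<Sum>J'\<in>?Sm k. \<Sum>L''\<in>?Sn l. \<Sum>J''\<in>?Sn k. \<Sum>L'\<in>?Sm l. H L' J' L'' J'')"
    by (rule sum.cong[OF refl], rule sum.swap)
  also have "\<dots> = (\<Sum>L''\<in>?Sn l. \<Sum>J'\<in>?Sm k. \<Sum>J''\<in>?Sn k. \<Sum>L'\<in>?Sm l. H L' J' L'' J'')"
    by (rule sum.swap)
  also have "\<dots> = (\<Sum>L''\<in>?Sn l. \<Sum>J''\<in>?Sn k. \<Sum>J'\<in>?Sm k. \<Sum>L'\<in>?Sm l. H L' J' L'' J'')"
    by (rule sum.cong[OF refl], rule sum.swap)
  also have "\<dots> = (\<Sum>L''\<in>?Sn l. \<Sum>J''\<in>?Sn k. \<Sum>L'\<in>?Sm l. \<Sum>J'\<in>?Sm k. H L' J' L'' J'')"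
    by (rule sum.cong[OF refl], rule sum.cong[OF refl], rule sum.swap)
  also have "\<dots> = minor_sum m n G l k"
    unfolding minor_sum_def H_def s_def sum_same_blocks ..
  finally show ?thesis unfolding G_def .
qed

lemma chi_component_commute: "chi_component k \<otimes>\<^bsub>E\<^esub> chi_component l = chi_component l \<otimes>\<^bsub>E\<^esub> chi_component k"
proof (rule E_eqI)
  fix \<phi> assume \<phi>: "linear_functional E (carrier E) \<phi>"
  let ?G = "\<lambda>a b a' b'. \<phi> (kt (monomial (l + k) a b) (pol_star (monomial (l + k) a' b')))"
  have "minor_sum m n ?G l k = minor_sum m n ?G k l"
  proof (rule minor_sum_commute)
    fix i a b a' b'
    assume i: "Suc i < l + k" and w: "a \<in> words (l + k) m" "b \<in> words (l + k) n" "a' \<in> words (l + k) m" "b' \<in> words (l + k) n"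
    show "hecke Q i (\<lambda>a. ?G a b a' b') a = hecke Q i (\<lambda>b. ?G a b a' b') b"
      by (rule hecke_monomial[OF functional_kt_left[OF \<phi> monomial_closed[OF w(3,4)]] w(1,2) i])
    \<comment> \<open>In the second factor only the conjugated values are linear in the monomial;
      the relation passes back to the values because \<open>Q\<close> is real.\<close>
    have "hecke Q i (\<lambda>a'. cnj (?G a b a' b')) a' = hecke Q i (\<lambda>b'. cnj (?G a b a' b')) b'"
      by (rule hecke_monomial[OF functional_kt_right[OF \<phi> monomial_closed[OF w(1,2)]] w(3,4) i])
    then show "hecke Q i (\<lambda>a'. ?G a b a' b') a' = hecke Q i (\<lambda>b'. ?G a b a' b') b'"
      by (simp only: hecke_cnj complex_cnj_cancel_iff)
  qed
  then show "\<phi> (chi_component k \<otimes>\<^bsub>E\<^esub> chi_component l) = \<phi> (chi_component l \<otimes>\<^bsub>E\<^esub> chi_component k)"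
    unfolding functional_chi_mult[OF \<phi>] by (simp only: add.commute[of k l])
qed (auto intro: chi_component_closed)

text \<open>Commutativity in the kernel algebra lifts to series by reversing both summation indices
  of the convolution.\<close>

lemma chi_commute:
  "chi q m n k \<otimes>\<^bsub>series_algebra q m n\<^esub> chi q m n l = chi q m n l \<otimes>\<^bsub>series_algebra q m n\<^esub> chi q m n k"
proof (intro ext)
  fix i j
  have c: "chi q m n k a b \<in> carrier E" for k a b by (simp add: chi_eq chi_component_closed)
  have comm: "chi q m n k a b \<otimes>\<^bsub>E\<^esub> chi q m n l c d = chi q m n l c d \<otimes>\<^bsub>E\<^esub> chi q m n k a b" for k l a b c d
    using chi_component_commute[of k l] chi_component_closed by (simp add: chi_eq)
  show "(chi q m n k \<otimes>\<^bsub>series_algebra q m n\<^esub> chi q m n l) i j = (chi q m n l \<otimes>\<^bsub>series_algebra q m n\<^esub> chi q m n k) i j"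
    unfolding series_algebra_def monoid.simps partial_object.simps
  proof (rule E_eqI)
    fix \<phi> assume \<phi>: "linear_functional E (carrier E) \<phi>"
    have expand: "\<phi> (\<Oplus>\<^bsub>E\<^esub>a\<in>{..i}. \<Oplus>\<^bsub>E\<^esub>b\<in>{..j}. chi q m n k a b \<otimes>\<^bsub>E\<^esub> chi q m n l (i - a) (j - b))
      = (\<Sum>a\<le>i. \<Sum>b\<le>j. \<phi> (chi q m n k a b \<otimes>\<^bsub>E\<^esub> chi q m n l (i - a) (j - b)))" for k l
      by (rule E.linear_functional_finsum2[OF \<phi>]) (auto intro: c)
    have "(\<Sum>a\<le>i. \<Sum>b\<le>j. \<phi> (chi q m n k a b \<otimes>\<^bsub>E\<^esub> chi q m n l (i - a) (j - b)))
      = (\<Sum>a\<le>i. \<Sum>b\<le>j. \<phi> (chi q m n l a b \<otimes>\<^bsub>E\<^esub> chi q m n k (i - a) (j - b)))"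
    proof (rule sum.reindex_bij_witness[of _ "\<lambda>a. i - a" "\<lambda>a. i - a"])
      fix a assume a: "a \<in> {..i}"
      show "(\<Sum>b\<le>j. \<phi> (chi q m n l (i - a) b \<otimes>\<^bsub>E\<^esub> chi q m n k (i - (i - a)) (j - b)))
         = (\<Sum>b\<le>j. \<phi> (chi q m n k a b \<otimes>\<^bsub>E\<^esub> chi q m n l (i - a) (j - b)))"
        by (rule sum.reindex_bij_witness[of _ "\<lambda>b. j - b" "\<lambda>b. j - b"]) (use a in \<open>auto simp: comm[of l _ _ k]\<close>)
    qed auto
    then show "\<phi> (\<Oplus>\<^bsub>E\<^esub>a\<in>{..i}. \<Oplus>\<^bsub>E\<^esub>b\<in>{..j}. chi q m n k a b \<otimes>\<^bsub>E\<^esub> chi q m n l (i - a) (j - b))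
      = \<phi> (\<Oplus>\<^bsub>E\<^esub>a\<in>{..i}. \<Oplus>\<^bsub>E\<^esub>b\<in>{..j}. chi q m n l a b \<otimes>\<^bsub>E\<^esub> chi q m n k (i - a) (j - b))"
      by (simp only: expand)
  qed (auto intro!: E.finsum_finsum_closed c E.m_closed)
qed

end

section \<open>Formal series and infinite products\<close>

context complex_algebra
begin

lemma linear_span_closed: "S \<subseteq> carrier A \<Longrightarrow> x \<in> linear_span A S \<Longrightarrow> x \<in> carrier A"
proof -
  assume S: "S \<subseteq> carrier A" and x: "x \<in> linear_span A S"
  show ?thesis using x by induction (use S in auto)
qed

lemma linear_span_base:
  assumes "S \<subseteq> carrier A" "s \<in> S" shows "s \<in> linear_span A S"
  using linear_span.add[OF linear_span.zero assms(2), of A 1] assms by auto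

lemma linear_span_add:
  assumes S: "S \<subseteq> carrier A" and x: "x \<in> linear_span A S" and y: "y \<in> linear_span A S"
  shows "x \<oplus> y \<in> linear_span A S"
  using y
proof induction
  case zero
  then show ?case using x linear_span_closed[OF S] by simp
next
  case (add y s c)
  have "x \<oplus> (y \<oplus> c \<odot> s) = (x \<oplus> y) \<oplus> c \<odot> s"
    using x add linear_span_closed[OF S] S by (simp add: a_assoc subset_iff)
  then show ?case using linear_span.add[OF add(3,2)] by simp
qed

lemma linear_span_smult:
  assumes S: "S \<subseteq> carrier A" and x: "x \<in> linear_span A S"
  shows "d \<odot> x \<in> linear_span A S"
  using x
proof induction
  case zero
  then show ?case by (simp add: linear_span.zero)
next
  case (add y s c)
  have "d \<odot> (y \<oplus> c \<odot> s) = d \<odot> y \<oplus> (d * c) \<odot> s"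
    using add linear_span_closed[OF S] S by (simp add: smult_add_right smult_smult subset_iff)
  then show ?case using linear_span.add[OF add(3,2)] by simp
qed

lemma linear_span_mult:
  assumes S: "S \<subseteq> carrier A" and T: "T \<subseteq> carrier A" and U: "U \<subseteq> carrier A"
    and ST: "\<And>s t. s \<in> S \<Longrightarrow> t \<in> T \<Longrightarrow> s \<otimes> t \<in> linear_span A U"
    and x: "x \<in> linear_span A S" and y: "y \<in> linear_span A T"
  shows "x \<otimes> y \<in> linear_span A U"
proof -
  have left: "x \<otimes> t \<in> linear_span A U" if t: "t \<in> T" for t
    using x
  proof induction
    case zero
    then show ?case using t T linear_span.zero[of A U] by auto
  next
    case (add x s c)
    have "(x \<oplus> c \<odot> s) \<otimes> t = x \<otimes> t \<oplus> c \<odot> (s \<otimes> t)"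
      using add t S T linear_span_closed[OF S] by (simp add: l_distr smult_mult_left subset_iff)
    then show ?case using add ST[OF add(2) t] by (simp add: linear_span_add linear_span_smult U)
  qed
  have xc: "x \<in> carrier A" using x linear_span_closed[OF S] by blast
  show ?thesis
    using y
  proof induction
    case zero
    then show ?case using xc linear_span.zero[of A U] by simp
  next
    case (add y t c)
    have "x \<otimes> (y \<oplus> c \<odot> t) = x \<otimes> y \<oplus> c \<odot> (x \<otimes> t)"
      using add xc T linear_span_closed[OF T] by (simp add: r_distr smult_mult_right subset_iff)
    then show ?case using add left[OF add(2)] by (simp add: linear_span_add linear_span_smult U)
  qed
qed

lemma linear_span_finsum:
  assumes S: "S \<subseteq> carrier A" and "finite I" "\<And>i. i \<in> I \<Longrightarrow> f i \<in> linear_span A S"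
  shows "(\<Oplus>i\<in>I. f i) \<in> linear_span A S"
proof -
  \<comment> \<open>Only the membership half of the lemma on sums is wanted, and the zero functional
    makes it available.\<close>
  have "linear_functional A (linear_span A S) (\<lambda>_. 0)" by (simp add: linear_functional_def)
  then show ?thesis
    using linear_functional_finsum_subspace[of "linear_span A S" "\<lambda>_. 0" I f] assms
      linear_span_closed[OF S] linear_span_add[OF S] linear_span.zero by blast
qed

lemma homogeneous_generators_closed:
  "S \<subseteq> carrier A \<Longrightarrow> list_prod A ` {xs. set xs \<subseteq> S \<and> length xs = k} \<subseteq> carrier A"
  using list_prod_closed by blast

lemma homogeneous_component_closed:
  "S \<subseteq> carrier A \<Longrightarrow> x \<in> homogeneous_component A S k \<Longrightarrow> x \<in> carrier A"
  unfolding homogeneous_component_def using linear_span_closed homogeneous_generators_closed by blast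

lemma list_prod_homogeneous:
  "S \<subseteq> carrier A \<Longrightarrow> set xs \<subseteq> S \<Longrightarrow> list_prod A xs \<in> homogeneous_component A S (length xs)"
  unfolding homogeneous_component_def
  by (rule linear_span_base[OF homogeneous_generators_closed]) auto

lemma homogeneous_component_mult:
  assumes S: "S \<subseteq> carrier A" and "x \<in> homogeneous_component A S i" "y \<in> homogeneous_component A S j"
  shows "x \<otimes> y \<in> homogeneous_component A S (i + j)"
  unfolding homogeneous_component_def
proof (rule linear_span_mult)
  show "x \<in> linear_span A (list_prod A ` {xs. set xs \<subseteq> S \<and> length xs = i})"
    "y \<in> linear_span A (list_prod A ` {xs. set xs \<subseteq> S \<and> length xs = j})"
    using assms by (simp_all add: homogeneous_component_def)
  fix s t assume "s \<in> list_prod A ` {xs. set xs \<subseteq> S \<and> length xs = i}"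
    "t \<in> list_prod A ` {xs. set xs \<subseteq> S \<and> length xs = j}"
  then obtain xs ys where "s = list_prod A xs" "set xs \<subseteq> S" "length xs = i"
    "t = list_prod A ys" "set ys \<subseteq> S" "length ys = j" by blast
  moreover have "list_prod A (xs @ ys) = list_prod A xs \<otimes> list_prod A ys"
    using calculation S by (intro list_prod_append) auto
  ultimately show "s \<otimes> t \<in> linear_span A (list_prod A ` {xs. set xs \<subseteq> S \<and> length xs = i + j})"
    using list_prod_homogeneous[OF S, of "xs @ ys"] by (simp add: homogeneous_component_def)
qed (use S homogeneous_generators_closed in auto)

end

text \<open>Both sides run over the triples of naturals with sum \<open>i\<close>, grouped by the
  sum of the first two entries or by the first entry.\<close>

lemma sum_assoc_reindex:
  fixes f :: "nat \<Rightarrow> nat \<Rightarrow> nat \<Rightarrow> 'a :: comm_monoid_add"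
  shows "(\<Sum>a\<le>i. \<Sum>c\<le>a. f c (a - c) (i - a)) = (\<Sum>c\<le>i. \<Sum>e\<le>i - c. f c e (i - c - e))"
proof -
  have "(\<Sum>a\<le>i. \<Sum>c\<le>a. f c (a - c) (i - a)) = (\<Sum>(a, c)\<in>(SIGMA a:{..i}. {..a}). f c (a - c) (i - a))"
    by (rule sum.Sigma) auto
  also have "\<dots> = (\<Sum>(c, e)\<in>(SIGMA c:{..i}. {..i - c}). f c e (i - c - e))"
    by (rule sum.reindex_bij_witness[of _ "\<lambda>(c, e). (c + e, c)" "\<lambda>(a, c). (c, a - c)"]) auto
  also have "\<dots> = (\<Sum>c\<le>i. \<Sum>e\<le>i - c. f c e (i - c - e))"
    by (rule sum.Sigma[symmetric]) auto
  finally show ?thesis .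
qed

section \<open>Bidegrees and the monoid of formal series\<close>

context quantum_matrices
begin

abbreviation C where "C \<equiv> kernel_component q m n"
abbreviation S where "S \<equiv> series_algebra q m n"

abbreviation pure_set where
  "pure_set i j \<equiv> {kt a b | a b. a \<in> Mat_component q m n i \<and> b \<in> Matbar_component q m n j}"

lemma z_set_M: "z_set q m n \<subseteq> carrier M" "pol_star ` z_set q m n \<subseteq> carrier Mb"
  unfolding carrier_M carrier_Mb by (auto intro: generated_subalgebra.gen)

text \<open>Spans and list products depend only on operations that \<open>P\<close>,
  \<open>M\<close> and \<open>Mb\<close> share, not on the carrier.\<close>

lemma component_M: "Mat_component q m n i = homogeneous_component M (z_set q m n) i"
  and component_Mb: "Matbar_component q m n i = homogeneous_component Mb (pol_star ` z_set q m n) i"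
proof -
  have "linear_span P X = linear_span M X" "linear_span P X = linear_span Mb X" for X
  proof -
    have "x \<in> linear_span P X \<Longrightarrow> x \<in> linear_span M X" "x \<in> linear_span P X \<Longrightarrow> x \<in> linear_span Mb X" for x
      by (induction rule: linear_span.induct) (use linear_span.intros[where A = M and S = X] linear_span.intros[where A = Mb and S = X] in auto)
    moreover have "x \<in> linear_span M X \<Longrightarrow> x \<in> linear_span P X" for x
      by (induction rule: linear_span.induct) (use linear_span.intros[where A = P and S = X] in auto)
    moreover have "x \<in> linear_span Mb X \<Longrightarrow> x \<in> linear_span P X" for x
      by (induction rule: linear_span.induct) (use linear_span.intros[where A = P and S = X] in auto)
    ultimately show "linear_span P X = linear_span M X" "linear_span P X = linear_span Mb X" by blast+
  qed
  moreover have "list_prod P = list_prod M" "list_prod P = list_prod Mb" by (auto simp: list_prod_def)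
  ultimately show "Mat_component q m n i = homogeneous_component M (z_set q m n) i"
    "Matbar_component q m n i = homogeneous_component Mb (pol_star ` z_set q m n) i"
    by (simp_all add: Mat_component_def Matbar_component_def homogeneous_component_def)
qed

lemma Mat_component_closed: "x \<in> Mat_component q m n i \<Longrightarrow> x \<in> carrier M"
  and Matbar_component_closed: "y \<in> Matbar_component q m n i \<Longrightarrow> y \<in> carrier Mb"
  unfolding component_M component_Mb
  using M.homogeneous_component_closed[OF z_set_M(1)] Mb.homogeneous_component_closed[OF z_set_M(2)] by blast+

lemma pure_set_closed: "pure_set i j \<subseteq> carrier E"
  using kt_closed Mat_component_closed Matbar_component_closed by blast

lemma C_eq: "C i j = linear_span E (pure_set i j)"
  by (simp add: kernel_component_def)

lemma C_closed: "x \<in> C i j \<Longrightarrow> x \<in> carrier E"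
  unfolding C_eq by (rule E.linear_span_closed[OF pure_set_closed])

lemma C_zero [simp]: "\<zero>\<^bsub>E\<^esub> \<in> C i j"
  unfolding C_eq by (rule linear_span.zero)

lemma C_add: "x \<in> C i j \<Longrightarrow> y \<in> C i j \<Longrightarrow> x \<oplus>\<^bsub>E\<^esub> y \<in> C i j"
  unfolding C_eq by (rule E.linear_span_add[OF pure_set_closed])

lemma C_smult: "x \<in> C i j \<Longrightarrow> c \<odot>\<^bsub>E\<^esub> x \<in> C i j"
  unfolding C_eq by (rule E.linear_span_smult[OF pure_set_closed])

lemma C_finsum: "finite I \<Longrightarrow> (\<And>a. a \<in> I \<Longrightarrow> f a \<in> C i j) \<Longrightarrow> (\<Oplus>\<^bsub>E\<^esub>a\<in>I. f a) \<in> C i j"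
  unfolding C_eq by (rule E.linear_span_finsum[OF pure_set_closed])

lemma C_kt: "a \<in> Mat_component q m n i \<Longrightarrow> b \<in> Matbar_component q m n j \<Longrightarrow> kt a b \<in> C i j"
  unfolding C_eq by (rule E.linear_span_base[OF pure_set_closed]) blast

lemma C_mult:
  assumes "x \<in> C i j" "y \<in> C i' j'"
  shows "x \<otimes>\<^bsub>E\<^esub> y \<in> C (i + i') (j + j')"
  unfolding C_eq
proof (rule E.linear_span_mult[OF pure_set_closed pure_set_closed pure_set_closed])
  show "x \<in> linear_span E (pure_set i j)" "y \<in> linear_span E (pure_set i' j')"
    using assms by (simp_all only: C_eq)
  fix s t assume "s \<in> pure_set i j" "t \<in> pure_set i' j'"
  then obtain a b a' b' where s: "s = kt a b" "a \<in> Mat_component q m n i" "b \<in> Matbar_component q m n j"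
    and t: "t = kt a' b'" "a' \<in> Mat_component q m n i'" "b' \<in> Matbar_component q m n j'" by blast
  have "s \<otimes>\<^bsub>E\<^esub> t = kt (a' \<otimes>\<^bsub>M\<^esub> a) (b \<otimes>\<^bsub>Mb\<^esub> b')"
    using s t Mat_component_closed Matbar_component_closed by (simp add: kt_mult)
  moreover have "a' \<otimes>\<^bsub>M\<^esub> a \<in> Mat_component q m n (i + i')"
    using M.homogeneous_component_mult[OF z_set_M(1)] s t by (simp only: component_M add.commute[of i])
  moreover have "b \<otimes>\<^bsub>Mb\<^esub> b' \<in> Matbar_component q m n (j + j')"
    using Mb.homogeneous_component_mult[OF z_set_M(2)] s t by (simp only: component_Mb)
  ultimately show "s \<otimes>\<^bsub>E\<^esub> t \<in> linear_span E (pure_set (i + i') (j + j'))"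
    using C_kt unfolding C_eq by simp
qed

lemma C_one [simp]: "\<one>\<^bsub>E\<^esub> \<in> C 0 0"
proof -
  have "\<one>\<^bsub>P\<^esub> \<in> Mat_component q m n 0" "\<one>\<^bsub>P\<^esub> \<in> Matbar_component q m n 0"
    using M.list_prod_homogeneous[OF z_set_M(1), of "[]"] Mb.list_prod_homogeneous[OF z_set_M(2), of "[]"]
    by (simp_all add: component_M component_Mb list_prod_def)
  then show ?thesis by (simp add: kt_one C_kt)
qed

lemma pol_star_list_prod:
  "set xs \<subseteq> carrier M \<Longrightarrow> pol_star (list_prod P xs) = list_prod P (rev (map pol_star xs))"
proof (induction xs)
  case Nil
  then show ?case by (simp add: list_prod_def pol_star_one)
next
  case (Cons x xs)
  have c: "x \<in> carrier P" "set xs \<subseteq> carrier P" "set (rev (map pol_star xs)) \<subseteq> carrier P" "pol_star x \<in> carrier P"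
    using Cons.prems M_subset star_closed Mb_subset by auto
  have "pol_star (list_prod P (x # xs)) = pol_star (list_prod P xs) \<otimes>\<^bsub>P\<^esub> pol_star x"
    using pol_star_mult[OF c(1) P.list_prod_closed[OF c(2)]] by (simp add: list_prod_def)
  also have "pol_star x = list_prod P [pol_star x]" using c by (simp add: list_prod_def)
  finally show ?case
    using Cons P.list_prod_append[OF c(3), of "[pol_star x]"] c by simp
qed

lemma pol_star_component: "x \<in> Mat_component q m n k \<Longrightarrow> pol_star x \<in> Matbar_component q m n k"
proof -
  let ?X = "list_prod P ` {xs. set xs \<subseteq> z_set q m n \<and> length xs = k}"
  let ?Y = "list_prod P ` {xs. set xs \<subseteq> pol_star ` z_set q m n \<and> length xs = k}"
  have X: "?X \<subseteq> carrier P" and Y: "?Y \<subseteq> carrier P"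
    using P.homogeneous_generators_closed z_set_closed by blast+
  assume "x \<in> Mat_component q m n k"
  then have "x \<in> linear_span P ?X" by (simp add: Mat_component_def homogeneous_component_def)
  then have "pol_star x \<in> linear_span P ?Y"
  proof induction
    case zero
    have "pol_star \<zero>\<^bsub>P\<^esub> = \<zero>\<^bsub>P\<^esub>"
      using pol_star_smult[of "\<one>\<^bsub>P\<^esub>" q m n 0] by (simp add: pol_star_one)
    then show ?case by (simp add: linear_span.zero)
  next
    case (add x s c)
    then obtain xs where xs: "s = list_prod P xs" "set xs \<subseteq> z_set q m n" "length xs = k" by blast
    have c: "x \<in> carrier P" "s \<in> carrier P" using add P.linear_span_closed[OF X] X by blast+
    have "pol_star s = list_prod P (rev (map pol_star xs))"
      using xs z_set_M by (simp add: pol_star_list_prod subset_iff)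
    then have "pol_star s \<in> ?Y" using xs by (auto intro!: imageI)
    moreover have "pol_star (x \<oplus>\<^bsub>P\<^esub> c \<odot>\<^bsub>P\<^esub> s) = pol_star x \<oplus>\<^bsub>P\<^esub> cnj c \<odot>\<^bsub>P\<^esub> pol_star s"
      using c by (simp add: pol_star_add pol_star_smult)
    ultimately show ?case using linear_span.add[OF add(3)] by simp
  qed
  then show ?thesis by (simp add: Matbar_component_def homogeneous_component_def)
qed

lemma q_minor_component:
  assumes "J' \<subseteq> {1..m}" "card J' = k" "J'' \<subseteq> {1..n}" "card J'' = k"
  shows "q_minor q m n k J' J'' \<in> Mat_component q m n k"
  unfolding q_minor_def Mat_component_def homogeneous_component_def
proof (rule P.linear_span_finsum, rule P.homogeneous_generators_closed[OF z_set_closed(1)])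
  fix s assume s: "s \<in> {s. s permutes {..<k}}"
  have idx: "sorted_list_of_set J'' ! i \<in> J''" "sorted_list_of_set J' ! s i \<in> J'" if "i < k" for i
    using that assms s permutes_in_image[of s "{..<k}" i] finite_subset[OF assms(1)] finite_subset[OF assms(3)]
      nth_mem[of i "sorted_list_of_set J''"] nth_mem[of "s i" "sorted_list_of_set J'"] by auto
  have "set (map (\<lambda>i. z (sorted_list_of_set J'' ! i) (sorted_list_of_set J' ! s i)) [0..<k]) \<subseteq> z_set q m n"
  proof
    fix x assume "x \<in> set (map (\<lambda>i. z (sorted_list_of_set J'' ! i) (sorted_list_of_set J' ! s i)) [0..<k])"
    then obtain i where "i < k" "x = z (sorted_list_of_set J'' ! i) (sorted_list_of_set J' ! s i)"
      by auto
    then show "x \<in> z_set q m n"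
      unfolding z_set_def using idx[of i] assms(1,3) by blast
  qed
  then show "of_real ((- q) ^ inversion_number k s) \<odot>\<^bsub>P\<^esub>
      list_prod P (map (\<lambda>i. z (sorted_list_of_set J'' ! i) (sorted_list_of_set J' ! s i)) [0..<k])
    \<in> linear_span P (list_prod P ` {xs. set xs \<subseteq> z_set q m n \<and> length xs = k})"
    by (intro P.linear_span_smult P.linear_span_base P.homogeneous_generators_closed[OF z_set_closed(1)])
      (auto intro!: imageI)
qed (simp add: finite_permutations)

lemma chi_component_C: "chi_component k \<in> C k k"
  unfolding chi_component_def
  by (intro C_finsum C_kt pol_star_component q_minor_component) auto

lemma S_simps [simp]: "carrier S = {K. \<forall>i j. K i j \<in> C i j}"
  "one S = (\<lambda>i j. if i = 0 \<and> j = 0 then \<one>\<^bsub>E\<^esub> else \<zero>\<^bsub>E\<^esub>)"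
  "zero S = (\<lambda>i j. \<zero>\<^bsub>E\<^esub>)"
  "add S = (\<lambda>K L i j. K i j \<oplus>\<^bsub>E\<^esub> L i j)"
  "smult S = (\<lambda>c K i j. c \<odot>\<^bsub>E\<^esub> K i j)"
  by (simp_all add: series_algebra_def)

lemma S_component: "K \<in> carrier S \<Longrightarrow> K i j \<in> C i j"
  by simp

lemma S_closed: "K \<in> carrier S \<Longrightarrow> K i j \<in> carrier E"
  by (rule C_closed[OF S_component])

lemma S_mult: "(K \<otimes>\<^bsub>S\<^esub> L) i j = (\<Oplus>\<^bsub>E\<^esub>a\<in>{..i}. \<Oplus>\<^bsub>E\<^esub>b\<in>{..j}. K a b \<otimes>\<^bsub>E\<^esub> L (i - a) (j - b))"
  by (simp add: series_algebra_def)

lemma S_mult_closed: "K \<in> carrier S \<Longrightarrow> L \<in> carrier S \<Longrightarrow> K \<otimes>\<^bsub>S\<^esub> L \<in> carrier S"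
proof -
  assume "K \<in> carrier S" "L \<in> carrier S"
  then have "K a b \<otimes>\<^bsub>E\<^esub> L (i - a) (j - b) \<in> C i j" if "a \<le> i" "b \<le> j" for a b i j
    using that C_mult[of "K a b" a b "L (i - a) (j - b)" "i - a" "j - b"] by simp
  then have "(K \<otimes>\<^bsub>S\<^esub> L) i j \<in> C i j" for i j
    unfolding S_mult by (intro C_finsum) auto
  then show ?thesis by simp
qed

lemma functional_S_mult:
  assumes "linear_functional E (carrier E) \<phi>" "K \<in> carrier S" "L \<in> carrier S"
  shows "\<phi> ((K \<otimes>\<^bsub>S\<^esub> L) i j) = (\<Sum>a\<le>i. \<Sum>b\<le>j. \<phi> (K a b \<otimes>\<^bsub>E\<^esub> L (i - a) (j - b)))"
  unfolding S_mult
  by (rule E.linear_functional_finsum2[OF assms(1)]) (auto intro: E.m_closed S_closed[OF assms(2)] S_closed[OF assms(3)])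

lemma S_eqI:
  assumes "K \<in> carrier S" "L \<in> carrier S"
    and "\<And>\<phi> i j. linear_functional E (carrier E) \<phi> \<Longrightarrow> \<phi> (K i j) = \<phi> (L i j)"
  shows "K = L"
proof (intro ext)
  fix i j show "K i j = L i j" by (rule E_eqI) (use assms S_closed in blast)+
qed

text \<open>For associativity, \<open>F\<close> records a functional on triple products, with the
  degrees of the first and of the second grading listed separately. Both bracketings then sum
  \<open>F\<close> over the same triples in each grading.\<close>

sublocale S: monoid S
proof (rule monoidI)
  fix K L N assume KLN: "K \<in> carrier S" "L \<in> carrier S" "N \<in> carrier S"
  show "K \<otimes>\<^bsub>S\<^esub> L \<otimes>\<^bsub>S\<^esub> N = K \<otimes>\<^bsub>S\<^esub> (L \<otimes>\<^bsub>S\<^esub> N)"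
  proof (rule S_eqI)
    fix \<phi> i j assume \<phi>: "linear_functional E (carrier E) \<phi>"
    have c: "K a b \<in> carrier E" "L a b \<in> carrier E" "N a b \<in> carrier E" for a b
      using KLN S_closed by blast+
    define F where "F a c e b d f = \<phi> (K a b \<otimes>\<^bsub>E\<^esub> (L c d \<otimes>\<^bsub>E\<^esub> N e f))" for a c e b d f
    have "\<phi> ((K \<otimes>\<^bsub>S\<^esub> L \<otimes>\<^bsub>S\<^esub> N) i j) = (\<Sum>a\<le>i. \<Sum>b\<le>j. \<phi> ((K \<otimes>\<^bsub>S\<^esub> L) a b \<otimes>\<^bsub>E\<^esub> N (i - a) (j - b)))"
      by (rule functional_S_mult[OF \<phi> S_mult_closed[OF KLN(1,2)] KLN(3)])
    also have "\<dots> = (\<Sum>a\<le>i. \<Sum>b\<le>j. \<Sum>c\<le>a. \<Sum>d\<le>b. F c (a - c) (i - a) d (b - d) (j - b))"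
    proof (rule sum.cong[OF HOL.refl], rule sum.cong[OF HOL.refl])
      fix a b
      show "\<phi> ((K \<otimes>\<^bsub>S\<^esub> L) a b \<otimes>\<^bsub>E\<^esub> N (i - a) (j - b)) = (\<Sum>c\<le>a. \<Sum>d\<le>b. F c (a - c) (i - a) d (b - d) (j - b))"
        using functional_S_mult[OF E.linear_functional_mult_right[OF \<phi> c(3)[of "i - a" "j - b"]] KLN(1,2), of a b]
        by (simp add: F_def E.m_assoc c)
    qed
    also have "\<dots> = (\<Sum>a\<le>i. \<Sum>c\<le>a. \<Sum>b\<le>j. \<Sum>d\<le>b. F c (a - c) (i - a) d (b - d) (j - b))"
      by (rule sum.cong[OF HOL.refl], rule sum.swap)
    also have "\<dots> = (\<Sum>a\<le>i. \<Sum>c\<le>i - a. \<Sum>b\<le>j. \<Sum>d\<le>j - b. F a c (i - a - c) b d (j - b - d))"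
      using sum_assoc_reindex[of "\<lambda>x y w. \<Sum>b\<le>j. \<Sum>d\<le>b. F x y w d (b - d) (j - b)" i]
        sum_assoc_reindex[of "F x y w" j for x y w] by simp
    also have "\<dots> = (\<Sum>a\<le>i. \<Sum>b\<le>j. \<Sum>c\<le>i - a. \<Sum>d\<le>j - b. F a c (i - a - c) b d (j - b - d))"
      by (rule sum.cong[OF HOL.refl], rule sum.swap)
    also have "\<dots> = (\<Sum>a\<le>i. \<Sum>b\<le>j. \<phi> (K a b \<otimes>\<^bsub>E\<^esub> (L \<otimes>\<^bsub>S\<^esub> N) (i - a) (j - b)))"
    proof (rule sum.cong[OF HOL.refl], rule sum.cong[OF HOL.refl])
      fix a b
      show "(\<Sum>c\<le>i - a. \<Sum>d\<le>j - b. F a c (i - a - c) b d (j - b - d)) = \<phi> (K a b \<otimes>\<^bsub>E\<^esub> (L \<otimes>\<^bsub>S\<^esub> N) (i - a) (j - b))"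
        using functional_S_mult[OF E.linear_functional_mult_left[OF \<phi> c(1)[of a b]] KLN(2,3), of "i - a" "j - b"]
        by (simp add: F_def)
    qed
    also have "\<dots> = \<phi> ((K \<otimes>\<^bsub>S\<^esub> (L \<otimes>\<^bsub>S\<^esub> N)) i j)"
      by (rule functional_S_mult[OF \<phi> KLN(1) S_mult_closed[OF KLN(2,3)], symmetric])
    finally show "\<phi> ((K \<otimes>\<^bsub>S\<^esub> L \<otimes>\<^bsub>S\<^esub> N) i j) = \<phi> ((K \<otimes>\<^bsub>S\<^esub> (L \<otimes>\<^bsub>S\<^esub> N)) i j)" .
  qed (intro S_mult_closed KLN)+
next
  have one: "\<one>\<^bsub>S\<^esub> \<in> carrier S" by simp
  then show "\<one>\<^bsub>S\<^esub> \<in> carrier S" .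
  fix K assume K: "K \<in> carrier S"
  then have c: "K i j \<in> carrier E" for i j by (rule S_closed)
  have zero: "\<phi> \<zero>\<^bsub>E\<^esub> = 0" if "linear_functional E (carrier E) \<phi>" for \<phi>
    using E.linear_functional_finsum[OF that, of "{}" "\<lambda>_. \<zero>\<^bsub>E\<^esub>"] by simp
  show "\<one>\<^bsub>S\<^esub> \<otimes>\<^bsub>S\<^esub> K = K"
  proof (rule S_eqI[OF S_mult_closed[OF one K] K])
    fix \<phi> i j assume \<phi>: "linear_functional E (carrier E) \<phi>"
    have inner: "(\<Sum>b\<le>j. \<phi> (\<one>\<^bsub>S\<^esub> a b \<otimes>\<^bsub>E\<^esub> K (i - a) (j - b))) = (if a = 0 then \<phi> (K i j) else 0)" for a
    proof -
      have "\<phi> (\<one>\<^bsub>S\<^esub> a b \<otimes>\<^bsub>E\<^esub> K (i - a) (j - b)) = (if b = 0 then if a = 0 then \<phi> (K i j) else 0 else 0)" for b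
        by (simp add: c zero[OF \<phi>])
      then show ?thesis by simp
    qed
    have "\<phi> ((\<one>\<^bsub>S\<^esub> \<otimes>\<^bsub>S\<^esub> K) i j) = (\<Sum>a\<le>i. if a = 0 then \<phi> (K i j) else 0)"
      unfolding functional_S_mult[OF \<phi> one K] inner ..
    also have "\<dots> = \<phi> (K i j)" by simp
    finally show "\<phi> ((\<one>\<^bsub>S\<^esub> \<otimes>\<^bsub>S\<^esub> K) i j) = \<phi> (K i j)" .
  qed
  show "K \<otimes>\<^bsub>S\<^esub> \<one>\<^bsub>S\<^esub> = K"
  proof (rule S_eqI[OF S_mult_closed[OF K one] K])
    fix \<phi> i j assume \<phi>: "linear_functional E (carrier E) \<phi>"
    have inner: "(\<Sum>b\<le>j. \<phi> (K a b \<otimes>\<^bsub>E\<^esub> \<one>\<^bsub>S\<^esub> (i - a) (j - b))) = (if a = i then \<phi> (K i j) else 0)"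
      if "a \<in> {..i}" for a
    proof -
      have "\<phi> (K a b \<otimes>\<^bsub>E\<^esub> \<one>\<^bsub>S\<^esub> (i - a) (j - b)) = (if b = j then if a = i then \<phi> (K i j) else 0 else 0)"
        if "b \<in> {..j}" for b
      proof -
        have "i - a = 0 \<longleftrightarrow> a = i" "j - b = 0 \<longleftrightarrow> b = j" using that \<open>a \<in> {..i}\<close> by auto
        then show ?thesis by (simp add: c zero[OF \<phi>])
      qed
      then have "(\<Sum>b\<le>j. \<phi> (K a b \<otimes>\<^bsub>E\<^esub> \<one>\<^bsub>S\<^esub> (i - a) (j - b)))
          = (\<Sum>b\<le>j. if b = j then if a = i then \<phi> (K i j) else 0 else 0)"
        by (rule sum.cong[OF HOL.refl])
      then show ?thesis by simp
    qed
    have "\<phi> ((K \<otimes>\<^bsub>S\<^esub> \<one>\<^bsub>S\<^esub>) i j) = (\<Sum>a\<le>i. if a = i then \<phi> (K i j) else 0)"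
      unfolding functional_S_mult[OF \<phi> K one] by (rule sum.cong[OF HOL.refl inner])
    also have "\<dots> = \<phi> (K i j)" by simp
    finally show "\<phi> ((K \<otimes>\<^bsub>S\<^esub> \<one>\<^bsub>S\<^esub>) i j) = \<phi> (K i j)" .
  qed
qed (rule S_mult_closed)

end

section \<open>Diagonal series as sequences of homogeneous coefficients\<close>

context quantum_matrices
begin

lemma functional_zero: "linear_functional E (carrier E) \<phi> \<Longrightarrow> \<phi> \<zero>\<^bsub>E\<^esub> = 0"
  using E.linear_functional_finsum[of \<phi> "{}" "\<lambda>_. \<zero>\<^bsub>E\<^esub>"] by simp

lemma functional_smult: "linear_functional E (carrier E) \<phi> \<Longrightarrow> x \<in> carrier E \<Longrightarrow> \<phi> (c \<odot>\<^bsub>E\<^esub> x) = c * \<phi> x"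
  by (simp add: linear_functional_def)

lemma functional_restrict:
  "linear_functional E (carrier E) \<phi> \<Longrightarrow> linear_functional E (C i j) \<phi>"
  by (simp add: linear_functional_def C_closed)

lemma abelian_monoid_S: "abelian_monoid S"
proof (rule abelian_monoidI)
  fix x y z assume "x \<in> carrier S" "y \<in> carrier S" "z \<in> carrier S"
  then have c: "x i j \<in> carrier E" "y i j \<in> carrier E" "z i j \<in> carrier E" for i j
    using S_closed by blast+
  show "x \<oplus>\<^bsub>S\<^esub> y \<oplus>\<^bsub>S\<^esub> z = x \<oplus>\<^bsub>S\<^esub> (y \<oplus>\<^bsub>S\<^esub> z)" by (simp add: E.a_assoc c)
  show "x \<oplus>\<^bsub>S\<^esub> y = y \<oplus>\<^bsub>S\<^esub> x" by (simp add: E.a_comm c)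
  show "\<zero>\<^bsub>S\<^esub> \<oplus>\<^bsub>S\<^esub> x = x" by (simp add: c)
qed (simp_all add: C_add)

lemma finsum_S:
  assumes "finite I" "\<And>k. k \<in> I \<Longrightarrow> f k \<in> carrier S"
  shows "(\<Oplus>\<^bsub>S\<^esub>k\<in>I. f k) i j = (\<Oplus>\<^bsub>E\<^esub>k\<in>I. f k i j)"
proof -
  interpret A: abelian_monoid S by (rule abelian_monoid_S)
  show ?thesis
    using assms
  proof (induction I rule: finite_induct)
    case (insert k I)
    have f: "f \<in> I \<rightarrow> carrier S" "f k \<in> carrier S" using insert by auto
    have g: "(\<lambda>k. f k i j) \<in> I \<rightarrow> carrier E" "f k i j \<in> carrier E"
      using insert.prems S_closed by auto
    have "(\<Oplus>\<^bsub>S\<^esub>k\<in>insert k I. f k) = f k \<oplus>\<^bsub>S\<^esub> (\<Oplus>\<^bsub>S\<^esub>k\<in>I. f k)"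
      by (rule A.finsum_insert[OF insert(1,2) f])
    then show ?case
      using insert E.finsum_insert[OF insert(1,2) g] by simp
  qed simp
qed

text \<open>Each chi_k lives in the single bidegree (k,-k), so all series in the product formula are
  diagonal. Encoding them as sequences replaces the double convolution by the single one in
  \<open>conv\<close>.\<close>

definition diag :: "(nat \<Rightarrow> kern) \<Rightarrow> series" where
  "diag f = (\<lambda>i j. if i = j then f i else \<zero>\<^bsub>E\<^esub>)"

definition homog :: "(nat \<Rightarrow> kern) \<Rightarrow> bool" where
  "homog f \<longleftrightarrow> (\<forall>i. f i \<in> C i i)"

definition conv :: "(nat \<Rightarrow> kern) \<Rightarrow> (nat \<Rightarrow> kern) \<Rightarrow> nat \<Rightarrow> kern" where
  "conv f g i = (\<Oplus>\<^bsub>E\<^esub>a\<in>{..i}. f a \<otimes>\<^bsub>E\<^esub> g (i - a))"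

definition rescale :: "complex \<Rightarrow> (nat \<Rightarrow> kern) \<Rightarrow> nat \<Rightarrow> kern" where
  "rescale t f i = (t ^ i) \<odot>\<^bsub>E\<^esub> f i"

definition unit_seq :: "nat \<Rightarrow> kern" where
  "unit_seq i = (if i = 0 then \<one>\<^bsub>E\<^esub> else \<zero>\<^bsub>E\<^esub>)"

lemma homog_closed: "homog f \<Longrightarrow> f i \<in> carrier E"
  using C_closed by (auto simp: homog_def)

lemma diag_closed: "homog f \<Longrightarrow> diag f \<in> carrier S"
  by (auto simp: homog_def diag_def)

lemma homog_rescale: "homog f \<Longrightarrow> homog (rescale t f)"
  by (simp add: homog_def rescale_def C_smult)

lemma homog_term: "homog f \<Longrightarrow> homog g \<Longrightarrow> a \<le> i \<Longrightarrow> f a \<otimes>\<^bsub>E\<^esub> g (i - a) \<in> C i i"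
  using C_mult[of "f a" a a "g (i - a)" "i - a" "i - a"] by (simp add: homog_def)

lemma homog_conv: "homog f \<Longrightarrow> homog g \<Longrightarrow> homog (conv f g)"
  using homog_term[of f g] unfolding homog_def[of "conv f g"] conv_def by (auto intro!: C_finsum)

lemma functional_conv:
  assumes "linear_functional E (carrier E) \<phi>" "homog f" "homog g"
  shows "\<phi> (conv f g i) = (\<Sum>a\<le>i. \<phi> (f a \<otimes>\<^bsub>E\<^esub> g (i - a)))"
  unfolding conv_def
  by (rule E.linear_functional_finsum[OF assms(1)]) (auto intro: E.m_closed homog_closed assms(2,3))

lemma homog_eqI:
  assumes "homog f" "homog g" "\<And>\<phi> i. linear_functional E (carrier E) \<phi> \<Longrightarrow> \<phi> (f i) = \<phi> (g i)"
  shows "f = g"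
proof
  fix i show "f i = g i" by (rule E_eqI) (use assms homog_closed in blast)+
qed

lemma diag_mult:
  assumes f: "homog f" and g: "homog g"
  shows "diag f \<otimes>\<^bsub>S\<^esub> diag g = diag (conv f g)"
proof (rule S_eqI)
  show "diag f \<otimes>\<^bsub>S\<^esub> diag g \<in> carrier S" "diag (conv f g) \<in> carrier S"
    using assms by (auto intro!: S_mult_closed diag_closed homog_conv simp del: S_simps)
  fix \<phi> i j assume \<phi>: "linear_functional E (carrier E) \<phi>"
  note z = functional_zero[OF \<phi>] and c = homog_closed[OF f] homog_closed[OF g]
  have inner: "(\<Sum>b\<le>j. \<phi> (diag f a b \<otimes>\<^bsub>E\<^esub> diag g (i - a) (j - b)))
     = (if i = j then \<phi> (f a \<otimes>\<^bsub>E\<^esub> g (i - a)) else 0)" if a: "a \<in> {..i}" for a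
  proof (cases "i = j")
    case True
    have "(\<Sum>b\<le>j. \<phi> (diag f a b \<otimes>\<^bsub>E\<^esub> diag g (i - a) (j - b)))
      = (\<Sum>b\<le>j. if b = a then \<phi> (f a \<otimes>\<^bsub>E\<^esub> g (i - a)) else 0)"
      using True by (intro sum.cong[OF HOL.refl]) (auto simp: diag_def z c)
    then show ?thesis using True a by simp
  next
    case False
    have "\<phi> (diag f a b \<otimes>\<^bsub>E\<^esub> diag g (i - a) (j - b)) = 0" if "b \<in> {..j}" for b
    proof (cases "a = b")
      case True
      then have "i - a \<noteq> j - b" using False that a by auto
      then show ?thesis by (simp add: diag_def z c)
    qed (simp add: diag_def z c)
    then show ?thesis using False by simp
  qed
  have "\<phi> ((diag f \<otimes>\<^bsub>S\<^esub> diag g) i j) = (\<Sum>a\<le>i. if i = j then \<phi> (f a \<otimes>\<^bsub>E\<^esub> g (i - a)) else 0)"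
    unfolding functional_S_mult[OF \<phi> diag_closed[OF f] diag_closed[OF g]]
    by (rule sum.cong[OF HOL.refl inner])
  also have "\<dots> = \<phi> (diag (conv f g) i j)"
    by (simp add: diag_def z functional_conv[OF \<phi> f g])
  finally show "\<phi> ((diag f \<otimes>\<^bsub>S\<^esub> diag g) i j) = \<phi> (diag (conv f g) i j)" .
qed

lemma functional_conv_rescale:
  assumes \<phi>: "linear_functional E (carrier E) \<phi>" and f: "homog f" and g: "homog g"
  shows "\<phi> (conv (rescale t f) (rescale u g) i) = (\<Sum>a\<le>i. t ^ a * u ^ (i - a) * \<phi> (f a \<otimes>\<^bsub>E\<^esub> g (i - a)))"
proof -
  have "\<phi> (rescale t f a \<otimes>\<^bsub>E\<^esub> rescale u g b) = t ^ a * u ^ b * \<phi> (f a \<otimes>\<^bsub>E\<^esub> g b)" for a b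
    using homog_closed[OF f] homog_closed[OF g]
    by (simp add: rescale_def E.smult_mult_left E.smult_mult_right E.smult_smult functional_smult[OF \<phi>])
  then show ?thesis by (simp add: functional_conv[OF \<phi> homog_rescale[OF f] homog_rescale[OF g]])
qed

text \<open>The weights of degrees \<open>a\<close> and \<open>i - a\<close> multiply to that of
  degree \<open>i\<close>, so rescaling is multiplicative. An inverse of the unscaled sequence
  therefore yields inverses for every \<open>t\<close>.\<close>

lemma conv_rescale:
  assumes f: "homog f" and g: "homog g"
  shows "conv (rescale t f) (rescale t g) = rescale t (conv f g)"
proof (rule homog_eqI)
  show "homog (conv (rescale t f) (rescale t g))" "homog (rescale t (conv f g))"
    using f g by (auto intro: homog_conv homog_rescale)
  fix \<phi> i assume \<phi>: "linear_functional E (carrier E) \<phi>"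
  have "\<phi> (conv (rescale t f) (rescale t g) i) = (\<Sum>a\<le>i. t ^ i * \<phi> (f a \<otimes>\<^bsub>E\<^esub> g (i - a)))"
    unfolding functional_conv_rescale[OF \<phi> f g] by (intro sum.cong[OF HOL.refl]) (simp flip: power_add)
  also have "\<dots> = \<phi> (rescale t (conv f g) i)"
    using homog_closed[OF homog_conv[OF f g]]
    by (simp add: rescale_def functional_smult[OF \<phi>] functional_conv[OF \<phi> f g] sum_distrib_left)
  finally show "\<phi> (conv (rescale t f) (rescale t g) i) = \<phi> (rescale t (conv f g) i)" .
qed

lemma homog_unit_seq: "homog unit_seq"
  by (simp add: homog_def unit_seq_def)

lemma diag_unit_seq: "diag unit_seq = \<one>\<^bsub>S\<^esub>"
  by (auto simp: diag_def unit_seq_def fun_eq_iff)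

lemma rescale_unit_seq: "rescale t unit_seq = unit_seq"
  by (auto simp: rescale_def unit_seq_def fun_eq_iff)

text \<open>The inner conditional, also in \<open>prod_seq\<close> below, is redundant; it supplies the termination proof.\<close>

function conv_inverse :: "(nat \<Rightarrow> kern) \<Rightarrow> nat \<Rightarrow> kern" where
  "conv_inverse p i = (if i = 0 then \<one>\<^bsub>E\<^esub>
     else (- 1) \<odot>\<^bsub>E\<^esub> (\<Oplus>\<^bsub>E\<^esub>a\<in>{1..i}. if a \<in> {1..i} then p a \<otimes>\<^bsub>E\<^esub> conv_inverse p (i - a) else \<zero>\<^bsub>E\<^esub>))"
  by pat_completeness auto
termination by (relation "measure snd") auto

declare conv_inverse.simps [simp del]

lemma conv_inverse_0 [simp]: "conv_inverse p 0 = \<one>\<^bsub>E\<^esub>"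
  by (simp add: conv_inverse.simps)

lemma homog_conv_inverse:
  assumes "homog p" shows "homog (conv_inverse p)"
proof -
  have "conv_inverse p i \<in> C i i" for i
  proof (induction i rule: less_induct)
    case (less i)
    have "p a \<otimes>\<^bsub>E\<^esub> conv_inverse p (i - a) \<in> C i i" if "a \<in> {1..i}" for a
      using that less[of "i - a"] C_mult[of "p a" a a "conv_inverse p (i - a)" "i - a" "i - a"] assms
      by (simp add: homog_def)
    then show ?case
      by (cases "i = 0") (auto simp: conv_inverse.simps[of p i] intro!: C_smult C_finsum)
  qed
  then show ?thesis by (simp add: homog_def)
qed

text \<open>The recursion solves the equation degree by degree: the constant term 1 of
  \<open>p\<close> isolates the inverse's coefficient of degree \<open>i\<close>, and the other
  summands involve lower degrees only.\<close>

lemma conv_conv_inverse: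
  assumes p: "homog p" "p 0 = \<one>\<^bsub>E\<^esub>"
  shows "conv p (conv_inverse p) = unit_seq"
proof (rule homog_eqI)
  let ?r = "conv_inverse p"
  have r: "homog ?r" by (rule homog_conv_inverse[OF p(1)])
  show "homog (conv p ?r)" "homog unit_seq" using p r by (auto intro: homog_conv homog_unit_seq)
  fix \<phi> i assume \<phi>: "linear_functional E (carrier E) \<phi>"
  note c = homog_closed[OF p(1)] homog_closed[OF r]
  show "\<phi> (conv p ?r i) = \<phi> (unit_seq i)"
  proof (cases "i = 0")
    case True
    then show ?thesis by (simp add: conv_def unit_seq_def p(2))
  next
    case False
    have fs: "(\<Oplus>\<^bsub>E\<^esub>a\<in>{1..i}. if a \<in> {1..i} then p a \<otimes>\<^bsub>E\<^esub> ?r (i - a) else \<zero>\<^bsub>E\<^esub>) \<in> carrier E"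
      by (rule E.finsum_closed) (auto simp: c)
    have "\<phi> (?r i) = - \<phi> (\<Oplus>\<^bsub>E\<^esub>a\<in>{1..i}. if a \<in> {1..i} then p a \<otimes>\<^bsub>E\<^esub> ?r (i - a) else \<zero>\<^bsub>E\<^esub>)"
      using False fs by (subst conv_inverse.simps) (simp add: functional_smult[OF \<phi>])
    also have "\<dots> = - (\<Sum>a\<in>{1..i}. \<phi> (p a \<otimes>\<^bsub>E\<^esub> ?r (i - a)))"
      by (subst E.linear_functional_finsum[OF \<phi>]) (auto simp: c)
    finally have "\<phi> (?r i) + (\<Sum>a\<in>{1..i}. \<phi> (p a \<otimes>\<^bsub>E\<^esub> ?r (i - a))) = 0" by simp
    moreover have "(\<Sum>a\<le>i. \<phi> (p a \<otimes>\<^bsub>E\<^esub> ?r (i - a))) = \<phi> (?r i) + (\<Sum>a\<in>{1..i}. \<phi> (p a \<otimes>\<^bsub>E\<^esub> ?r (i - a)))"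
      by (simp add: atMost_atLeast0 sum.atLeast_Suc_atMost p(2) c)
    ultimately show ?thesis
      using False by (simp add: functional_conv[OF \<phi> p(1) r] unit_seq_def functional_zero[OF \<phi>])
  qed
qed

text \<open>The recursion gives right inverses only. The inverse sequence again has constant term 1,
  so it has a right inverse too, which by associativity must be the original series.\<close>

lemma diag_rescale_inverse:
  assumes p: "homog p" "p 0 = \<one>\<^bsub>E\<^esub>"
  shows "diag (rescale t p) \<otimes>\<^bsub>S\<^esub> diag (rescale t (conv_inverse p)) = \<one>\<^bsub>S\<^esub>"
    "diag (rescale t (conv_inverse p)) \<otimes>\<^bsub>S\<^esub> diag (rescale t p) = \<one>\<^bsub>S\<^esub>"
proof -
  have right: "diag (rescale t p) \<otimes>\<^bsub>S\<^esub> diag (rescale t (conv_inverse p)) = \<one>\<^bsub>S\<^esub>"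
    if "homog p" "p 0 = \<one>\<^bsub>E\<^esub>" for p
    using that homog_conv_inverse[of p]
    by (simp only: diag_mult homog_rescale conv_rescale conv_conv_inverse rescale_unit_seq diag_unit_seq)
  let ?r = "conv_inverse p"
  have r: "homog ?r" by (rule homog_conv_inverse[OF p(1)])
  have c: "diag (rescale t f) \<in> carrier S" if "homog f" for f
    by (intro diag_closed homog_rescale that)
  show pr: "diag (rescale t p) \<otimes>\<^bsub>S\<^esub> diag (rescale t ?r) = \<one>\<^bsub>S\<^esub>" by (rule right[OF p])
  have rr: "diag (rescale t ?r) \<otimes>\<^bsub>S\<^esub> diag (rescale t (conv_inverse ?r)) = \<one>\<^bsub>S\<^esub>"
    by (rule right[OF r]) simp
  have "diag (rescale t p) = diag (rescale t (conv_inverse ?r))"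
    using S.inv_unique[OF pr rr] c[OF p(1)] c[OF r] c[OF homog_conv_inverse[OF r]] by blast
  then show "diag (rescale t ?r) \<otimes>\<^bsub>S\<^esub> diag (rescale t p) = \<one>\<^bsub>S\<^esub>" using rr by simp
qed

text \<open>The coefficients of \<open>chi_factor\<close> as a polynomial in \<open>- t\<close>,
  with the unit in degree 0 and the cut-off at \<open>m\<close> of the defining sum.\<close>

definition chi_seq :: "nat \<Rightarrow> kern" where
  "chi_seq k = (if k = 0 then \<one>\<^bsub>E\<^esub> else if k \<le> m then chi_component k else \<zero>\<^bsub>E\<^esub>)"

lemma homog_chi_seq: "homog chi_seq"
  by (simp add: homog_def chi_seq_def chi_component_C)

lemma chi_closed: "chi q m n k \<in> carrier S"
  by (auto simp: chi_eq chi_component_C)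

lemma chi_factor_eq: "chi_factor q m n t = diag (rescale (- t) chi_seq)"
proof (rule S_eqI)
  interpret A: abelian_monoid S by (rule abelian_monoid_S)
  have smult: "c \<odot>\<^bsub>S\<^esub> chi q m n k \<in> carrier S" for c k
    using chi_closed[of k] by (simp add: C_smult)
  have sum_closed: "(\<Oplus>\<^bsub>S\<^esub>k\<in>{1..m}. ((- t) ^ k) \<odot>\<^bsub>S\<^esub> chi q m n k) \<in> carrier S"
    by (rule A.finsum_closed) (use smult in blast)
  show "chi_factor q m n t \<in> carrier S"
    unfolding chi_factor_def using A.a_closed[OF S.one_closed sum_closed] .
  show "diag (rescale (- t) chi_seq) \<in> carrier S" by (intro diag_closed homog_rescale homog_chi_seq)
  fix \<phi> i j assume \<phi>: "linear_functional E (carrier E) \<phi>"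
  note z = functional_zero[OF \<phi>]
  have cl: "chi q m n k i j \<in> carrier E" for k by (rule S_closed[OF chi_closed])
  have fs: "(\<Oplus>\<^bsub>E\<^esub>k\<in>{1..m}. ((- t) ^ k) \<odot>\<^bsub>E\<^esub> chi q m n k i j) \<in> carrier E"
    by (rule E.finsum_closed) (auto simp: cl)
  have "chi_factor q m n t i j = \<one>\<^bsub>S\<^esub> i j \<oplus>\<^bsub>E\<^esub> (\<Oplus>\<^bsub>E\<^esub>k\<in>{1..m}. ((- t) ^ k) \<odot>\<^bsub>E\<^esub> chi q m n k i j)"
    unfolding chi_factor_def using finsum_S[of "{1..m}" "\<lambda>k. ((- t) ^ k) \<odot>\<^bsub>S\<^esub> chi q m n k" i j] smult
    by (simp del: S_simps(1))
  moreover have "\<phi> (\<one>\<^bsub>S\<^esub> i j \<oplus>\<^bsub>E\<^esub> (\<Oplus>\<^bsub>E\<^esub>k\<in>{1..m}. ((- t) ^ k) \<odot>\<^bsub>E\<^esub> chi q m n k i j))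
      = \<phi> (\<one>\<^bsub>S\<^esub> i j) + \<phi> (\<Oplus>\<^bsub>E\<^esub>k\<in>{1..m}. ((- t) ^ k) \<odot>\<^bsub>E\<^esub> chi q m n k i j)"
    using \<phi> fs S_closed[OF S.one_closed, of i j] unfolding linear_functional_def by blast
  moreover have "\<phi> (\<Oplus>\<^bsub>E\<^esub>k\<in>{1..m}. ((- t) ^ k) \<odot>\<^bsub>E\<^esub> chi q m n k i j)
      = (\<Sum>k\<in>{1..m}. (- t) ^ k * \<phi> (chi q m n k i j))"
    by (subst E.linear_functional_finsum[OF \<phi>]) (auto simp: cl functional_smult[OF \<phi>])
  moreover have "(\<Sum>k\<in>{1..m}. (- t) ^ k * \<phi> (chi q m n k i j))
      = (\<Sum>k\<in>{1..m}. if k = i then if i = j then (- t) ^ i * \<phi> (chi_component i) else 0 else 0)"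
    by (rule sum.cong[OF HOL.refl]) (auto simp: chi_eq z)
  ultimately show "\<phi> (chi_factor q m n t i j) = \<phi> (diag (rescale (- t) chi_seq) i j)"
    using chi_component_closed[of i]
    by (auto simp: diag_def rescale_def chi_seq_def z functional_smult[OF \<phi>])
qed

end

section \<open>The infinite product and its functional equation\<close>

locale quantum_matrices_unit = quantum_matrices +
  assumes q_less_1: "q < 1"
begin

lemma q_power_neq_1: "0 < i \<Longrightarrow> Q ^ (2 * i) \<noteq> 1"
proof -
  assume "0 < i"
  then have "q ^ (2 * i) < 1" using q_pos q_less_1 by (intro power_less_one_iff[THEN iffD2, rotated]) auto
  then have "complex_of_real (q ^ (2 * i)) \<noteq> 1" by (metis less_irrefl of_real_eq_1_iff)
  then show ?thesis by simp
qed

text \<open>The recursion is forced by the functional equation \<open>P t = chi_factor t * P (q\<^sup>2 t)\<close> of the infinite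
  product \<open>P t = \<Sum> t\<^sup>i prod_seq i\<close>.\<close>

function prod_seq :: "nat \<Rightarrow> kern" where
  "prod_seq i = (if i = 0 then \<one>\<^bsub>E\<^esub> else (1 / (1 - Q ^ (2 * i))) \<odot>\<^bsub>E\<^esub>
     (\<Oplus>\<^bsub>E\<^esub>k\<in>{1..i}. if k \<in> {1..i} then ((- 1) ^ k * Q ^ (2 * (i - k))) \<odot>\<^bsub>E\<^esub> (chi_seq k \<otimes>\<^bsub>E\<^esub> prod_seq (i - k)) else \<zero>\<^bsub>E\<^esub>))"
  by pat_completeness auto
termination by (relation "measure id") auto

declare prod_seq.simps [simp del]

lemma prod_seq_0 [simp]: "prod_seq 0 = \<one>\<^bsub>E\<^esub>"
  by (simp add: prod_seq.simps)

lemma homog_prod_seq: "homog prod_seq"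
proof -
  have "prod_seq i \<in> C i i" for i
  proof (induction i rule: less_induct)
    case (less i)
    have "chi_seq k \<otimes>\<^bsub>E\<^esub> prod_seq (i - k) \<in> C i i" if "k \<in> {1..i}" for k
      using that less[of "i - k"] C_mult[of "chi_seq k" k k "prod_seq (i - k)" "i - k" "i - k"] homog_chi_seq
      by (simp add: homog_def)
    then show ?case
      by (cases "i = 0") (auto simp: prod_seq.simps[of i] intro!: C_smult C_finsum)
  qed
  then show ?thesis by (simp add: homog_def)
qed

text \<open>The coefficient of t^i in the functional equation. The summand for k = 0 is q^(2i) times
  the coefficient of degree \<open>i\<close>; moved to the other side it produces the factor 1 -
  q^(2i) by which the recursion divides.\<close>

lemma functional_prod_seq:
  assumes \<phi>: "linear_functional E (carrier E) \<phi>"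
  shows "(\<Sum>k\<le>i. (- 1) ^ k * Q ^ (2 * (i - k)) * \<phi> (chi_seq k \<otimes>\<^bsub>E\<^esub> prod_seq (i - k))) = \<phi> (prod_seq i)"
proof (cases "i = 0")
  case True
  then show ?thesis by (simp add: chi_seq_def)
next
  case False
  note c = homog_closed[OF homog_chi_seq] homog_closed[OF homog_prod_seq]
  let ?s = "\<Sum>k\<in>{1..i}. (- 1) ^ k * Q ^ (2 * (i - k)) * \<phi> (chi_seq k \<otimes>\<^bsub>E\<^esub> prod_seq (i - k))"
  let ?f = "\<lambda>k. if k \<in> {1..i} then ((- 1) ^ k * Q ^ (2 * (i - k))) \<odot>\<^bsub>E\<^esub> (chi_seq k \<otimes>\<^bsub>E\<^esub> prod_seq (i - k)) else \<zero>\<^bsub>E\<^esub>"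
  have fs: "(\<Oplus>\<^bsub>E\<^esub>k\<in>{1..i}. ?f k) \<in> carrier E"
    by (rule E.finsum_closed) (auto simp: c)
  have "\<phi> (prod_seq i) = 1 / (1 - Q ^ (2 * i)) * \<phi> (\<Oplus>\<^bsub>E\<^esub>k\<in>{1..i}. ?f k)"
    using False fs by (subst prod_seq.simps) (simp add: functional_smult[OF \<phi>])
  also have "\<phi> (\<Oplus>\<^bsub>E\<^esub>k\<in>{1..i}. ?f k) = ?s"
    by (subst E.linear_functional_finsum[OF \<phi>]) (auto simp: c functional_smult[OF \<phi>])
  finally have "?s = (1 - Q ^ (2 * i)) * \<phi> (prod_seq i)"
    using q_power_neq_1[of i] False by simp
  moreover have "(\<Sum>k\<le>i. (- 1) ^ k * Q ^ (2 * (i - k)) * \<phi> (chi_seq k \<otimes>\<^bsub>E\<^esub> prod_seq (i - k)))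
     = Q ^ (2 * i) * \<phi> (prod_seq i) + ?s"
    by (simp add: atMost_atLeast0 sum.atLeast_Suc_atMost c chi_seq_def[of 0])
  ultimately show ?thesis by (simp add: algebra_simps)
qed

definition prod_series :: "complex \<Rightarrow> series" where
  "prod_series t = diag (rescale t prod_seq)"

definition inverse_series :: "complex \<Rightarrow> series" where
  "inverse_series t = diag (rescale t (conv_inverse prod_seq))"

lemma homog_inv_seq: "homog (conv_inverse prod_seq)"
  by (rule homog_conv_inverse[OF homog_prod_seq])

lemma prod_series_closed: "prod_series t \<in> carrier S" and inverse_series_closed: "inverse_series t \<in> carrier S"
  unfolding prod_series_def inverse_series_def by (intro diag_closed homog_rescale homog_prod_seq homog_inv_seq)+

lemma prod_inverse_right: "prod_series t \<otimes>\<^bsub>S\<^esub> inverse_series t = \<one>\<^bsub>S\<^esub>" and prod_inverse_left: "inverse_series t \<otimes>\<^bsub>S\<^esub> prod_series t = \<one>\<^bsub>S\<^esub>"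
  unfolding prod_series_def inverse_series_def using diag_rescale_inverse[OF homog_prod_seq prod_seq_0] by blast+

lemma chi_factor_closed: "chi_factor q m n t \<in> carrier S"
  unfolding chi_factor_eq by (intro diag_closed homog_rescale homog_chi_seq)

text \<open>In degree \<open>i\<close> every summand contains (-t)^k (q^2 t)^(i-k), from which t^i
  can be extracted; what remains is the coefficient identity of
  \<open>functional_prod_seq\<close>.\<close>

lemma chi_factor_shift: "chi_factor q m n t \<otimes>\<^bsub>S\<^esub> prod_series (t * Q\<^sup>2) = prod_series t"
proof -
  have "conv (rescale (- t) chi_seq) (rescale (t * Q\<^sup>2) prod_seq) = rescale t prod_seq"
  proof (rule homog_eqI)
    show "homog (conv (rescale (- t) chi_seq) (rescale (t * Q\<^sup>2) prod_seq))" "homog (rescale t prod_seq)"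
      by (intro homog_conv homog_rescale homog_chi_seq homog_prod_seq)+
    fix \<phi> i assume \<phi>: "linear_functional E (carrier E) \<phi>"
    have "(- t) ^ k * (t * Q\<^sup>2) ^ (i - k) = t ^ i * ((- 1) ^ k * Q ^ (2 * (i - k)))" if "k \<in> {..i}" for k
    proof -
      have "(- t) ^ k = (- 1) ^ k * t ^ k" by (rule power_minus)
      moreover have "t ^ i = t ^ k * t ^ (i - k)" using that by (simp flip: power_add)
      ultimately show ?thesis by (simp add: power_mult_distrib power_mult)
    qed
    then have "\<phi> (conv (rescale (- t) chi_seq) (rescale (t * Q\<^sup>2) prod_seq) i)
      = (\<Sum>k\<le>i. t ^ i * ((- 1) ^ k * Q ^ (2 * (i - k))) * \<phi> (chi_seq k \<otimes>\<^bsub>E\<^esub> prod_seq (i - k)))"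
      unfolding functional_conv_rescale[OF \<phi> homog_chi_seq homog_prod_seq] by simp
    also have "\<dots> = t ^ i * \<phi> (prod_seq i)"
      unfolding functional_prod_seq[OF \<phi>, of i, symmetric] sum_distrib_left by (simp add: mult.assoc)
    also have "\<dots> = \<phi> (rescale t prod_seq i)"
      using homog_closed[OF homog_prod_seq] by (simp add: rescale_def functional_smult[OF \<phi>])
    finally show "\<phi> (conv (rescale (- t) chi_seq) (rescale (t * Q\<^sup>2) prod_seq) i) = \<phi> (rescale t prod_seq i)" .
  qed
  then show ?thesis
    unfolding chi_factor_eq prod_series_def
    by (simp add: diag_mult homog_rescale homog_chi_seq homog_prod_seq)
qed

lemma partial_product_closed:
  "partial_product q m n (\<lambda>j. chi_factor q m n (f j)) N \<in> carrier S"
  by (induction N) (auto intro: S_mult_closed chi_factor_closed S.one_closed simp del: S_simps)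

lemma partial_product_shift:
  "partial_product q m n (\<lambda>j. chi_factor q m n (t * Q ^ (2 * j))) N \<otimes>\<^bsub>S\<^esub> prod_series (t * Q ^ (2 * N)) = prod_series t"
proof (induction N)
  case 0
  then show ?case using S.l_one[OF prod_series_closed] by (simp del: S_simps)
next
  case (Suc N)
  let ?p = "partial_product q m n (\<lambda>j. chi_factor q m n (t * Q ^ (2 * j)))"
  have "?p (Suc N) \<otimes>\<^bsub>S\<^esub> prod_series (t * Q ^ (2 * Suc N))
      = ?p N \<otimes>\<^bsub>S\<^esub> (chi_factor q m n (t * Q ^ (2 * N)) \<otimes>\<^bsub>S\<^esub> prod_series (t * Q ^ (2 * N) * Q\<^sup>2))"
    using S.m_assoc[OF partial_product_closed chi_factor_closed prod_series_closed]
    by (simp add: power2_eq_square ac_simps del: S_simps)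
  then show ?case using Suc by (simp add: chi_factor_shift)
qed

text \<open>Each factor is multiplied on the right of the earlier ones and absorbed by the tail
  \<open>prod_series\<close>; cancelling the tail on the right respects this order.\<close>

lemma partial_product_eq:
  "partial_product q m n (\<lambda>j. chi_factor q m n (t * Q ^ (2 * j))) N = prod_series t \<otimes>\<^bsub>S\<^esub> inverse_series (t * Q ^ (2 * N))"
proof -
  let ?p = "partial_product q m n (\<lambda>j. chi_factor q m n (t * Q ^ (2 * j))) N"
  have "?p = ?p \<otimes>\<^bsub>S\<^esub> (prod_series (t * Q ^ (2 * N)) \<otimes>\<^bsub>S\<^esub> inverse_series (t * Q ^ (2 * N)))"
    unfolding prod_inverse_right using S.r_one[OF partial_product_closed] by simp
  also have "\<dots> = (?p \<otimes>\<^bsub>S\<^esub> prod_series (t * Q ^ (2 * N))) \<otimes>\<^bsub>S\<^esub> inverse_series (t * Q ^ (2 * N))"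
    by (rule S.m_assoc[OF partial_product_closed prod_series_closed inverse_series_closed, symmetric])
  finally show ?thesis unfolding partial_product_shift .
qed

lemma product_ratio_eq: "prod_series t \<otimes>\<^bsub>S\<^esub> inverse_series u = diag (conv (rescale t prod_seq) (rescale u (conv_inverse prod_seq)))"
  unfolding prod_series_def inverse_series_def by (intro diag_mult homog_rescale homog_prod_seq homog_inv_seq)

text \<open>The functional is assumed linear on one component only, since coefficientwise
  convergence quantifies over such functionals.\<close>

lemma functional_product_ratio:
  assumes \<phi>: "linear_functional E (C i i) \<phi>"
  shows "\<phi> ((prod_series t \<otimes>\<^bsub>S\<^esub> inverse_series u) i i)
    = (\<Sum>a\<le>i. t ^ a * u ^ (i - a) * \<phi> (prod_seq a \<otimes>\<^bsub>E\<^esub> conv_inverse prod_seq (i - a)))"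
proof -
  let ?r = "conv_inverse prod_seq"
  have summand: "rescale t prod_seq a \<otimes>\<^bsub>E\<^esub> rescale u ?r (i - a) = (t ^ a * u ^ (i - a)) \<odot>\<^bsub>E\<^esub> (prod_seq a \<otimes>\<^bsub>E\<^esub> ?r (i - a))" for a
    using homog_closed[OF homog_prod_seq] homog_closed[OF homog_inv_seq]
    by (simp add: rescale_def E.smult_mult_left E.smult_mult_right E.smult_smult mult.commute)
  have in_C: "rescale t prod_seq a \<otimes>\<^bsub>E\<^esub> rescale u ?r (i - a) \<in> C i i" if "a \<in> {..i}" for a
    using that by (intro homog_term homog_rescale homog_prod_seq homog_inv_seq) simp
  have "\<phi> ((prod_series t \<otimes>\<^bsub>S\<^esub> inverse_series u) i i) = (\<Sum>a\<le>i. \<phi> (rescale t prod_seq a \<otimes>\<^bsub>E\<^esub> rescale u ?r (i - a)))"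
  proof -
    have sub: "C i i \<subseteq> carrier E" using C_closed by blast
    have "\<phi> (\<Oplus>\<^bsub>E\<^esub>a\<in>{..i}. rescale t prod_seq a \<otimes>\<^bsub>E\<^esub> rescale u ?r (i - a))
        = (\<Sum>a\<le>i. \<phi> (rescale t prod_seq a \<otimes>\<^bsub>E\<^esub> rescale u ?r (i - a)))"
      by (rule conjunct2[OF E.linear_functional_finsum_subspace[OF \<phi> sub C_zero]]) (use C_add in_C in auto)
    then show ?thesis by (simp add: product_ratio_eq diag_def conv_def)
  qed
  also have "\<dots> = (\<Sum>a\<le>i. t ^ a * u ^ (i - a) * \<phi> (prod_seq a \<otimes>\<^bsub>E\<^esub> ?r (i - a)))"
    using \<phi> homog_term[OF homog_prod_seq homog_inv_seq] unfolding summand linear_functional_def by simp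
  finally show ?thesis .
qed

text \<open>In degree \<open>i\<close> the summand with index \<open>a\<close> depends on the number
  of factors through q^(2N(i-a)). All summands with a < i tend to 0; the one with a = i is constant
  and equals the coefficient of the limit.\<close>

lemma partial_product_converges:
  "series_converges q m n (partial_product q m n (\<lambda>j. chi_factor q m n (t * Q ^ (2 * j)))) (prod_series t)"
  unfolding series_converges_def partial_product_eq
proof (intro conjI allI impI)
  show "prod_series t \<otimes>\<^bsub>S\<^esub> inverse_series (t * Q ^ (2 * N)) \<in> carrier S" for N
    by (intro S_mult_closed prod_series_closed inverse_series_closed)
  show "prod_series t \<in> carrier S" by (rule prod_series_closed)
  fix i j \<phi> assume \<phi>: "linear_functional E (C i j) \<phi>"
  let ?r = "conv_inverse prod_seq"
  show "(\<lambda>N. \<phi> ((prod_series t \<otimes>\<^bsub>S\<^esub> inverse_series (t * Q ^ (2 * N))) i j)) \<longlonglongrightarrow> \<phi> (prod_series t i j)"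
  proof (cases "i = j")
    case False
    then show ?thesis unfolding product_ratio_eq unfolding prod_series_def diag_def by simp
  next
    case True
    then have \<phi>': "linear_functional E (C i i) \<phi>" using \<phi> by simp
    have "(\<lambda>N. t ^ a * (t * Q ^ (2 * N)) ^ (i - a) * \<phi> (prod_seq a \<otimes>\<^bsub>E\<^esub> ?r (i - a)))
        \<longlonglongrightarrow> (if a = i then t ^ i * \<phi> (prod_seq i) else 0)" if a: "a \<in> {..i}" for a
    proof (cases "a = i")
      case True
      then show ?thesis using homog_closed[OF homog_prod_seq] by simp
    next
      case False
      have eq: "t ^ a * (t * Q ^ (2 * N)) ^ (i - a) * c = t ^ a * t ^ (i - a) * c * (Q ^ (2 * (i - a))) ^ N" for N c
        by (simp add: power_mult_distrib power_mult[symmetric] ac_simps)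
      have lim: "(\<lambda>N. t ^ a * t ^ (i - a) * c * (Q ^ (2 * (i - a))) ^ N) \<longlonglongrightarrow> t ^ a * t ^ (i - a) * c * 0" for c
      proof (intro tendsto_mult tendsto_const LIMSEQ_power_zero)
        have "q ^ (2 * (i - a)) < 1"
          using q_pos q_less_1 False a by (intro power_less_one_iff[THEN iffD2, rotated]) auto
        then show "norm (Q ^ (2 * (i - a))) < 1" using q_pos by (simp add: norm_power)
      qed
      show ?thesis
        unfolding eq using lim[of "\<phi> (prod_seq a \<otimes>\<^bsub>E\<^esub> ?r (i - a))"] by (simp only: False if_False mult_zero_right)
    qed
    then have "(\<lambda>N. \<Sum>a\<le>i. t ^ a * (t * Q ^ (2 * N)) ^ (i - a) * \<phi> (prod_seq a \<otimes>\<^bsub>E\<^esub> ?r (i - a)))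
        \<longlonglongrightarrow> (\<Sum>a\<le>i. if a = i then t ^ i * \<phi> (prod_seq i) else 0)"
      by (rule tendsto_sum)
    moreover have "\<phi> (prod_series t i i) = t ^ i * \<phi> (prod_seq i)"
      using \<phi>' homog_prod_seq by (simp add: prod_series_def diag_def rescale_def linear_functional_def homog_def)
    ultimately show ?thesis
      unfolding True[symmetric] functional_product_ratio[OF \<phi>'] by simp
  qed
qed

text \<open>This gives meaning to the definite description in \<open>infinite_product\<close>.
  Functionals on the whole kernel algebra restrict to the components and already separate
  points.\<close>

lemma series_converges_unique:
  assumes "series_converges q m n X K" "series_converges q m n X L"
  shows "K = L"
proof (rule S_eqI)
  show "K \<in> carrier S" "L \<in> carrier S" using assms by (simp_all only: series_converges_def)
  fix \<phi> i j assume "linear_functional E (carrier E) \<phi>"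
  then have "linear_functional E (C i j) \<phi>" by (rule functional_restrict)
  then have "(\<lambda>p. \<phi> (X p i j)) \<longlonglongrightarrow> \<phi> (K i j)" "(\<lambda>p. \<phi> (X p i j)) \<longlonglongrightarrow> \<phi> (L i j)"
    using assms unfolding series_converges_def by blast+
  then show "\<phi> (K i j) = \<phi> (L i j)" by (rule LIMSEQ_unique)
qed

lemma shifted_factor_eq:
  "shifted_factor q m n lam = (\<lambda>j. chi_factor q m n (Q powr (2 * lam) * Q ^ (2 * j)))"
proof
  fix j
  have "2 * (lam + of_nat j) = 2 * lam + of_nat (2 * j)" by (simp add: algebra_simps)
  then have "Q powr (2 * (lam + of_nat j)) = Q powr (2 * lam) * Q powr of_nat (2 * j)"
    by (simp only: powr_add)
  also have "Q powr of_nat (2 * j) = Q ^ (2 * j)" by (rule powr_nat') simp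
  finally show "shifted_factor q m n lam j = chi_factor q m n (Q powr (2 * lam) * Q ^ (2 * j))"
    by (simp add: shifted_factor_def)
qed

lemma chi_product_converges: "has_infinite_product q m n (shifted_factor q m n lam) (prod_series (Q powr (2 * lam)))"
  unfolding has_infinite_product_def shifted_factor_eq by (rule partial_product_converges)

lemma chi_product_eq: "chi_product q m n lam = prod_series (Q powr (2 * lam))"
  unfolding chi_product_def infinite_product_def
  using chi_product_converges series_converges_unique unfolding has_infinite_product_def
  by (intro the_equality) blast+

section \<open>Polynomial kernels and interpolation\<close>

lemma functional_kernel_eval:
  assumes \<phi>: "linear_functional E (carrier E) \<phi>" and K: "polynomial_kernel q m n K"
    and D: "\<And>d. D < d \<Longrightarrow> K i j d = \<zero>\<^bsub>E\<^esub>"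
  shows "\<phi> (kernel_eval q m n K u i j) = (\<Sum>d\<le>D. \<phi> (K i j d) * u ^ d)"
proof -
  let ?A = "{d. K i j d \<noteq> \<zero>\<^bsub>E\<^esub>}"
  have A: "finite ?A" and c: "K i j d \<in> carrier E" for d
    using K C_closed unfolding polynomial_kernel_def by blast+
  have "\<phi> (kernel_eval q m n K u i j) = (\<Sum>d\<in>?A. \<phi> (K i j d) * u ^ d)"
    unfolding kernel_eval_def
    by (subst E.linear_functional_finsum[OF \<phi> A]) (auto simp: c functional_smult[OF \<phi>] mult.commute)
  also have "\<dots> = (\<Sum>d\<le>D. \<phi> (K i j d) * u ^ d)"
  proof (rule sum.mono_neutral_left)
    show "?A \<subseteq> {..D}" using D by (force simp: not_less[symmetric])
  qed (auto simp: functional_zero[OF \<phi>])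
  finally show ?thesis .
qed

text \<open>The coefficient of u^d in the component of bidegree (i,-i) of P(u) P(1)^(-1).\<close>

definition lambda_kernel :: poly_kernel where
  "lambda_kernel i j d = (if i = j \<and> d \<le> i then prod_seq d \<otimes>\<^bsub>E\<^esub> conv_inverse prod_seq (i - d) else \<zero>\<^bsub>E\<^esub>)"

lemma polynomial_lambda_kernel: "polynomial_kernel q m n lambda_kernel"
  unfolding polynomial_kernel_def
proof (intro allI conjI)
  fix i j d
  show "lambda_kernel i j d \<in> C i j"
    using homog_term[OF homog_prod_seq homog_inv_seq] by (simp add: lambda_kernel_def)
  show "finite {d. lambda_kernel i j d \<noteq> \<zero>\<^bsub>E\<^esub>}"
    by (rule finite_subset[of _ "{..i}"]) (auto simp: lambda_kernel_def)
qed

lemma kernel_eval_closed: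
  assumes "polynomial_kernel q m n K" shows "kernel_eval q m n K u \<in> carrier S"
proof -
  have "kernel_eval q m n K u i j \<in> C i j" for i j
    unfolding kernel_eval_def using assms unfolding polynomial_kernel_def by (intro C_finsum C_smult) blast+
  then show ?thesis by simp
qed

lemma kernel_eval_lambda_kernel: "kernel_eval q m n lambda_kernel t = prod_series t \<otimes>\<^bsub>S\<^esub> inverse_series 1"
proof (rule S_eqI)
  show "kernel_eval q m n lambda_kernel t \<in> carrier S"
    by (rule kernel_eval_closed[OF polynomial_lambda_kernel])
  show "prod_series t \<otimes>\<^bsub>S\<^esub> inverse_series 1 \<in> carrier S" by (intro S_mult_closed prod_series_closed inverse_series_closed)
  fix \<phi> i j assume \<phi>: "linear_functional E (carrier E) \<phi>"
  have eval: "\<phi> (kernel_eval q m n lambda_kernel t i j) = (\<Sum>d\<le>i. \<phi> (lambda_kernel i j d) * t ^ d)"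
    by (rule functional_kernel_eval[OF \<phi> polynomial_lambda_kernel]) (simp add: lambda_kernel_def)
  show "\<phi> (kernel_eval q m n lambda_kernel t i j) = \<phi> ((prod_series t \<otimes>\<^bsub>S\<^esub> inverse_series 1) i j)"
  proof (cases "i = j")
    case True
    then show ?thesis
      unfolding eval using functional_product_ratio[OF functional_restrict[OF \<phi>], where i = i and t = t and u = 1]
      by (simp add: lambda_kernel_def mult.commute)
  next
    case False
    then show ?thesis
      unfolding eval by (simp add: lambda_kernel_def product_ratio_eq diag_def functional_zero[OF \<phi>])
  qed
qed

lemma K_neg_eq:
  assumes "l \<le> - 1"
  shows "K_neg q m n l = prod_series (of_real (q powi (2 * l))) \<otimes>\<^bsub>S\<^esub> inverse_series 1"
proof -
  let ?t = "complex_of_real (q powi (2 * l))"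
  have "complex_of_real (q powi (2 * (l + int j))) = ?t * Q ^ (2 * j)" for j
  proof -
    have "2 * (l + int j) = 2 * l + int (2 * j)" by simp
    then have "q powi (2 * (l + int j)) = q powi (2 * l) * q powi (int (2 * j))"
      by (simp only: power_int_add[OF disjI1[OF Q_nonzero]])
    also have "q powi (int (2 * j)) = q ^ (2 * j)" by (rule power_int_of_nat)
    finally show ?thesis by simp
  qed
  then have "K_neg q m n l = prod_series ?t \<otimes>\<^bsub>S\<^esub> inverse_series (?t * Q ^ (2 * nat (- l)))"
    unfolding K_neg_def by (simp only: partial_product_eq)
  \<comment> \<open>With exactly \<open>- l\<close> factors the parameter of the tail has moved from
    q^(2l) to 1. This is where \<open>l\<close> must not be positive, as \<open>nat\<close> would
    truncate.\<close>
  also have "?t * Q ^ (2 * nat (- l)) = 1"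
  proof -
    have "q powi (2 * l) * q powi (int (2 * nat (- l))) = q powi (2 * l + int (2 * nat (- l)))"
      by (simp only: power_int_add[OF disjI1[OF Q_nonzero]])
    also have "2 * l + int (2 * nat (- l)) = 0" using assms by simp
    finally have "q powi (2 * l) * q ^ (2 * nat (- l)) = 1" by (simp only: power_int_of_nat power_int_0_right)
    then show ?thesis by (metis of_real_1 of_real_mult of_real_power)
  qed
  finally show ?thesis .
qed

text \<open>Under a functional each component of the difference becomes a complex polynomial with
  infinitely many zeros q^(2l), so each coefficient has value 0; functionals separate
  points.\<close>

lemma polynomial_kernel_unique:
  assumes K: "polynomial_kernel q m n K" and L: "polynomial_kernel q m n L"
    and eq: "\<And>l::int. l \<le> - 1 \<Longrightarrow>
      kernel_eval q m n K (of_real (q powi (2 * l))) = kernel_eval q m n L (of_real (q powi (2 * l)))"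
  shows "K = L"
proof (intro ext)
  fix i j d
  have fin: "finite ({d. K i j d \<noteq> \<zero>\<^bsub>E\<^esub>} \<union> {d. L i j d \<noteq> \<zero>\<^bsub>E\<^esub>})"
    using K L unfolding polynomial_kernel_def by blast
  \<comment> \<open>Including \<open>d\<close> in the maximum guarantees that the coefficient under
    consideration occurs in the polynomial even when it lies beyond both supports.\<close>
  define D where "D = Max (insert d ({d. K i j d \<noteq> \<zero>\<^bsub>E\<^esub>} \<union> {d. L i j d \<noteq> \<zero>\<^bsub>E\<^esub>}))"
  have le: "e \<le> D" if "e = d \<or> K i j e \<noteq> \<zero>\<^bsub>E\<^esub> \<or> L i j e \<noteq> \<zero>\<^bsub>E\<^esub>" for e
    unfolding D_def by (rule Max_ge) (use fin that in auto)
  show "K i j d = L i j d"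
  proof (rule E_eqI)
    show "K i j d \<in> carrier E" "L i j d \<in> carrier E"
      using K L C_closed unfolding polynomial_kernel_def by blast+
    fix \<phi> assume \<phi>: "linear_functional E (carrier E) \<phi>"
    define c where "c e = \<phi> (K i j e) - \<phi> (L i j e)" for e
    \<comment> \<open>With l = -(k+1) the interpolation points are the positive powers of x =
      q^(-2); they are distinct because x > 1.\<close>
    define x where "x = complex_of_real (inverse (q\<^sup>2))"
    have root: "(\<Sum>e\<le>D. c e * (x ^ Suc k) ^ e) = 0" for k
    proof -
      let ?u = "complex_of_real (q powi (2 * (- int (Suc k))))"
      have "q powi (2 * (- int (Suc k))) = inverse (q ^ (2 * Suc k))"
        using power_int_minus[of q "int (2 * Suc k)"] power_int_of_nat[of q "2 * Suc k"] by simp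
      also have "\<dots> = inverse (q\<^sup>2) ^ Suc k" by (simp only: power_inverse power_mult)
      finally have u: "?u = x ^ Suc k" by (simp only: x_def of_real_power)
      have "\<phi> (kernel_eval q m n K ?u i j) = \<phi> (kernel_eval q m n L ?u i j)"
        by (simp only: eq)
      moreover have "\<phi> (kernel_eval q m n K ?u i j) = (\<Sum>e\<le>D. \<phi> (K i j e) * ?u ^ e)"
        by (rule functional_kernel_eval[OF \<phi> K]) (metis le leD)
      moreover have "\<phi> (kernel_eval q m n L ?u i j) = (\<Sum>e\<le>D. \<phi> (L i j e) * ?u ^ e)"
        by (rule functional_kernel_eval[OF \<phi> L]) (metis le leD)
      ultimately show ?thesis unfolding c_def u by (simp add: left_diff_distrib sum_subtractf)
    qed
    have "infinite (range (\<lambda>k. x ^ Suc k))"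
    proof (rule range_inj_infinite, rule injI)
      fix k k' assume "x ^ Suc k = x ^ Suc k'"
      then have "inverse (q\<^sup>2) ^ Suc k = inverse (q\<^sup>2) ^ Suc k'"
        unfolding x_def by (metis of_real_eq_iff of_real_power)
      moreover have "1 < inverse (q\<^sup>2)"
        using q_pos q_less_1 by (simp add: one_less_inverse power_less_one_iff)
      ultimately show "k = k'" by (metis power_inject_exp Suc_inject)
    qed
    moreover have "range (\<lambda>k. x ^ Suc k) \<subseteq> {y. (\<Sum>e\<le>D. c e * y ^ e) = 0}" using root by blast
    ultimately have "infinite {y. (\<Sum>e\<le>D. c e * y ^ e) = 0}" using finite_subset by blast
    then have "c d = 0" unfolding polyfun_finite_roots using le[of d] by blast
    then show "\<phi> (K i j d) = \<phi> (L i j d)" by (simp add: c_def)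
  qed
qed

lemma interpolating_kernel_eq: "interpolating_kernel q m n = lambda_kernel"
  unfolding interpolating_kernel_def
proof (rule the_equality)
  show "polynomial_kernel q m n lambda_kernel \<and>
    (\<forall>l::int. l \<le> - 1 \<longrightarrow> kernel_eval q m n lambda_kernel (of_real (q powi (2 * l))) = K_neg q m n l)"
    using polynomial_lambda_kernel kernel_eval_lambda_kernel K_neg_eq by simp
  fix K assume K: "polynomial_kernel q m n K \<and>
    (\<forall>l::int. l \<le> - 1 \<longrightarrow> kernel_eval q m n K (of_real (q powi (2 * l))) = K_neg q m n l)"
  show "K = lambda_kernel"
    by (rule polynomial_kernel_unique) (use K polynomial_lambda_kernel kernel_eval_lambda_kernel K_neg_eq in simp_all)
qed

lemma K_lambda_eq: "K_lambda q m n lam = prod_series (Q powr (2 * lam)) \<otimes>\<^bsub>S\<^esub> inverse_series 1"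
  by (simp only: K_lambda_def interpolating_kernel_eq kernel_eval_lambda_kernel)

lemma chi_product_0: "chi_product q m n 0 \<in> Units S" "inv\<^bsub>S\<^esub> (chi_product q m n 0) = inverse_series 1"
proof -
  \<comment> \<open>Here \<open>Q powr 0 = 1\<close>, as \<open>Q\<close> is nonzero, so the
    denominator of the product formula is P(1).\<close>
  have eq: "chi_product q m n 0 = prod_series 1" by (simp add: chi_product_eq)
  show "chi_product q m n 0 \<in> Units S"
    unfolding eq Units_def using prod_series_closed[of 1] inverse_series_closed[of 1] prod_inverse_right[of 1] prod_inverse_left[of 1] by blast
  show "inv\<^bsub>S\<^esub> (chi_product q m n 0) = inverse_series 1"
    unfolding eq by (rule S.inv_unique'[symmetric]) (intro prod_series_closed inverse_series_closed prod_inverse_right prod_inverse_left)+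
qed

end

theorem proposition10p3:
  fixes q :: real and m n :: nat
  assumes "0 < q" and "q < 1" and "1 \<le> m" and "m \<le> n"
  shows "(\<forall>k\<in>{1..m}. \<forall>k'\<in>{1..m}.
            chi q m n k \<otimes>\<^bsub>series_algebra q m n\<^esub> chi q m n k' =
            chi q m n k' \<otimes>\<^bsub>series_algebra q m n\<^esub> chi q m n k) \<and>
         (\<forall>lam::complex.
            has_infinite_product q m n (shifted_factor q m n lam) (chi_product q m n lam) \<and>
            chi_product q m n 0 \<in> Units (series_algebra q m n) \<and>
            K_lambda q m n lam =
              chi_product q m n lam \<otimes>\<^bsub>series_algebra q m n\<^esub>
              inv\<^bsub>series_algebra q m n\<^esub> (chi_product q m n 0))"
proof -
  interpret quantum_matrices_unit q m n
    by unfold_locales (use assms in auto)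
  show ?thesis
    using chi_commute chi_product_converges chi_product_0 K_lambda_eq
    by (simp add: chi_product_eq)
qed

end
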